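(* Let $\mathfrak{H}$ be a complex Hilbert space of finite dimension $d$ and let $\Gamma$ be a symmetric $N$-particle state on $\mathfrak{H}^{\otimes N}$. For every $1\le k\le N$ there exists a Borel probability measure $\mu_k$ on the set $\mathcal{S}(\mathfrak{H})$ of one-particle states such that $$\sup_{\Lambda_1,\dots,\Lambda_k\in\mathcal{M}(\mathfrak{H})}\Big\|\Lambda_1\otimes\cdots\otimes\Lambda_k\Big(\Gamma^{(k)}-\int\gamma^{\otimes k}\,d\mu_k(\gamma)\Big)\Big\|_{\mathfrak{S}^1(\mathfrak{H}^{\otimes k})}\le\sqrt{\frac{2(k-1)^2\log d}{N-k+1}}.$$
   Context: $\mathcal{S}(\mathfrak{H})$ is the set of positive trace-class operators on $\mathfrak{H}$ with trace $1$. A symmetric $N$-particle state is $\Gamma\in\mathcal{S}(\mathfrak{H}^{\otimes N})$ with $U_\sigma\Gamma=\Gamma U_\sigma$ for every permutation $\sigma$, where $U_\sigma(u_1\otimes\cdots\otimes u_N)=u_{\sigma(1)}\otimes\cdots\otimes u_{\sigma(N)}$. Its reduced density matrix $\Gamma^{(k)}$ is defined by $\mathrm{tr}(B_k\Gamma^{(k)})=\mathrm{tr}(B_k\otimes\mathbb{1}^{\otimes(N-k)}\Gamma)$ for all bounded $B_k$ on $\mathfrak{H}^{\otimes k}$. A quantum measurement $\Lambda\in\mathcal{M}(\mathfrak{H})$ on a Hilbert space of dimension $d$ is a family $(M_j,e_j)_{j=1}^d$ with $M_j\ge0$, $\sum_jM_j=\mathbb{1}$, and $(e_j)$ an orthonormal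 basis; it acts by $\Lambda(\rho)=\sum_j\mathrm{tr}[M_j\rho]\,|e_j\rangle\langle e_j|$ (extended linearly to trace-class operators). $\Lambda_1\otimes\cdots\otimes\Lambda_k$ is the measurement on $\mathfrak{H}^{\otimes k}$ with operators $M_{j_1,1}\otimes\cdots\otimes M_{j_k,k}$ and vectors $e_{j_1,1}\otimes\cdots\otimes e_{j_k,k}$. $\|\cdot\|_{\mathfrak{S}^1}$ is the trace norm. *)

theory Defs
  imports "HOL-Probability.Probability"
begin

text \<open>Operators on a finite-dimensional Hilbert space with orthonormal basis indexed by a
finite set I are represented by their matrix entries  A x y  (x, y in I).
The one-particle space is C^d with basis indexed by the finite type 'a (d = CARD('a)),
and the k-particle space is its k-fold tensor power, with basis indexed by
lists of length k over 'a.\<close>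

type_synonym ('i) op = "'i \<Rightarrow> 'i \<Rightarrow> complex"

definition mmult :: "'i set \<Rightarrow> 'i op \<Rightarrow> 'i op \<Rightarrow> 'i op" where
  "mmult I A B = (\<lambda>x y. \<Sum>z\<in>I. A x z * B z y)"

definition adj :: "'i op \<Rightarrow> 'i op" where
  "adj A = (\<lambda>x y. cnj (A y x))"

definition idop :: "'i op" where
  "idop = (\<lambda>x y. if x = y then 1 else 0)"

definition tr :: "'i set \<Rightarrow> 'i op \<Rightarrow> complex" where
  "tr I A = (\<Sum>x\<in>I. A x x)"

definition psd :: "'i set \<Rightarrow> 'i op \<Rightarrow> bool" where
  "psd I A \<longleftrightarrow> (\<forall>x\<in>I. \<forall>y\<in>I. A x y = cnj (A y x)) \<and>
     (\<forall>v. 0 \<le> Re (\<Sum>x\<in>I. \<Sum>y\<in>I. cnj (v x) * A x y * v y))"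

definition supported :: "'i set \<Rightarrow> 'i op \<Rightarrow> bool" where
  "supported I A \<longleftrightarrow> (\<forall>x y. x \<notin> I \<or> y \<notin> I \<longrightarrow> A x y = 0)"

definition op_abs :: "'i set \<Rightarrow> 'i op \<Rightarrow> 'i op" where
  "op_abs I A = (THE B. supported I B \<and> psd I B \<and>
      (\<forall>x\<in>I. \<forall>y\<in>I. mmult I B B x y = mmult I (adj A) A x y))"

definition trace_norm :: "'i set \<Rightarrow> 'i op \<Rightarrow> real" where
  "trace_norm I A = Re (tr I (op_abs I A))"

definition states :: "'i set \<Rightarrow> 'i op set" where
  "states I = {\<rho>. psd I \<rho> \<and> tr I \<rho> = 1}"

definition idx :: "nat \<Rightarrow> 'a list set" where
  "idx k = {xs. length xs = k}"

text \<open>U_sigma (u_1 ... u_N) = u_sigma(1) ... u_sigma(N), as a matrix in the product basis\<close>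
definition perm_op :: "nat \<Rightarrow> (nat \<Rightarrow> nat) \<Rightarrow> 'a list op" where
  "perm_op N \<sigma> = (\<lambda>xs ys. if xs = map (\<lambda>j. ys ! \<sigma> j) [0..<N] then 1 else 0)"

definition symmetric_state :: "nat \<Rightarrow> 'a list op \<Rightarrow> bool" where
  "symmetric_state N \<Gamma> \<longleftrightarrow> \<Gamma> \<in> states (idx N) \<and>
     (\<forall>\<sigma>. \<sigma> permutes {..<N} \<longrightarrow>
        (\<forall>xs\<in>idx N. \<forall>ys\<in>idx N.
           mmult (idx N) (perm_op N \<sigma>) \<Gamma> xs ys = mmult (idx N) \<Gamma> (perm_op N \<sigma>) xs ys))"

definition kron :: "nat \<Rightarrow> 'a list op \<Rightarrow> 'a list op \<Rightarrow> 'a list op" where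
  "kron k A B = (\<lambda>xs ys. A (take k xs) (take k ys) * B (drop k xs) (drop k ys))"

definition rdm :: "nat \<Rightarrow> nat \<Rightarrow> 'a list op \<Rightarrow> 'a list op" where
  "rdm N k \<Gamma> = (THE G. supported (idx k) G \<and>
     (\<forall>B. tr (idx k) (mmult (idx k) B G) = tr (idx N) (mmult (idx N) (kron k B idop) \<Gamma>)))"

definition is_measurement :: "'i set \<Rightarrow> 'j set \<Rightarrow> ('j \<Rightarrow> 'i op) \<Rightarrow> ('j \<Rightarrow> 'i \<Rightarrow> complex) \<Rightarrow> bool" where
  "is_measurement I J M e \<longleftrightarrow>
     card J = card I \<and>
     (\<forall>j\<in>J. psd I (M j)) \<and>
     (\<forall>x\<in>I. \<forall>y\<in>I. (\<Sum>j\<in>J. M j x y) = idop x y) \<and>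
     (\<forall>j\<in>J. \<forall>j'\<in>J. (\<Sum>x\<in>I. cnj (e j x) * e j' x) = (if j = j' then 1 else 0))"

definition meas_apply :: "'i set \<Rightarrow> 'j set \<Rightarrow> ('j \<Rightarrow> 'i op) \<Rightarrow> ('j \<Rightarrow> 'i \<Rightarrow> complex) \<Rightarrow> 'i op \<Rightarrow> 'i op" where
  "meas_apply I J M e X = (\<lambda>x y. \<Sum>j\<in>J. tr I (mmult I (M j) X) * e j x * cnj (e j y))"

text \<open>one-particle measurements: outcomes indexed by 'a (d of them)\<close>
type_synonym 'a meas = "('a \<Rightarrow> 'a op) \<times> ('a \<Rightarrow> 'a \<Rightarrow> complex)"

definition one_measurement :: "'a::finite meas \<Rightarrow> bool" where
  "one_measurement \<Lambda> \<longleftrightarrow> is_measurement (UNIV :: 'a set) UNIV (fst \<Lambda>) (snd \<Lambda>)"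

definition tensM :: "nat \<Rightarrow> (nat \<Rightarrow> 'a meas) \<Rightarrow> 'a list \<Rightarrow> 'a list op" where
  "tensM k \<Lambda>s js = (\<lambda>xs ys. \<Prod>i<k. fst (\<Lambda>s i) (js ! i) (xs ! i) (ys ! i))"

definition tensE :: "nat \<Rightarrow> (nat \<Rightarrow> 'a meas) \<Rightarrow> 'a list \<Rightarrow> 'a list \<Rightarrow> complex" where
  "tensE k \<Lambda>s js = (\<lambda>xs. \<Prod>i<k. snd (\<Lambda>s i) (js ! i) (xs ! i))"

definition tensor_meas_apply :: "nat \<Rightarrow> (nat \<Rightarrow> 'a meas) \<Rightarrow> 'a list op \<Rightarrow> 'a list op" where
  "tensor_meas_apply k \<Lambda>s = meas_apply (idx k) (idx k) (tensM k \<Lambda>s) (tensE k \<Lambda>s)"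

definition tpow :: "nat \<Rightarrow> 'a op \<Rightarrow> 'a list op" where
  "tpow k \<gamma> = (\<lambda>xs ys. \<Prod>i<k. \<gamma> (xs ! i) (ys ! i))"

definition tpow_integral :: "nat \<Rightarrow> 'a op measure \<Rightarrow> 'a list op" where
  "tpow_integral k \<mu> = (\<lambda>xs ys. \<integral>\<gamma>. tpow k \<gamma> xs ys \<partial>\<mu>)"

end

theory Submission
  imports Defs "Jordan_Normal_Form.Spectral_Radius"
begin

text \<open>Single out \<open>k - 1\<close> of the \<open>N\<close> particles and measure the remaining
  \<open>n = N - k + 1\<close> ones successively. The entropy of the \<open>k - 1\<close> particles, averaged over the
  outcomes, starts below \<open>(k - 1) log d\<close> and never becomes negative. Unless every measurement of
  the next particle lowers it by at most \<open>(k - 1) log d / n\<close>, perform one that lowers it by more;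
  this must stop at some history of measurements of length less than \<open>n\<close>. Conditioned on the
  outcomes of that history, \<open>k - 1\<close> particles have mutual information at most
  \<open>(k - 1) log d / n\<close> with any measurement of one further particle, so the chain rule bounds the
  relative entropy of the outcomes of \<open>k\<close> local measurements to the product of their marginals by
  \<open>(k - 1)\<^sup>2 log d / n\<close>. Pinsker's inequality concludes, with \<open>\<mu>\<close> the law of the conditioned
  one-particle state; it does not depend on the \<open>k\<close> measurements, as the history does not.

  Passing from quantum to classical information needs that relative entropy decreases under
  measurements. Both sides are integrals over \<open>s\<close> in \<open>[0, 1]\<close> of
  \<open>(1 - s) (a - b)\<^sup>2 / ((1 - s) b + s a)\<close>, summed over outcome probabilities on the classical side
  and over pairs of eigenvalues, weighted by the squared overlaps of the eigenvectors, on the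
  quantum side; the integrands compare pointwise by Cauchy-Schwarz.\<close>

section \<open>Diagonalisation of Hermitian operators\<close>

text \<open>The \<open>k - 1\<close> particles are left unmeasured while the history is built
  because the entropy of their measured outcomes would depend on the very measurements over which
  the supremum is taken. Their quantum entropy does not, and by Holevo's bound its decrease controls
  all local measurements at once. Arguing by contradiction, the choice of the history needs no
  measurement that attains the largest decrease. Exchangeability enters twice: the particle measured
  next may be any particle outside the singled-out ones, and an outcome probability depends only on
  the multiset of effects. The constants: one factor \<open>k - 1\<close> comes from the dimension
  \<open>d ^ (k - 1)\<close>, the other from the chain rule, whose \<open>k\<close> terms include a
  trivial first one; \<open>n\<close> is the number of steps available to the greedy choice, and 2
  is Pinsker's constant. Conditional operators and entropies are kept unnormalised, weighted by the
  probability of the history, so that an average over histories is a plain sum to which a history of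
  probability 0 contributes nothing.\<close>

lemma exists_eigenvector:
  fixes A :: "'i op"
  assumes "finite I" "I \<noteq> {}"
  obtains \<kappa> u where "\<exists>x\<in>I. u x \<noteq> 0" "\<And>x. x \<in> I \<Longrightarrow> (\<Sum>y\<in>I. A x y * u y) = \<kappa> * u x"
proof -
  define n where "n = card I"
  have n0: "n > 0" using assms by (simp add: n_def card_gt_0_iff)
  obtain h where h: "bij_betw h {0..<n} I"
    using ex_bij_betw_nat_finite[OF assms(1)] n_def by blast
  define M where "M = mat n n (\<lambda>(i, j). A (h i) (h j))"
  have M: "M \<in> carrier_mat n n" by (simp add: M_def)
  obtain \<kappa> where "\<kappa> \<in> spectrum M" using spectrum_non_empty[OF M n0] by blast
  then obtain w where w: "eigenvector M w \<kappa>"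
    by (auto simp: spectrum_def eigenvalue_def)
  have wc: "w \<in> carrier_vec n" and w0: "w \<noteq> 0\<^sub>v n" and ev: "M *\<^sub>v w = \<kappa> \<cdot>\<^sub>v w"
    using w M by (auto simp: eigenvector_def)
  define u where "u x = vec_index w (inv_into {0..<n} h x)" for x
  have u_h: "u (h i) = vec_index w i" if "i < n" for i
    using that h by (simp add: u_def bij_betw_inv_into_left)
  have "\<exists>i<n. vec_index w i \<noteq> 0"
    using w0 wc by (metis eq_vecI carrier_vecD index_zero_vec)
  then obtain i where "i < n" "vec_index w i \<noteq> 0" by blast
  then have 1: "\<exists>x\<in>I. u x \<noteq> 0"
    using h u_h by (metis atLeastLessThan_iff bij_betwE le0)
  have 2: "(\<Sum>y\<in>I. A x y * u y) = \<kappa> * u x" if x: "x \<in> I" for x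
  proof -
    obtain i where i: "i < n" "x = h i"
      using x h by (metis atLeastLessThan_iff bij_betw_iff_bijections)
    have "(\<Sum>y\<in>I. A x y * u y) = (\<Sum>j\<in>{0..<n}. A (h i) (h j) * u (h j))"
      unfolding i(2) by (rule sum.reindex_bij_betw[OF h, symmetric])
    also have "\<dots> = (\<Sum>j\<in>{0..<n}. A (h i) (h j) * vec_index w j)"
      by (rule sum.cong) (auto simp: u_h)
    also have "\<dots> = vec_index (M *\<^sub>v w) i"
      using i wc by (simp add: M_def scalar_prod_def)
    also have "\<dots> = \<kappa> * vec_index w i" using ev i wc by simp
    finally show ?thesis using i u_h by simp
  qed
  show ?thesis using that[OF 1 2] .
qed

definition sesq :: "'i set \<Rightarrow> 'i op \<Rightarrow> ('i \<Rightarrow> complex) \<Rightarrow> ('i \<Rightarrow> complex) \<Rightarrow> complex" where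
  "sesq I A f g = (\<Sum>x\<in>I. \<Sum>y\<in>I. cnj (f x) * A x y * g y)"

text \<open>Indexing the eigenvectors by \<open>I\<close> itself lets the diagonalisation proceed by
  induction on \<open>I\<close>. With completeness recorded next to orthonormality, expansions in
  the basis need no dimension count.\<close>

definition eigenbasis :: "'i set \<Rightarrow> 'i op \<Rightarrow> ('i \<Rightarrow> real) \<Rightarrow> ('i \<Rightarrow> 'i \<Rightarrow> complex) \<Rightarrow> bool" where
  "eigenbasis I A b v \<longleftrightarrow>
     (\<forall>i\<in>I. \<forall>j\<in>I. (\<Sum>x\<in>I. cnj (v i x) * v j x) = (if i = j then 1 else 0)) \<and>
     (\<forall>x\<in>I. \<forall>y\<in>I. (\<Sum>i\<in>I. v i x * cnj (v i y)) = (if x = y then 1 else 0)) \<and>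
     (\<forall>x\<in>I. \<forall>y\<in>I. A x y = (\<Sum>i\<in>I. of_real (b i) * v i x * cnj (v i y)))"

lemma cnj_mult_self: "cnj z * z = of_real ((cmod z)\<^sup>2)"
  by (metis complex_norm_square mult.commute of_real_power)

text \<open>Deflation by a Householder reflection \<open>H\<close>: it is self-adjoint, squares to
  the identity and takes the basis vector at \<open>z\<close> to a unit eigenvector, so
  \<open>H A H\<close> decouples the index \<open>z\<close> from \<open>J\<close> and the induction
  hypothesis diagonalises the \<open>J\<close> block.\<close>

lemma hermitian_eigenbasis_exists:
  fixes A :: "'i op"
  assumes "finite I" "\<And>x y. x \<in> I \<Longrightarrow> y \<in> I \<Longrightarrow> A x y = cnj (A y x)"
  shows "\<exists>b v. eigenbasis I A b v"
  using assms
proof (induction I arbitrary: A rule: finite_induct)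
  case empty
  then show ?case by (simp add: eigenbasis_def)
next
  case (insert z J A)
  let ?I = "insert z J"
  have fin: "finite ?I" and zI: "z \<in> ?I" using insert.hyps by auto
  have herm: "A x y = cnj (A y x)" if "x \<in> ?I" "y \<in> ?I" for x y by (rule insert.prems[OF that])
  obtain \<kappa> u0 where u0: "\<exists>x\<in>?I. u0 x \<noteq> 0" "\<And>x. x \<in> ?I \<Longrightarrow> (\<Sum>y\<in>?I. A x y * u0 y) = \<kappa> * u0 x"
    using exists_eigenvector[OF fin, of A] by (metis insert_not_empty)
  define nn where "nn = (\<Sum>x\<in>?I. (cmod (u0 x))\<^sup>2)"
  have nnpos: "nn > 0"
  proof -
    obtain x where "x \<in> ?I" "u0 x \<noteq> 0" using u0 by blast
    then show ?thesis unfolding nn_def by (intro sum_pos2[OF fin, of x]) auto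
  qed
  \<comment> \<open>Normalise the eigenvector so that its z-entry is real and nonpositive; the Householder
    denominator 1 - u z is then at least 1.\<close>
  define ph where "ph = (if u0 z = 0 then 1 else - cnj (u0 z) / of_real (cmod (u0 z))) / of_real (sqrt nn)"
  define u where "u x = ph * u0 x" for x
  have phn: "(cmod ph)\<^sup>2 * nn = 1"
    using nnpos by (simp add: ph_def norm_divide norm_mult power_divide)
  have unorm: "(\<Sum>x\<in>?I. cnj (u x) * u x) = 1"
  proof -
    have "(\<Sum>x\<in>?I. cnj (u x) * u x) = (\<Sum>x\<in>?I. of_real ((cmod ph)\<^sup>2 * (cmod (u0 x))\<^sup>2))"
      by (intro sum.cong refl) (simp only: cnj_mult_self u_def norm_mult power_mult_distrib)
    also have "\<dots> = of_real ((cmod ph)\<^sup>2 * nn)" by (simp only: nn_def sum_distrib_left of_real_sum)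
    finally show ?thesis using phn by simp
  qed
  have uev: "(\<Sum>y\<in>?I. A x y * u y) = \<kappa> * u x" if "x \<in> ?I" for x
    using u0(2)[OF that] by (simp add: u_def sum_distrib_left[symmetric] mult.left_commute del: sum.insert)
  define r where "r = - cmod (u0 z) / sqrt nn"
  have uz: "u z = of_real r"
  proof (cases "u0 z = 0")
    case False
    have "cnj (u0 z) * u0 z = of_real (cmod (u0 z)) * of_real (cmod (u0 z))"
      by (simp add: cnj_mult_self power2_eq_square)
    then show ?thesis using False by (simp add: u_def ph_def r_def field_simps)
  qed (simp add: u_def r_def)
  define s where "s = 1 - r"
  have s1: "s > 0" using nnpos by (simp add: s_def r_def add_pos_nonneg)
  define w where "w x = (if x = z then 1 else 0) - u x" for x
  \<comment> \<open>The usual coefficient 2 / |w|^2 of a reflection is \<open>1 / s\<close>: the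
    difference \<open>w\<close> of the basis vector at \<open>z\<close> and the unit vector
    \<open>u\<close> has squared norm \<open>2 * s\<close>.\<close>
  define H where "H x y = (if x = y then 1 else 0) - w x * cnj (w y) / of_real s" for x y
  have wz: "w z = of_real s" by (simp add: w_def uz s_def)
  have sumd: "(\<Sum>x\<in>?I. (if x = y then 1 else 0) * f x) = (f y :: complex)"
       "(\<Sum>x\<in>?I. f x * (if x = y then 1 else 0)) = (f y :: complex)"
       "(\<Sum>x\<in>?I. (if y = x then 1 else 0) * f x) = (f y :: complex)"
       "(\<Sum>x\<in>?I. f x * (if y = x then 1 else 0)) = (f y :: complex)" if "y \<in> ?I" for y f
    using fin that by (simp_all add: if_distrib if_distribR cong: if_cong)
  have wnorm: "(\<Sum>x\<in>?I. cnj (w x) * w x) = 2 * of_real s"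
  proof -
    have "(\<Sum>x\<in>?I. cnj (w x) * w x) = (\<Sum>x\<in>?I. (if x = z then 1 else 0) * (1 - u x - cnj (u x)) + cnj (u x) * u x)"
      by (rule sum.cong) (auto simp: w_def algebra_simps)
    also have "\<dots> = 1 - u z - cnj (u z) + 1"
      unfolding sum.distrib sumd[OF zI] unorm ..
    finally show ?thesis by (simp add: uz s_def)
  qed
  have Hsym: "cnj (H x y) = H y x" for x y by (simp add: H_def mult.commute)
  have HH: "(\<Sum>y\<in>?I. H x y * H y t) = (if x = t then 1 else 0)" if "x \<in> ?I" "t \<in> ?I" for x t
  proof -
    have "(\<Sum>y\<in>?I. H x y * H y t) = (\<Sum>y\<in>?I. (if x = y then 1 else 0) * H y t
       - w x / of_real s * (cnj (w y) * (if y = t then 1 else 0)) + w x * cnj (w t) / (of_real s * of_real s) * (cnj (w y) * w y))"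
      by (rule sum.cong) (auto simp: H_def algebra_simps)
    also have "\<dots> = H x t - w x / of_real s * cnj (w t) + w x * cnj (w t) / (of_real s * of_real s) * (2 * of_real s)"
      unfolding sum.distrib sum_subtractf sumd[OF that(1)] sum_distrib_left[symmetric] sumd[OF that(2)] wnorm ..
    finally show ?thesis using s1 by (simp add: H_def field_simps)
  qed
  have Hz: "H x z = u x" for x using s1 by (simp add: H_def wz) (auto simp: w_def uz s_def)
  define A' where "A' x y = (\<Sum>p\<in>?I. \<Sum>q\<in>?I. H x p * A p q * H q y)" for x y
  have A'z: "A' x z = (if x = z then \<kappa> else 0)" if "x \<in> ?I" for x
  proof -
    have "A' x z = (\<Sum>p\<in>?I. H x p * (\<Sum>q\<in>?I. A p q * u q))"
      unfolding A'_def Hz sum_distrib_left by (simp add: mult.assoc del: sum.insert)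
    also have "\<dots> = (\<Sum>p\<in>?I. \<kappa> * (H x p * H p z))"
      by (rule sum.cong) (simp_all add: uev Hz del: sum.insert)
    also have "\<dots> = \<kappa> * (if x = z then 1 else 0)" unfolding sum_distrib_left[symmetric] HH[OF that zI] ..
    finally show ?thesis by simp
  qed
  have A'herm: "A' x y = cnj (A' y x)" for x y
  proof -
    have "cnj (A' y x) = (\<Sum>p\<in>?I. \<Sum>q\<in>?I. H x q * A q p * H p y)"
      unfolding A'_def cnj_sum complex_cnj_mult Hsym
      by (intro sum.cong refl) (subst herm, auto simp: mult_ac)
    also have "\<dots> = A' x y" unfolding A'_def by (rule sum.swap)
    finally show ?thesis ..
  qed
  \<comment> \<open>The eigenvalue is a diagonal entry of the Hermitian matrix
    \<open>A'\<close>.\<close>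
  have lreal: "\<kappa> = of_real (Re \<kappa>)"
    using A'herm[of z z] A'z[OF zI] by (simp add: complex_eq_iff)
  obtain b v where "eigenbasis J A' b v" using insert.IH[of A', OF A'herm] by blast
  then have vo: "\<And>i j. i\<in>J \<Longrightarrow> j\<in>J \<Longrightarrow> (\<Sum>x\<in>J. cnj (v i x) * v j x) = (if i = j then 1 else 0)"
    and vc: "\<And>x y. x\<in>J \<Longrightarrow> y\<in>J \<Longrightarrow> (\<Sum>i\<in>J. v i x * cnj (v i y)) = (if x = y then 1 else 0)"
    and vd: "\<And>x y. x\<in>J \<Longrightarrow> y\<in>J \<Longrightarrow> A' x y = (\<Sum>i\<in>J. of_real (b i) * v i x * cnj (v i y))"
    by (auto simp: eigenbasis_def)
  define b' where "b' i = (if i = z then Re \<kappa> else b i)" for i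
  define v' where "v' i x = (if i = z then (if x = z then 1 else 0) else if x = z then 0 else v i x)" for i x
  have zJ: "z \<notin> J" "finite J" using insert.hyps by auto
  have Jz: "x \<noteq> z" if "x \<in> J" for x using that zJ by auto
  have v'o: "(\<Sum>x\<in>?I. cnj (v' i x) * v' j x) = (if i = j then 1 else 0)" if "i \<in> ?I" "j \<in> ?I" for i j
  proof -
    have "(\<Sum>x\<in>J. cnj (v' i x) * v' j x) = (if i = z \<or> j = z then 0 else (\<Sum>x\<in>J. cnj (v i x) * v j x))"
      using zJ by (auto simp: v'_def intro!: sum.neutral sum.cong)
    then show ?thesis using that zJ vo by (auto simp: v'_def)
  qed
  have v'c: "(\<Sum>i\<in>?I. v' i x * cnj (v' i y)) = (if x = y then 1 else 0)" if "x \<in> ?I" "y \<in> ?I" for x y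
  proof -
    have "(\<Sum>i\<in>J. v' i x * cnj (v' i y)) = (if x = z \<or> y = z then 0 else (\<Sum>i\<in>J. v i x * cnj (v i y)))"
      using zJ by (auto simp: v'_def intro!: sum.neutral sum.cong)
    then show ?thesis using that zJ vc by (auto simp: v'_def)
  qed
  have v'd: "A' x y = (\<Sum>i\<in>?I. of_real (b' i) * v' i x * cnj (v' i y))" if "x \<in> ?I" "y \<in> ?I" for x y
  proof -
    have "(\<Sum>i\<in>J. of_real (b' i) * v' i x * cnj (v' i y)) = (if x = z \<or> y = z then 0 else (\<Sum>i\<in>J. of_real (b i) * v i x * cnj (v i y)))"
      using zJ by (auto simp: v'_def b'_def intro!: sum.neutral sum.cong)
    moreover have "A' z y = (if y = z then \<kappa> else 0)" using A'herm[of z y] A'z[OF that(2)] lreal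
      by (metis complex_cnj_complex_of_real complex_cnj_zero)
    ultimately show ?thesis using that zJ vd A'z[OF that(1)] lreal by (auto simp: v'_def b'_def)
  qed
  define V where "V i x = (\<Sum>p\<in>?I. H x p * v' i p)" for i x
  have cV: "cnj (V i x) = (\<Sum>p\<in>?I. cnj (v' i p) * H p x)" for i x
    unfolding V_def cnj_sum complex_cnj_mult Hsym by (simp add: mult.commute del: sum.insert)
  have 1: "(\<Sum>x\<in>?I. cnj (V i x) * V j x) = (if i = j then 1 else 0)" if "i \<in> ?I" "j \<in> ?I" for i j
  proof -
    have "(\<Sum>x\<in>?I. cnj (V i x) * V j x) = (\<Sum>x\<in>?I. \<Sum>p\<in>?I. \<Sum>q\<in>?I. cnj (v' i p) * v' j q * (H p x * H x q))"
      unfolding cV unfolding V_def sum_product by (simp add: mult_ac del: sum.insert)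
    also have "\<dots> = (\<Sum>p\<in>?I. \<Sum>x\<in>?I. \<Sum>q\<in>?I. cnj (v' i p) * v' j q * (H p x * H x q))" by (rule sum.swap)
    also have "\<dots> = (\<Sum>p\<in>?I. \<Sum>q\<in>?I. \<Sum>x\<in>?I. cnj (v' i p) * v' j q * (H p x * H x q))"
      by (intro sum.cong refl sum.swap)
    also have "\<dots> = (\<Sum>p\<in>?I. \<Sum>q\<in>?I. cnj (v' i p) * v' j q * (if p = q then 1 else 0))"
      unfolding sum_distrib_left[symmetric] by (intro sum.cong refl) (simp only: HH)
    also have "\<dots> = (\<Sum>p\<in>?I. cnj (v' i p) * v' j p)"
      by (intro sum.cong refl sumd)
    finally show ?thesis using v'o that by simp
  qed
  have comb: "(\<Sum>i\<in>?I. c i * V i x * cnj (V i y)) = (\<Sum>p\<in>?I. \<Sum>q\<in>?I. H x p * (\<Sum>i\<in>?I. c i * v' i p * cnj (v' i q)) * H q y)" for c x y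
  proof -
    have "(\<Sum>i\<in>?I. c i * V i x * cnj (V i y)) = (\<Sum>i\<in>?I. \<Sum>p\<in>?I. \<Sum>q\<in>?I. H x p * (c i * v' i p * cnj (v' i q)) * H q y)"
      unfolding mult.assoc[of "c _"] cV unfolding V_def sum_product unfolding sum_distrib_left by (simp add: mult_ac del: sum.insert)
    also have "\<dots> = (\<Sum>p\<in>?I. \<Sum>i\<in>?I. \<Sum>q\<in>?I. H x p * (c i * v' i p * cnj (v' i q)) * H q y)" by (rule sum.swap)
    also have "\<dots> = (\<Sum>p\<in>?I. \<Sum>q\<in>?I. \<Sum>i\<in>?I. H x p * (c i * v' i p * cnj (v' i q)) * H q y)"
      by (intro sum.cong refl sum.swap)
    finally show ?thesis by (simp add: sum_distrib_left sum_distrib_right del: sum.insert)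
  qed
  have 2: "(\<Sum>i\<in>?I. V i x * cnj (V i y)) = (if x = y then 1 else 0)" if "x \<in> ?I" "y \<in> ?I" for x y
  proof -
    have "(\<Sum>i\<in>?I. V i x * cnj (V i y)) = (\<Sum>p\<in>?I. \<Sum>q\<in>?I. H x p * (if p = q then 1 else 0) * H q y)"
      using comb[of "\<lambda>_. 1" x y] unfolding mult_1 by (rule trans) (intro sum.cong refl, simp only: v'c)
    also have "\<dots> = (\<Sum>p\<in>?I. H x p * H p y)"
      by (intro sum.cong refl) (simp only: mult.assoc sum_distrib_left[symmetric] sumd)
    finally show ?thesis using HH that by simp
  qed
  have 3: "A x y = (\<Sum>i\<in>?I. of_real (b' i) * V i x * cnj (V i y))" if xy: "x \<in> ?I" "y \<in> ?I" for x y
  proof -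
    have "(\<Sum>i\<in>?I. of_real (b' i) * V i x * cnj (V i y)) = (\<Sum>p\<in>?I. \<Sum>q\<in>?I. H x p * A' p q * H q y)"
      unfolding comb by (intro sum.cong refl) (simp only: v'd)
    also have "\<dots> = (\<Sum>p\<in>?I. \<Sum>q\<in>?I. \<Sum>m\<in>?I. \<Sum>l\<in>?I. (H x p * H p m) * A m l * (H l q * H q y))"
      unfolding A'_def sum_distrib_left sum_distrib_right by (simp add: mult_ac del: sum.insert)
    also have "\<dots> = (\<Sum>p\<in>?I. \<Sum>m\<in>?I. \<Sum>l\<in>?I. \<Sum>q\<in>?I. (H x p * H p m) * A m l * (H l q * H q y))"
      by (rule sum.cong[OF refl], rule trans[OF sum.swap], intro sum.cong refl sum.swap)
    also have "\<dots> = (\<Sum>p\<in>?I. \<Sum>m\<in>?I. \<Sum>l\<in>?I. (H x p * H p m) * A m l * (if l = y then 1 else 0))"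
      unfolding sum_distrib_left[symmetric] by (intro sum.cong refl) (simp only: HH xy)
    also have "\<dots> = (\<Sum>p\<in>?I. \<Sum>m\<in>?I. (H x p * H p m) * A m y)"
      by (intro sum.cong refl sumd xy)
    also have "\<dots> = (\<Sum>m\<in>?I. (\<Sum>p\<in>?I. H x p * H p m) * A m y)"
      by (subst sum.swap) (simp add: sum_distrib_right del: sum.insert)
    also have "\<dots> = (\<Sum>m\<in>?I. (if x = m then 1 else 0) * A m y)"
      by (intro sum.cong refl) (simp only: HH xy)
    also have "\<dots> = A x y" by (rule sumd[OF xy(1)])
    finally show ?thesis ..
  qed
  show ?case unfolding eigenbasis_def using 1 2 3 by blast
qed

section \<open>Pinsker's inequality\<close>

text \<open>Taylor's formula with integral remainder for \<open>x * ln x\<close>, whose second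
  derivative is \<open>1 / x\<close>, expanded at \<open>b\<close> and evaluated at
  \<open>a\<close>. The primitive \<open>F\<close> is the first-order Taylor polynomial at the
  moving base point \<open>(1 - s) * b + s * a\<close>, evaluated at \<open>a\<close>.\<close>

lemma kl_integrand_has_integral:
  fixes a b :: real
  assumes "0 \<le> a" "0 \<le> b" "b = 0 \<Longrightarrow> a = 0"
  shows "((\<lambda>s. (1 - s) * (a - b)\<^sup>2 / ((1 - s) * b + s * a)) has_integral
           (a * ln a - a * ln b - a + b)) {0..1}"
proof -
  consider "b = 0" | "a = 0" "b > 0" | "a > 0" "b > 0" using assms by fastforce
  then show ?thesis
  proof cases
    case 1
    then show ?thesis using assms by simp
  next
    case 2
    \<comment> \<open>For \<open>a = 0\<close> the integrand is constantly \<open>b\<close> except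
      at \<open>s = 1\<close>, where its numerator vanishes.\<close>
    have "((\<lambda>s. (1 - s) * (a - b)\<^sup>2 / ((1 - s) * b + s * a)) has_integral b) {0..1} \<longleftrightarrow>
          ((\<lambda>s::real. b) has_integral b) {0..1}"
      by (rule has_integral_spike_eq[of "{1}"]) (use 2 in \<open>auto simp: field_simps power2_eq_square\<close>)
    then show ?thesis using 2 has_integral_const_real[of b 0 1] by simp
  next
    case 3
    define F where "F s = (1 - s) * (a - b) * (ln ((1 - s) * b + s * a) + 1)
        + ((1 - s) * b + s * a) * ln ((1 - s) * b + s * a)" for s
    have pos: "(1 - s) * b + s * a > 0" if "s \<in> {0..1}" for s
      using 3 that by (cases "s = 0") (auto intro!: add_nonneg_pos)
    have "((\<lambda>s. (1 - s) * (a - b)\<^sup>2 / ((1 - s) * b + s * a)) has_integral (F 1 - F 0)) {0..1}"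
    proof (rule fundamental_theorem_of_calculus)
      fix s :: real assume s: "s \<in> {0..1}"
      define r where "r = (1 - s) * b + s * a"
      have r: "r > 0" using pos[OF s] by (simp add: r_def)
      have dR: "((\<lambda>s. (1 - s) * b + s * a) has_real_derivative (a - b)) (at s)"
        by (auto intro!: derivative_eq_intros)
      have dln: "((\<lambda>s. ln ((1 - s) * b + s * a)) has_real_derivative (a - b) / r) (at s)"
        using DERIV_chain2[OF DERIV_ln dR, folded r_def] r by (simp add: divide_inverse mult.commute)
      have "(F has_real_derivative
          (- (a - b)) * (ln r + 1) + (1 - s) * (a - b) * ((a - b) / r) + ((a - b) * ln r + r * ((a - b) / r))) (at s)"
        unfolding F_def by (rule derivative_eq_intros dln dR refl)+ (simp add: r_def)
      moreover have "(- (a - b)) * (ln r + 1) + (1 - s) * (a - b) * ((a - b) / r) + ((a - b) * ln r + r * ((a - b) / r))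
          = (1 - s) * (a - b)\<^sup>2 / r"
        using r by (simp add: field_simps power2_eq_square)
      ultimately have "(F has_real_derivative (1 - s) * (a - b)\<^sup>2 / r) (at s)" by simp
      then show "(F has_vector_derivative (1 - s) * (a - b)\<^sup>2 / ((1 - s) * b + s * a)) (at s within {0..1})"
        unfolding r_def has_real_derivative_iff_has_vector_derivative
        by (rule has_vector_derivative_at_within)
    qed simp
    moreover have "F 1 - F 0 = a * ln a - a * ln b - a + b"
      by (simp add: F_def algebra_simps)
    ultimately show ?thesis by simp
  qed
qed

text \<open>Cauchy-Schwarz for \<open>\<bar>f z\<bar> / sqrt (g z)\<close> and
  \<open>sqrt (g z)\<close>. Where \<open>g\<close> vanishes so does \<open>f\<close>, and the
  summand \<open>0 / 0\<close> is 0.\<close>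

lemma sum_divide_Cauchy_Schwarz:
  fixes f g :: "'z \<Rightarrow> real"
  assumes "finite Z" "\<And>z. z \<in> Z \<Longrightarrow> 0 \<le> g z" "\<And>z. z \<in> Z \<Longrightarrow> g z = 0 \<Longrightarrow> f z = 0"
  shows "(\<Sum>z\<in>Z. \<bar>f z\<bar>)\<^sup>2 \<le> (\<Sum>z\<in>Z. (f z)\<^sup>2 / g z) * (\<Sum>z\<in>Z. g z)"
proof -
  have "(\<Sum>z\<in>Z. \<bar>f z\<bar>) = (\<Sum>z\<in>Z. (\<bar>f z\<bar> / sqrt (g z)) * sqrt (g z))"
    using assms by (intro sum.cong refl) auto
  then have "(\<Sum>z\<in>Z. \<bar>f z\<bar>)\<^sup>2 \<le> (\<Sum>z\<in>Z. (\<bar>f z\<bar> / sqrt (g z))\<^sup>2) * (\<Sum>z\<in>Z. (sqrt (g z))\<^sup>2)"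
    using Cauchy_Schwarz_ineq_sum[of "\<lambda>z. \<bar>f z\<bar> / sqrt (g z)" "\<lambda>z. sqrt (g z)" Z] by simp
  also have "\<dots> = (\<Sum>z\<in>Z. (f z)\<^sup>2 / g z) * (\<Sum>z\<in>Z. g z)"
    using assms by (simp add: power_divide)
  finally show ?thesis .
qed

text \<open>For each \<open>s\<close> the mixture \<open>(1 - s) * Q z + s * P z\<close> has total
  mass 1, so Cauchy-Schwarz bounds the integrand of the relative entropy from below by
  \<open>1 - s\<close> times the squared distance. The integral of \<open>1 - s\<close> is 1/2,
  whence the factor 2.\<close>

lemma pinsker:
  fixes P Q :: "'z \<Rightarrow> real"
  assumes fin: "finite Z" and P: "\<And>z. z \<in> Z \<Longrightarrow> 0 \<le> P z" and Q: "\<And>z. z \<in> Z \<Longrightarrow> 0 \<le> Q z"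
    and abs_cont: "\<And>z. z \<in> Z \<Longrightarrow> Q z = 0 \<Longrightarrow> P z = 0"
    and "sum P Z = 1" "sum Q Z = 1"
  shows "(\<Sum>z\<in>Z. \<bar>P z - Q z\<bar>)\<^sup>2 \<le> 2 * (\<Sum>z\<in>Z. P z * ln (P z) - P z * ln (Q z))"
proof -
  let ?n = "(\<Sum>z\<in>Z. \<bar>P z - Q z\<bar>)\<^sup>2"
  let ?f = "\<lambda>s. \<Sum>z\<in>Z. (1 - s) * (P z - Q z)\<^sup>2 / ((1 - s) * Q z + s * P z)"
  have 1: "(?f has_integral (\<Sum>z\<in>Z. P z * ln (P z) - P z * ln (Q z) - P z + Q z)) {0..1}"
    by (intro has_integral_sum[OF fin] kl_integrand_has_integral P Q abs_cont)
  have "((\<lambda>s. s - s\<^sup>2 / 2) has_vector_derivative (1 - s)) (at s within {0..1})" for s :: real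
    unfolding has_real_derivative_iff_has_vector_derivative[symmetric]
    by (auto intro!: derivative_eq_intros)
  then have "((\<lambda>s::real. 1 - s) has_integral ((1 - 1\<^sup>2 / 2) - (0 - 0\<^sup>2 / 2))) {0..1}"
    by (intro fundamental_theorem_of_calculus) auto
  then have "((\<lambda>s::real. 1 - s) has_integral (1 / 2)) {0..1}" by simp
  then have 2: "((\<lambda>s::real. (1 - s) * ?n) has_integral (1 / 2 * ?n)) {0..1}"
    by (rule has_integral_mult_left)
  have "1 / 2 * ?n \<le> (\<Sum>z\<in>Z. P z * ln (P z) - P z * ln (Q z) - P z + Q z)"
  proof (rule has_integral_le[OF 2 1])
    fix s :: real assume s: "s \<in> {0..1}"
    show "(1 - s) * ?n \<le> ?f s"
    proof (cases "s = 1")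
      case False
      then have s1: "s < 1" "0 \<le> s" using s by auto
      have "?n \<le> (\<Sum>z\<in>Z. (P z - Q z)\<^sup>2 / ((1 - s) * Q z + s * P z)) * (\<Sum>z\<in>Z. (1 - s) * Q z + s * P z)"
      proof (rule sum_divide_Cauchy_Schwarz[OF fin])
        fix z assume z: "z \<in> Z"
        show "0 \<le> (1 - s) * Q z + s * P z" using s1 P[OF z] Q[OF z] by simp
        assume "(1 - s) * Q z + s * P z = 0"
        then have "(1 - s) * Q z = 0" using s1 P[OF z] Q[OF z]
          by (smt (verit) mult_nonneg_nonneg)
        then have "Q z = 0" using s1 by simp
        then show "P z - Q z = 0" using abs_cont[OF z] by simp
      qed
      also have "(\<Sum>z\<in>Z. (1 - s) * Q z + s * P z) = 1"
        using assms by (simp add: sum.distrib sum_distrib_left[symmetric])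
      finally have "(1 - s) * ?n \<le> (1 - s) * (\<Sum>z\<in>Z. (P z - Q z)\<^sup>2 / ((1 - s) * Q z + s * P z))"
        using s1 by (simp add: mult_left_mono)
      then show ?thesis by (simp add: sum_distrib_left)
    qed simp
  qed
  then show ?thesis using assms by (simp add: sum.distrib sum_subtractf)
qed

section \<open>Measured relative entropy\<close>

lemma sesq_cong:
  assumes "\<And>x. x \<in> I \<Longrightarrow> f x = f' x" "\<And>x. x \<in> I \<Longrightarrow> g x = g' x"
  shows "sesq I A f g = sesq I A f' g'"
  unfolding sesq_def by (intro sum.cong refl) (simp add: assms)

lemma sesq_sum_right:
  "sesq I A f (\<lambda>x. \<Sum>i\<in>S. c i * h i x) = (\<Sum>i\<in>S. c i * sesq I A f (h i))"
proof -
  have "sesq I A f (\<lambda>x. \<Sum>i\<in>S. c i * h i x) = (\<Sum>x\<in>I. \<Sum>y\<in>I. \<Sum>i\<in>S. c i * (cnj (f x) * A x y * h i y))"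
    unfolding sesq_def sum_distrib_left by (simp add: mult_ac)
  also have "\<dots> = (\<Sum>x\<in>I. \<Sum>i\<in>S. \<Sum>y\<in>I. c i * (cnj (f x) * A x y * h i y))"
    by (intro sum.cong refl sum.swap)
  also have "\<dots> = (\<Sum>i\<in>S. \<Sum>x\<in>I. \<Sum>y\<in>I. c i * (cnj (f x) * A x y * h i y))" by (rule sum.swap)
  finally show ?thesis by (simp add: sesq_def sum_distrib_left)
qed

lemma sesq_sum_left:
  "sesq I A (\<lambda>x. \<Sum>i\<in>S. c i * h i x) g = (\<Sum>i\<in>S. cnj (c i) * sesq I A (h i) g)"
proof -
  have "sesq I A (\<lambda>x. \<Sum>i\<in>S. c i * h i x) g = (\<Sum>x\<in>I. \<Sum>y\<in>I. \<Sum>i\<in>S. cnj (c i) * (cnj (h i x) * A x y * g y))"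
    unfolding sesq_def cnj_sum sum_distrib_left sum_distrib_right by (simp add: mult_ac)
  also have "\<dots> = (\<Sum>x\<in>I. \<Sum>i\<in>S. \<Sum>y\<in>I. cnj (c i) * (cnj (h i x) * A x y * g y))"
    by (intro sum.cong refl sum.swap)
  also have "\<dots> = (\<Sum>i\<in>S. \<Sum>x\<in>I. \<Sum>y\<in>I. cnj (c i) * (cnj (h i x) * A x y * g y))" by (rule sum.swap)
  finally show ?thesis by (simp add: sesq_def sum_distrib_left)
qed

lemma psd_sesq_nonneg: "psd I A \<Longrightarrow> 0 \<le> Re (sesq I A f f)"
  unfolding psd_def sesq_def by blast

lemma psd_hermitian: "psd I A \<Longrightarrow> x \<in> I \<Longrightarrow> y \<in> I \<Longrightarrow> A x y = cnj (A y x)"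
  unfolding psd_def by blast

lemma psd_sesq_cnj:
  assumes "psd I A"
  shows "cnj (sesq I A f g) = sesq I A g f"
proof -
  have "cnj (sesq I A f g) = (\<Sum>x\<in>I. \<Sum>y\<in>I. cnj (g y) * A y x * f x)"
    unfolding sesq_def cnj_sum complex_cnj_mult
    by (intro sum.cong refl) (simp add: psd_hermitian[OF assms, symmetric] mult_ac)
  also have "\<dots> = sesq I A g f" unfolding sesq_def by (rule sum.swap)
  finally show ?thesis .
qed

lemma psd_sesq_commute_Re:
  "psd I A \<Longrightarrow> Re (sesq I A f g) = Re (sesq I A g f)"
  using arg_cong[OF psd_sesq_cnj[of I A f g], of Re] by simp

lemma sesq_diff_quadratic:
  assumes "psd I A"
  shows "Re (sesq I A (\<lambda>x. f x - of_real t * g x) (\<lambda>x. f x - of_real t * g x)) =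
    Re (sesq I A f f) - 2 * t * Re (sesq I A f g) + t\<^sup>2 * Re (sesq I A g g)"
proof -
  have "sesq I A (\<lambda>x. f x - of_real t * g x) (\<lambda>x. f x - of_real t * g x) =
     sesq I A f f - of_real t * sesq I A f g - of_real t * sesq I A g f + of_real (t\<^sup>2) * sesq I A g g"
    unfolding sesq_def sum_distrib_left sum_subtractf[symmetric] sum.distrib[symmetric]
    by (intro sum.cong refl) (simp add: algebra_simps power2_eq_square)
  then show ?thesis using psd_sesq_commute_Re[OF assms, of g f]
    by (simp del: of_real_power)
qed

text \<open>The Born probability of the effect \<open>E\<close> in the state \<open>A\<close>,
  unnormalised if \<open>A\<close> is.\<close>

definition tq :: "'i set \<Rightarrow> 'i op \<Rightarrow> 'i op \<Rightarrow> real" where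
  "tq I E A = Re (tr I (mmult I E A))"

lemma eigenbasis_orth:
  "eigenbasis I A b v \<Longrightarrow> i \<in> I \<Longrightarrow> j \<in> I \<Longrightarrow> (\<Sum>x\<in>I. cnj (v i x) * v j x) = (if i = j then 1 else 0)"
  by (simp add: eigenbasis_def)

lemma eigenbasis_complete:
  "eigenbasis I A b v \<Longrightarrow> x \<in> I \<Longrightarrow> y \<in> I \<Longrightarrow> (\<Sum>i\<in>I. v i x * cnj (v i y)) = (if x = y then 1 else 0)"
  by (simp add: eigenbasis_def)

lemma eigenbasis_sesq:
  assumes "eigenbasis I A b v"
  shows "sesq I A f g = (\<Sum>i\<in>I. of_real (b i) * (\<Sum>x\<in>I. cnj (f x) * v i x) * (\<Sum>y\<in>I. cnj (v i y) * g y))"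
proof -
  have "sesq I A f g = (\<Sum>x\<in>I. \<Sum>y\<in>I. \<Sum>i\<in>I. of_real (b i) * ((cnj (f x) * v i x) * (cnj (v i y) * g y)))"
    unfolding sesq_def using assms
    by (intro sum.cong refl) (simp add: eigenbasis_def sum_distrib_left sum_distrib_right mult_ac)
  also have "\<dots> = (\<Sum>x\<in>I. \<Sum>i\<in>I. \<Sum>y\<in>I. of_real (b i) * ((cnj (f x) * v i x) * (cnj (v i y) * g y)))"
    by (intro sum.cong refl sum.swap)
  also have "\<dots> = (\<Sum>i\<in>I. \<Sum>x\<in>I. \<Sum>y\<in>I. of_real (b i) * ((cnj (f x) * v i x) * (cnj (v i y) * g y)))"
    by (rule sum.swap)
  also have "\<dots> = (\<Sum>i\<in>I. of_real (b i) * ((\<Sum>x\<in>I. cnj (f x) * v i x) * (\<Sum>y\<in>I. cnj (v i y) * g y)))"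
    unfolding sum_product unfolding sum_distrib_left ..
  finally show ?thesis by (simp add: mult.assoc)
qed

lemma eigenbasis_eigenvalue:
  assumes "finite I" "eigenbasis I A b v" "i \<in> I"
  shows "sesq I A (v i) (v i) = of_real (b i)"
proof -
  have "sesq I A (v i) (v i) = (\<Sum>j\<in>I. of_real (b j) * (if i = j then 1 else 0) * (if j = i then 1 else 0))"
    unfolding eigenbasis_sesq[OF assms(2)] using assms
    by (intro sum.cong refl) (simp only: eigenbasis_orth)
  also have "\<dots> = (\<Sum>j\<in>I. if i = j then of_real (b j) else 0)" by (intro sum.cong refl) auto
  finally show ?thesis using assms by simp
qed

lemma eigenbasis_psd_nonneg:
  assumes "finite I" "psd I A" "eigenbasis I A b v" "i \<in> I"
  shows "0 \<le> b i"
  using psd_sesq_nonneg[OF assms(2), of "v i"] eigenbasis_eigenvalue[OF assms(1,3,4)] by simp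

lemma eigenbasis_tq:
  assumes "eigenbasis I A b v"
  shows "tq I E A = (\<Sum>i\<in>I. b i * Re (sesq I E (v i) (v i)))"
proof -
  have "tr I (mmult I E A) = (\<Sum>x\<in>I. \<Sum>y\<in>I. \<Sum>i\<in>I. of_real (b i) * (cnj (v i x) * E x y * v i y))"
    unfolding tr_def mmult_def using assms
    by (intro sum.cong refl) (simp add: eigenbasis_def sum_distrib_left mult_ac)
  also have "\<dots> = (\<Sum>x\<in>I. \<Sum>i\<in>I. \<Sum>y\<in>I. of_real (b i) * (cnj (v i x) * E x y * v i y))"
    by (intro sum.cong refl sum.swap)
  also have "\<dots> = (\<Sum>i\<in>I. \<Sum>x\<in>I. \<Sum>y\<in>I. of_real (b i) * (cnj (v i x) * E x y * v i y))"
    by (rule sum.swap)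
  also have "\<dots> = (\<Sum>i\<in>I. of_real (b i) * sesq I E (v i) (v i))"
    unfolding sesq_def sum_distrib_left ..
  finally show ?thesis by (simp add: tq_def)
qed

lemma eigenbasis_trace:
  assumes "finite I" "eigenbasis I A b v"
  shows "tr I A = of_real (\<Sum>i\<in>I. b i)"
proof -
  have "tr I A = (\<Sum>x\<in>I. \<Sum>i\<in>I. of_real (b i) * (cnj (v i x) * v i x))"
    unfolding tr_def using assms by (intro sum.cong refl) (simp add: eigenbasis_def mult_ac)
  also have "\<dots> = (\<Sum>i\<in>I. \<Sum>x\<in>I. of_real (b i) * (cnj (v i x) * v i x))" by (rule sum.swap)
  also have "\<dots> = (\<Sum>i\<in>I. of_real (b i) * 1)"
    unfolding sum_distrib_left[symmetric] by (intro sum.cong refl) (simp add: eigenbasis_orth[OF assms(2)])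
  finally show ?thesis by simp
qed

lemma psd_eigenbasis_exists:
  assumes "finite I" "psd I A"
  obtains b v where "eigenbasis I A b v" "\<And>i. i \<in> I \<Longrightarrow> 0 \<le> b i"
proof -
  obtain b v where "eigenbasis I A b v"
    using hermitian_eigenbasis_exists[OF assms(1), of A] psd_hermitian[OF assms(2)] by blast
  then show thesis using that eigenbasis_psd_nonneg[OF assms] by blast
qed

lemma tq_nonneg:
  assumes "finite I" "psd I E" "psd I A"
  shows "0 \<le> tq I E A"
proof -
  obtain b v where bv: "eigenbasis I A b v" "\<And>i. i \<in> I \<Longrightarrow> 0 \<le> b i"
    using psd_eigenbasis_exists[OF assms(1,3)] by metis
  then show ?thesis unfolding eigenbasis_tq[OF bv(1)]
    by (intro sum_nonneg mult_nonneg_nonneg psd_sesq_nonneg assms) auto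
qed

lemma eigenbasis_expand:
  assumes "finite I" "eigenbasis I A b v" "x \<in> I"
  shows "(\<Sum>m\<in>I. (\<Sum>y\<in>I. cnj (v m y) * f y) * v m x) = f x"
proof -
  have "(\<Sum>m\<in>I. (\<Sum>y\<in>I. cnj (v m y) * f y) * v m x) = (\<Sum>m\<in>I. \<Sum>y\<in>I. (v m x * cnj (v m y)) * f y)"
    unfolding sum_distrib_right by (simp add: mult_ac)
  also have "\<dots> = (\<Sum>y\<in>I. \<Sum>m\<in>I. (v m x * cnj (v m y)) * f y)" by (rule sum.swap)
  also have "\<dots> = (\<Sum>y\<in>I. (if x = y then 1 else 0) * f y)"
    unfolding sum_distrib_right[symmetric]
    by (intro sum.cong refl) (simp add: eigenbasis_complete[OF assms(2,3)])
  finally show ?thesis using assms by (simp add: if_distribR if_distrib cong: if_cong)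
qed

lemma eigenbasis_norm_combination:
  assumes "finite I" "eigenbasis I A b v"
  shows "(\<Sum>x\<in>I. cnj (\<Sum>i\<in>I. c i * v i x) * (\<Sum>i\<in>I. c i * v i x)) = (\<Sum>i\<in>I. of_real ((cmod (c i))\<^sup>2))"
proof -
  have "(\<Sum>x\<in>I. cnj (\<Sum>i\<in>I. c i * v i x) * (\<Sum>i\<in>I. c i * v i x)) =
     (\<Sum>x\<in>I. \<Sum>i\<in>I. \<Sum>j\<in>I. (cnj (c i) * c j) * (cnj (v i x) * v j x))"
    unfolding cnj_sum sum_product by (simp add: mult_ac)
  also have "\<dots> = (\<Sum>i\<in>I. \<Sum>x\<in>I. \<Sum>j\<in>I. (cnj (c i) * c j) * (cnj (v i x) * v j x))"
    by (rule sum.swap)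
  also have "\<dots> = (\<Sum>i\<in>I. \<Sum>j\<in>I. \<Sum>x\<in>I. (cnj (c i) * c j) * (cnj (v i x) * v j x))"
    by (intro sum.cong refl sum.swap)
  also have "\<dots> = (\<Sum>i\<in>I. \<Sum>j\<in>I. (cnj (c i) * c j) * (if i = j then 1 else 0))"
    unfolding sum_distrib_left[symmetric] by (intro sum.cong refl) (simp add: eigenbasis_orth[OF assms(2)])
  also have "\<dots> = (\<Sum>i\<in>I. cnj (c i) * c i)"
    using assms(1) by (simp add: if_distrib cong: if_cong)
  finally show ?thesis by (simp only: cnj_mult_self)
qed

definition overlap :: "'i set \<Rightarrow> ('i \<Rightarrow> complex) \<Rightarrow> ('i \<Rightarrow> complex) \<Rightarrow> complex" where
  "overlap I f g = (\<Sum>x\<in>I. cnj (f x) * g x)"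

lemma cnj_overlap: "cnj (overlap I f g) = overlap I g f"
  unfolding overlap_def cnj_sum by (simp add: mult.commute)

lemma eigenbasis_parseval:
  assumes "finite I" "eigenbasis I A b v"
  shows "(\<Sum>m\<in>I. (cmod (overlap I (v m) f))\<^sup>2) = Re (overlap I f f)"
proof -
  have "overlap I f f = (\<Sum>x\<in>I. cnj (\<Sum>i\<in>I. overlap I (v i) f * v i x) * (\<Sum>i\<in>I. overlap I (v i) f * v i x))"
    unfolding overlap_def by (intro sum.cong refl) (simp only: eigenbasis_expand[OF assms])
  also have "\<dots> = (\<Sum>i\<in>I. of_real ((cmod (overlap I (v i) f))\<^sup>2))"
    by (rule eigenbasis_norm_combination[OF assms])
  finally show ?thesis by simp
qed

text \<open>Only the effects of a measurement, with a free number of outcomes: measuring some of the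
  particles has fewer outcomes than the dimension of the whole space. The vectors onto which the
  outcomes are prepared matter only for the trace norm.\<close>

definition povm :: "'i set \<Rightarrow> 'j set \<Rightarrow> ('j \<Rightarrow> 'i op) \<Rightarrow> bool" where
  "povm I J E \<longleftrightarrow> (\<forall>j\<in>J. psd I (E j)) \<and> (\<forall>x\<in>I. \<forall>y\<in>I. (\<Sum>j\<in>J. E j x y) = idop x y)"

lemma povm_sesq_sum:
  assumes "finite I" "povm I J E"
  shows "(\<Sum>j\<in>J. sesq I (E j) f g) = overlap I f g"
proof -
  have "(\<Sum>j\<in>J. sesq I (E j) f g) = (\<Sum>x\<in>I. \<Sum>j\<in>J. \<Sum>y\<in>I. cnj (f x) * E j x y * g y)"
    unfolding sesq_def by (rule sum.swap)
  also have "\<dots> = (\<Sum>x\<in>I. \<Sum>y\<in>I. \<Sum>j\<in>J. cnj (f x) * E j x y * g y)"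
    by (intro sum.cong refl sum.swap)
  also have "\<dots> = (\<Sum>x\<in>I. \<Sum>y\<in>I. cnj (f x) * idop x y * g y)"
    using assms by (simp add: sum_distrib_left[symmetric] sum_distrib_right[symmetric] povm_def)
  also have "\<dots> = overlap I f g"
    unfolding overlap_def idop_def using assms(1)
    by (intro sum.cong refl) (simp add: if_distrib if_distribR cong: if_cong)
  finally show ?thesis .
qed

text \<open>The Cauchy-Schwarz step behind monotonicity: each outcome of the measurement is tested
  against the vectors solving \<open>(1 - s) \<sigma> X + s X \<rho> = \<rho> - \<sigma>\<close>, whose entries in the two
  eigenbases are the numbers \<open>\<xi>\<close> below.\<close>

lemma measured_integrand_le:
  assumes fin: "finite I" "finite J" and E: "povm I J E"
    and \<rho>: "eigenbasis I \<rho> a u" "\<And>i. i \<in> I \<Longrightarrow> 0 \<le> a i"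
    and \<sigma>: "eigenbasis I \<sigma> b v" "\<And>i. i \<in> I \<Longrightarrow> 0 \<le> b i"
    and ac: "\<And>m i. m \<in> I \<Longrightarrow> i \<in> I \<Longrightarrow> b m = 0 \<Longrightarrow> a i = 0 \<or> overlap I (v m) (u i) = 0"
    and s: "0 \<le> s" "s < 1"
  shows "(\<Sum>j\<in>J. (tq I (E j) \<rho> - tq I (E j) \<sigma>)\<^sup>2 / ((1 - s) * tq I (E j) \<sigma> + s * tq I (E j) \<rho>)) \<le>
     (\<Sum>m\<in>I. \<Sum>i\<in>I. (cmod (overlap I (v m) (u i)))\<^sup>2 * ((a i - b m)\<^sup>2 / ((1 - s) * b m + s * a i)))"
proof -
  define c where "c m i = overlap I (v m) (u i)" for m i
  define d where "d m i = (1 - s) * b m + s * a i" for m i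
  define \<xi> where "\<xi> m i = of_real ((a i - b m) / d m i) * c m i" for m i
  have d\<xi>: "of_real (d m i) * \<xi> m i = of_real (a i - b m) * c m i" if "m \<in> I" "i \<in> I" for m i
  \<comment> \<open>If \<open>d m i = 0\<close>, then \<open>\<xi> m i = 0\<close> by
    \<open>x / 0 = 0\<close>, and the equation survives since \<open>b m = 0\<close> and
    \<open>ac\<close> makes \<open>a i * c m i\<close> vanish. For \<open>s = 0\<close> the
    eigenvalue \<open>a i\<close> itself may be positive.\<close>
  proof (cases "d m i = 0")
    case True
    then have "(1 - s) * b m = 0" "s * a i = 0"
      using s \<rho>(2)[OF that(2)] \<sigma>(2)[OF that(1)] unfolding d_def
      by (smt (verit) mult_nonneg_nonneg)+
    then have "b m = 0" using s by simp
    then show ?thesis using ac[OF that] True by (auto simp: c_def)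
  qed (simp add: \<xi>_def)
  \<comment> \<open>With X the operator whose entries are the \<open>\<xi> m i\<close>,
    \<open>g i\<close> is X applied to \<open>u i\<close>, and \<open>f m\<close> is the adjoint of
    X applied to \<open>v m\<close>.\<close>
  define f where "f m x = (\<Sum>i\<in>I. cnj (\<xi> m i) * u i x)" for m x
  define g where "g i x = (\<Sum>m\<in>I. \<xi> m i * v m x)" for i x
  define B where "B j = (\<Sum>m\<in>I. (1 - s) * b m * Re (sesq I (E j) (f m) (f m)))
      + (\<Sum>i\<in>I. s * a i * Re (sesq I (E j) (g i) (g i)))" for j
  have step: "(tq I (E j) \<rho> - tq I (E j) \<sigma>)\<^sup>2 / ((1 - s) * tq I (E j) \<sigma> + s * tq I (E j) \<rho>) \<le> B j"
    if j: "j \<in> J" for j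
  proof -
    have Ej: "psd I (E j)" using E j by (simp add: povm_def)
    define P where "P = tq I (E j) \<rho>"
    define Q where "Q = tq I (E j) \<sigma>"
    define A where "A = (1 - s) * Q + s * P"
    have Pe: "P = (\<Sum>i\<in>I. a i * Re (sesq I (E j) (u i) (u i)))"
      unfolding P_def by (rule eigenbasis_tq[OF \<rho>(1)])
    have Qe: "Q = (\<Sum>m\<in>I. b m * Re (sesq I (E j) (v m) (v m)))"
      unfolding Q_def by (rule eigenbasis_tq[OF \<sigma>(1)])
    have uu: "(\<Sum>m\<in>I. c m i * sesq I (E j) (u i) (v m)) = sesq I (E j) (u i) (u i)" for i
      unfolding sesq_sum_right[symmetric] c_def overlap_def
      by (rule sesq_cong) (simp_all add: eigenbasis_expand[OF fin(1) \<sigma>(1)])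
    have vv: "(\<Sum>i\<in>I. c m i * sesq I (E j) (u i) (v m)) = sesq I (E j) (v m) (v m)" for m
    proof -
      have "(\<Sum>i\<in>I. c m i * sesq I (E j) (u i) (v m)) = sesq I (E j) (\<lambda>x. \<Sum>i\<in>I. cnj (c m i) * u i x) (v m)"
        unfolding sesq_sum_left by simp
      also have "\<dots> = sesq I (E j) (v m) (v m)"
        unfolding c_def cnj_overlap unfolding overlap_def
        by (rule sesq_cong) (simp_all add: eigenbasis_expand[OF fin(1) \<rho>(1)])
      finally show ?thesis .
    qed
    \<comment> \<open>Expanded in both eigenbases, the two cross terms combine to
      \<open>d m i * \<xi> m i\<close>, which the equation for X turns into
      \<open>(a i - b m) * c m i\<close>, the entries of \<open>\<rho> - \<sigma>\<close>.\<close>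
    have cross: "(\<Sum>m\<in>I. (1 - s) * b m * Re (sesq I (E j) (f m) (v m)))
      + (\<Sum>i\<in>I. s * a i * Re (sesq I (E j) (g i) (u i))) = P - Q"
    proof -
      have 1: "(1 - s) * b m * Re (sesq I (E j) (f m) (v m)) =
          (\<Sum>i\<in>I. Re (of_real ((1 - s) * b m) * \<xi> m i * sesq I (E j) (u i) (v m)))" for m
        unfolding f_def sesq_sum_left by (simp add: sum_distrib_left mult.assoc)
      have 2: "s * a i * Re (sesq I (E j) (g i) (u i)) =
          (\<Sum>m\<in>I. Re (of_real (s * a i) * \<xi> m i * sesq I (E j) (u i) (v m)))" for i
        unfolding psd_sesq_commute_Re[OF Ej, of "g i"]
        unfolding g_def sesq_sum_right by (simp add: sum_distrib_left mult.assoc)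
      have "(\<Sum>m\<in>I. (1 - s) * b m * Re (sesq I (E j) (f m) (v m)))
      + (\<Sum>i\<in>I. s * a i * Re (sesq I (E j) (g i) (u i))) =
       (\<Sum>m\<in>I. \<Sum>i\<in>I. Re (of_real ((1 - s) * b m) * \<xi> m i * sesq I (E j) (u i) (v m))) +
       (\<Sum>m\<in>I. \<Sum>i\<in>I. Re (of_real (s * a i) * \<xi> m i * sesq I (E j) (u i) (v m)))"
        unfolding 1 2 by (subst (2) sum.swap) (rule refl)
      also have "\<dots> = (\<Sum>m\<in>I. \<Sum>i\<in>I. Re (of_real (d m i) * \<xi> m i * sesq I (E j) (u i) (v m)))"
        unfolding sum.distrib[symmetric] by (intro sum.cong refl) (simp add: d_def algebra_simps)
      also have "\<dots> = (\<Sum>m\<in>I. \<Sum>i\<in>I. a i * Re (c m i * sesq I (E j) (u i) (v m)) - b m * Re (c m i * sesq I (E j) (u i) (v m)))"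
        by (intro sum.cong refl) (simp add: d\<xi> mult.assoc left_diff_distrib)
      also have "\<dots> = (\<Sum>i\<in>I. \<Sum>m\<in>I. a i * Re (c m i * sesq I (E j) (u i) (v m)))
          - (\<Sum>m\<in>I. \<Sum>i\<in>I. b m * Re (c m i * sesq I (E j) (u i) (v m)))"
        unfolding sum_subtractf by (subst sum.swap) (rule refl)
      also have "\<dots> = P - Q"
        unfolding sum_distrib_left[symmetric] Re_sum[symmetric] uu vv Pe Qe ..
      finally show ?thesis .
    qed
    \<comment> \<open>The nonnegative forms at \<open>f m - t * v m\<close> and
      \<open>g i - t * u i\<close>, weighted by \<open>(1 - s) * b m\<close> and
      \<open>s * a i\<close>, add up to this quadratic in \<open>t\<close>. Its minimum, at
      \<open>t = (P - Q) / A\<close>, gives the claim; for \<open>A = 0\<close> the quotient is 0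
      and \<open>t = 0\<close> suffices.\<close>
    have quad: "0 \<le> B j - 2 * t * (P - Q) + t\<^sup>2 * A" for t
    proof -
      have "0 \<le> (\<Sum>m\<in>I. (1 - s) * b m * Re (sesq I (E j) (\<lambda>x. f m x - of_real t * v m x) (\<lambda>x. f m x - of_real t * v m x)))
       + (\<Sum>i\<in>I. s * a i * Re (sesq I (E j) (\<lambda>x. g i x - of_real t * u i x) (\<lambda>x. g i x - of_real t * u i x)))"
        using s \<rho>(2) \<sigma>(2) by (intro add_nonneg_nonneg sum_nonneg mult_nonneg_nonneg psd_sesq_nonneg Ej) auto
      also have "\<dots> = B j - 2 * t * (P - Q) + t\<^sup>2 * A"
        unfolding sesq_diff_quadratic[OF Ej] A_def B_def Pe Qe cross[symmetric, unfolded Pe Qe]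
        by (simp add: sum.distrib sum_subtractf sum_distrib_left algebra_simps)
      finally show ?thesis .
    qed
    show ?thesis
    proof (cases "A = 0")
      case True
      then show ?thesis using quad[of 0] by (simp add: A_def P_def Q_def)
    next
      case False
      have "2 * ((P - Q) / A) * (P - Q) = 2 * ((P - Q)\<^sup>2 / A)"
        and "((P - Q) / A)\<^sup>2 * A = (P - Q)\<^sup>2 / A"
        using False by (simp_all add: power2_eq_square)
      then have "0 \<le> B j - (P - Q)\<^sup>2 / A"
        using quad[of "(P - Q) / A"] by linarith
      then show ?thesis by (simp add: A_def P_def Q_def)
    qed
  qed
  \<comment> \<open>The effects sum to the identity, so orthonormality of the eigenbases leaves only
    the squared entries of X, weighted by \<open>d m i\<close>.\<close>
  have "(\<Sum>j\<in>J. B j) = (\<Sum>m\<in>I. (1 - s) * b m * Re (\<Sum>j\<in>J. sesq I (E j) (f m) (f m)))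
      + (\<Sum>i\<in>I. s * a i * Re (\<Sum>j\<in>J. sesq I (E j) (g i) (g i)))"
    unfolding B_def sum.distrib Re_sum sum_distrib_left
    by (intro arg_cong2[where f="(+)"] sum.swap)
  also have "\<dots> = (\<Sum>m\<in>I. (1 - s) * b m * (\<Sum>i\<in>I. (cmod (\<xi> m i))\<^sup>2))
      + (\<Sum>i\<in>I. s * a i * (\<Sum>m\<in>I. (cmod (\<xi> m i))\<^sup>2))"
  proof -
    have "overlap I (f m) (f m) = of_real (\<Sum>i\<in>I. (cmod (\<xi> m i))\<^sup>2)" for m
      unfolding overlap_def f_def eigenbasis_norm_combination[OF fin(1) \<rho>(1)] by simp
    moreover have "overlap I (g i) (g i) = of_real (\<Sum>m\<in>I. (cmod (\<xi> m i))\<^sup>2)" for i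
      unfolding overlap_def g_def eigenbasis_norm_combination[OF fin(1) \<sigma>(1)] by simp
    ultimately show ?thesis unfolding povm_sesq_sum[OF fin(1) E] by (simp del: of_real_sum)
  qed
  also have "\<dots> = (\<Sum>m\<in>I. \<Sum>i\<in>I. (1 - s) * b m * (cmod (\<xi> m i))\<^sup>2) + (\<Sum>m\<in>I. \<Sum>i\<in>I. s * a i * (cmod (\<xi> m i))\<^sup>2)"
    unfolding sum_distrib_left by (subst (2) sum.swap) (rule refl)
  also have "\<dots> = (\<Sum>m\<in>I. \<Sum>i\<in>I. d m i * (cmod (\<xi> m i))\<^sup>2)"
    unfolding sum.distrib[symmetric] d_def by (simp add: algebra_simps)
  also have "\<dots> = (\<Sum>m\<in>I. \<Sum>i\<in>I. (cmod (c m i))\<^sup>2 * ((a i - b m)\<^sup>2 / d m i))"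
  proof (intro sum.cong refl)
    fix m i
    show "d m i * (cmod (\<xi> m i))\<^sup>2 = (cmod (c m i))\<^sup>2 * ((a i - b m)\<^sup>2 / d m i)"
      by (cases "d m i = 0")
        (simp_all add: \<xi>_def norm_mult power_mult_distrib power_divide power2_eq_square
          flip: of_real_divide of_real_diff)
  qed
  finally have "(\<Sum>j\<in>J. B j) = (\<Sum>m\<in>I. \<Sum>i\<in>I. (cmod (c m i))\<^sup>2 * ((a i - b m)\<^sup>2 / d m i))" .
  then show ?thesis unfolding c_def d_def by (metis (no_types, lifting) step sum_mono)
qed

lemma povm_tq_sum:
  assumes "finite I" "povm I J E" "finite J" "eigenbasis I A b v"
  shows "(\<Sum>j\<in>J. tq I (E j) A) = (\<Sum>i\<in>I. b i)"
proof -
  have "(\<Sum>j\<in>J. tq I (E j) A) = (\<Sum>i\<in>I. b i * Re (\<Sum>j\<in>J. sesq I (E j) (v i) (v i)))"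
    unfolding eigenbasis_tq[OF assms(4)] Re_sum sum_distrib_left by (rule sum.swap)
  also have "\<dots> = (\<Sum>i\<in>I. b i)"
    unfolding povm_sesq_sum[OF assms(1,2)] overlap_def using assms
    by (intro sum.cong refl) (simp add: eigenbasis_orth)
  finally show ?thesis .
qed

lemma tq_diff: "tq I E (\<lambda>x y. A x y - B x y) = tq I E A - tq I E B"
  by (simp add: tq_def tr_def mmult_def right_diff_distrib sum_subtractf)

lemma sesq_diff: "sesq I (\<lambda>x y. A x y - B x y) f g = sesq I A f g - sesq I B f g"
  by (simp add: sesq_def algebra_simps sum_subtractf)

text \<open>Monotonicity of relative entropy under a measurement; the right-hand side is tr(rho log
  rho) - tr(rho log sigma). Domination of \<open>\<rho>\<close> by \<open>\<sigma>\<close> puts the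
  kernel of \<open>\<sigma>\<close> inside that of \<open>\<rho>\<close>, and likewise for the
  outcome probabilities, so both integral representations apply.\<close>

lemma measured_relative_entropy_le:
  assumes fin: "finite I" "finite J" and E: "povm I J E"
    and \<rho>: "psd I \<rho>" "eigenbasis I \<rho> a u"
    and \<sigma>: "psd I \<sigma>" "eigenbasis I \<sigma> b v"
    and dom: "psd I (\<lambda>x y. \<sigma> x y - \<rho> x y)"
  shows "(\<Sum>j\<in>J. tq I (E j) \<rho> * ln (tq I (E j) \<rho>) - tq I (E j) \<rho> * ln (tq I (E j) \<sigma>)) \<le>
     (\<Sum>i\<in>I. a i * ln (a i)) - (\<Sum>m\<in>I. ln (b m) * Re (sesq I \<rho> (v m) (v m)))"
proof -
  define w where "w m i = (cmod (overlap I (v m) (u i)))\<^sup>2" for m i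
  have a0: "0 \<le> a i" if "i \<in> I" for i by (rule eigenbasis_psd_nonneg[OF fin(1) \<rho> that])
  have b0: "0 \<le> b i" if "i \<in> I" for i by (rule eigenbasis_psd_nonneg[OF fin(1) \<sigma> that])
  have w0: "0 \<le> w m i" for m i by (simp add: w_def)
  have w1: "(\<Sum>m\<in>I. w m i) = 1" if "i \<in> I" for i
    using eigenbasis_parseval[OF fin(1) \<sigma>(2), of "u i"] eigenbasis_orth[OF \<rho>(2) that that]
    by (simp add: w_def overlap_def)
  have w2: "(\<Sum>i\<in>I. w m i) = 1" if "m \<in> I" for m
  proof -
    have "w m i = (cmod (overlap I (u i) (v m)))\<^sup>2" for i
      unfolding w_def cnj_overlap[of I "u i" "v m", symmetric] by simp
    then show ?thesis
      using eigenbasis_parseval[OF fin(1) \<rho>(2), of "v m"] eigenbasis_orth[OF \<sigma>(2) that that]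
      by (simp add: overlap_def)
  qed
  have \<rho>v: "Re (sesq I \<rho> (v m) (v m)) = (\<Sum>i\<in>I. a i * w m i)" for m
  proof -
    have "sesq I \<rho> (v m) (v m) = (\<Sum>i\<in>I. of_real (a i) * overlap I (v m) (u i) * cnj (overlap I (v m) (u i)))"
      unfolding eigenbasis_sesq[OF \<rho>(2)] cnj_overlap unfolding overlap_def ..
    also have "\<dots> = (\<Sum>i\<in>I. of_real (a i * w m i))"
      unfolding w_def by (intro sum.cong refl) (simp only: mult.assoc complex_norm_square[symmetric] of_real_mult)
    finally show ?thesis by simp
  qed
  have ac: "a i = 0 \<or> overlap I (v m) (u i) = 0" if mi: "m \<in> I" "i \<in> I" and bm: "b m = 0" for m i
  proof -
    have "Re (sesq I \<rho> (v m) (v m)) \<le> b m"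
      using psd_sesq_nonneg[OF dom, of "v m"] eigenbasis_eigenvalue[OF fin(1) \<sigma>(2) mi(1)]
      by (simp add: sesq_diff)
    then have "(\<Sum>i\<in>I. a i * w m i) \<le> 0" using bm \<rho>v by simp
    moreover have "0 \<le> (\<Sum>i\<in>I. a i * w m i)" by (intro sum_nonneg mult_nonneg_nonneg a0 w0)
    ultimately have "(\<Sum>i\<in>I. a i * w m i) = 0" by simp
    then have "a i * w m i = 0"
      using sum_nonneg_eq_0_iff[OF fin(1), of "\<lambda>i. a i * w m i"] a0 w0 mi by simp
    then show ?thesis by (auto simp: w_def)
  qed
  have Q0: "0 \<le> tq I (E j) \<sigma>" and P0: "0 \<le> tq I (E j) \<rho>" and PQ: "tq I (E j) \<rho> \<le> tq I (E j) \<sigma>"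
    if "j \<in> J" for j
    using tq_nonneg[OF fin(1) _ \<sigma>(1), of "E j"] tq_nonneg[OF fin(1) _ \<rho>(1), of "E j"]
      tq_nonneg[OF fin(1) _ dom, of "E j"] E that by (simp_all add: povm_def tq_diff)
  let ?kl = "\<lambda>a b :: real. a * ln a - a * ln b - a + b"
  let ?g = "\<lambda>a b s :: real. (1 - s) * (a - b)\<^sup>2 / ((1 - s) * b + s * a)"
  have L: "((\<lambda>s. \<Sum>j\<in>J. ?g (tq I (E j) \<rho>) (tq I (E j) \<sigma>) s) has_integral
     (\<Sum>j\<in>J. ?kl (tq I (E j) \<rho>) (tq I (E j) \<sigma>))) {0..1}"
  proof (intro has_integral_sum[OF fin(2)] kl_integrand_has_integral)
    fix j assume "j \<in> J" "tq I (E j) \<sigma> = 0"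
    then show "tq I (E j) \<rho> = 0" using P0[of j] PQ[of j] by simp
  qed (use P0 Q0 in auto)
  have R: "((\<lambda>s. \<Sum>m\<in>I. \<Sum>i\<in>I. w m i * ?g (a i) (b m) s) has_integral
     (\<Sum>m\<in>I. \<Sum>i\<in>I. w m i * ?kl (a i) (b m))) {0..1}"
  proof (intro has_integral_sum[OF fin(1)])
    fix m i assume mi: "m \<in> I" "i \<in> I"
    show "((\<lambda>s. w m i * ?g (a i) (b m) s) has_integral w m i * ?kl (a i) (b m)) {0..1}"
    proof (cases "w m i = 0")
      case False
      then have "b m = 0 \<Longrightarrow> a i = 0" using ac[OF mi] by (auto simp: w_def)
      then show ?thesis
        by (intro has_integral_mult_right kl_integrand_has_integral a0 b0 mi)
    qed simp
  qed
  have "(\<Sum>j\<in>J. ?kl (tq I (E j) \<rho>) (tq I (E j) \<sigma>)) \<le> (\<Sum>m\<in>I. \<Sum>i\<in>I. w m i * ?kl (a i) (b m))"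
  proof (rule has_integral_le[OF L R])
    fix s :: real assume s: "s \<in> {0..1}"
    show "(\<Sum>j\<in>J. ?g (tq I (E j) \<rho>) (tq I (E j) \<sigma>) s) \<le> (\<Sum>m\<in>I. \<Sum>i\<in>I. w m i * ?g (a i) (b m) s)"
    proof (cases "s = 1")
      case False
      then have s1: "0 \<le> s" "s < 1" using s by auto
      have "(1 - s) * (\<Sum>j\<in>J. (tq I (E j) \<rho> - tq I (E j) \<sigma>)\<^sup>2 / ((1 - s) * tq I (E j) \<sigma> + s * tq I (E j) \<rho>)) \<le>
        (1 - s) * (\<Sum>m\<in>I. \<Sum>i\<in>I. w m i * ((a i - b m)\<^sup>2 / ((1 - s) * b m + s * a i)))"
        unfolding w_def using s1
        by (intro mult_left_mono measured_integrand_le[OF fin E \<rho>(2) a0 \<sigma>(2) b0 ac]) auto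
      then show ?thesis by (simp add: sum_distrib_left mult.left_commute)
    qed simp
  qed
  \<comment> \<open>The squared overlaps \<open>w\<close> are doubly stochastic, so the linear terms
    of the integral formula reduce to the traces, which occur on the classical side too and
    cancel.\<close>
  also have "(\<Sum>m\<in>I. \<Sum>i\<in>I. w m i * ?kl (a i) (b m)) =
      (\<Sum>m\<in>I. \<Sum>i\<in>I. w m i * (a i * ln (a i) - a i)) - (\<Sum>m\<in>I. \<Sum>i\<in>I. w m i * (a i * ln (b m)))
      + (\<Sum>m\<in>I. \<Sum>i\<in>I. w m i * b m)"
    by (simp add: algebra_simps sum.distrib sum_subtractf)
  also have "(\<Sum>m\<in>I. \<Sum>i\<in>I. w m i * (a i * ln (a i) - a i)) = (\<Sum>i\<in>I. a i * ln (a i) - a i)"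
    by (subst sum.swap) (simp add: sum_distrib_right[symmetric] w1)
  also have "(\<Sum>m\<in>I. \<Sum>i\<in>I. w m i * b m) = (\<Sum>m\<in>I. b m)"
    by (simp add: sum_distrib_right[symmetric] w2)
  also have "(\<Sum>m\<in>I. \<Sum>i\<in>I. w m i * (a i * ln (b m))) = (\<Sum>m\<in>I. ln (b m) * Re (sesq I \<rho> (v m) (v m)))"
    unfolding \<rho>v by (simp add: sum_distrib_left mult_ac)
  finally show ?thesis
    using povm_tq_sum[OF fin(1) E fin(2) \<rho>(2)] povm_tq_sum[OF fin(1) E fin(2) \<sigma>(2)]
    by (simp add: sum.distrib sum_subtractf)
qed

text \<open>Any eigenbasis may be selected here: only the existence of one with the chosen eigenvalues
  is used, never that the value is independent of the choice.\<close>

definition neg_entropy :: "'i set \<Rightarrow> 'i op \<Rightarrow> real" where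
  "neg_entropy I A = (let b = fst (SOME bv. eigenbasis I A (fst bv) (snd bv)) in \<Sum>i\<in>I. b i * ln (b i))"

lemma neg_entropy_eigenbasis:
  assumes "finite I" "psd I A"
  obtains b v where "eigenbasis I A b v" "\<And>i. i \<in> I \<Longrightarrow> 0 \<le> b i"
    "neg_entropy I A = (\<Sum>i\<in>I. b i * ln (b i))"
proof -
  define bv where "bv = (SOME bv. eigenbasis I A (fst bv) (snd bv))"
  obtain b v where "eigenbasis I A b v" using psd_eigenbasis_exists[OF assms] by metis
  then have "\<exists>bv. eigenbasis I A (fst bv) (snd bv)" by (intro exI[of _ "(b, v)"]) simp
  then have "eigenbasis I A (fst bv) (snd bv)" unfolding bv_def by (rule someI_ex)
  moreover have "neg_entropy I A = (\<Sum>i\<in>I. fst bv i * ln (fst bv i))"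
    by (simp add: neg_entropy_def bv_def Let_def)
  ultimately show thesis using that eigenbasis_psd_nonneg[OF assms] by blast
qed

section \<open>Bounds on the entropy and Holevo's inequality\<close>

lemma xlnx_le_of_le:
  assumes "0 \<le> x" "x \<le> (p::real)"
  shows "x * ln x \<le> x * ln p"
proof (cases "x = 0")
  case False
  then show ?thesis using assms by (intro mult_left_mono) simp_all
qed simp

text \<open>No eigenvalue exceeds the trace. This is nonnegativity of the entropy in unnormalised
  form: for trace \<open>p > 0\<close> the two sides differ by \<open>p\<close> times the entropy of
  \<open>A / p\<close>.\<close>

lemma neg_entropy_le:
  assumes "finite I" "psd I A"
  shows "neg_entropy I A \<le> Re (tr I A) * ln (Re (tr I A))"
proof -
  obtain b v where bv: "eigenbasis I A b v" "\<And>i. i \<in> I \<Longrightarrow> 0 \<le> b i"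
    "neg_entropy I A = (\<Sum>i\<in>I. b i * ln (b i))" using neg_entropy_eigenbasis[OF assms] by metis
  have t: "Re (tr I A) = (\<Sum>i\<in>I. b i)" using eigenbasis_trace[OF assms(1) bv(1)] by simp
  have "(\<Sum>i\<in>I. b i * ln (b i)) \<le> (\<Sum>i\<in>I. b i * ln (\<Sum>i\<in>I. b i))"
    by (intro sum_mono xlnx_le_of_le bv member_le_sum assms) (use bv in auto)
  then show ?thesis unfolding bv t by (simp add: sum_distrib_right)
qed

text \<open>The uniform spectrum maximises the entropy: use \<open>ln x \<le> x - 1\<close> at
  \<open>x = 1 / (n * b i)\<close> for every positive eigenvalue.\<close>

lemma neg_entropy_ge:
  assumes "finite I" "I \<noteq> {}" "psd I A" "tr I A = 1"
  shows "- ln (real (card I)) \<le> neg_entropy I A"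
proof -
  obtain b v where bv: "eigenbasis I A b v" "\<And>i. i \<in> I \<Longrightarrow> 0 \<le> b i"
    "neg_entropy I A = (\<Sum>i\<in>I. b i * ln (b i))" using neg_entropy_eigenbasis[OF assms(1,3)] by metis
  define n where "n = real (card I)"
  have n: "n > 0" using assms by (simp add: n_def card_gt_0_iff)
  have s1: "(\<Sum>i\<in>I. b i) = 1" using eigenbasis_trace[OF assms(1) bv(1)] assms(4)
    by (metis of_real_eq_1_iff)
  have "b i - 1 / n - b i * ln n \<le> b i * ln (b i)" if "i \<in> I" for i
  proof (cases "b i = 0")
    case False
    then have b: "b i > 0" using bv(2)[OF that] by simp
    have "ln (1 / (n * b i)) \<le> 1 / (n * b i) - 1"
      by (intro ln_le_minus_one) (use n b in simp)
    then have "b i * ln (1 / (n * b i)) \<le> b i * (1 / (n * b i) - 1)"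
      using b by simp
    then show ?thesis using n b by (simp add: ln_div ln_mult algebra_simps)
  qed (use n in simp)
  then have "(\<Sum>i\<in>I. b i - 1 / n - b i * ln n) \<le> (\<Sum>i\<in>I. b i * ln (b i))" by (rule sum_mono)
  moreover have "(\<Sum>i\<in>I. b i - 1 / n - b i * ln n) = - ln n"
    unfolding sum_subtractf sum_distrib_right[symmetric] s1 using n by (simp add: n_def)
  ultimately show ?thesis by (simp add: bv n_def)
qed

text \<open>\<open>R y\<close> is the unnormalised state left by outcome \<open>y\<close> of one
  measurement. The left-hand side is \<open>p\<close> times the mutual information of
  \<open>y\<close> with the outcome \<open>j\<close> of a second measurement, the right-hand side
  \<open>p\<close> times the Holevo quantity. The bound is monotonicity for each pair
  \<open>R y\<close>, \<open>S\<close>, summed over \<open>y\<close>.\<close>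

lemma holevo_bound:
  assumes fin: "finite I" "finite J" "finite Y" and E: "povm I J E"
    and R: "\<And>y. y \<in> Y \<Longrightarrow> psd I (R y)" and S: "psd I S"
    and sum_R: "\<And>x x'. x \<in> I \<Longrightarrow> x' \<in> I \<Longrightarrow> (\<Sum>y\<in>Y. R y x x') = S x x'"
    and dom: "\<And>y. y \<in> Y \<Longrightarrow> psd I (\<lambda>x x'. S x x' - R y x x')"
  defines "p \<equiv> Re (tr I S)" and "q \<equiv> \<lambda>y. Re (tr I (R y))"
  shows "(\<Sum>j\<in>J. \<Sum>y\<in>Y. tq I (E j) (R y) *
       (ln (tq I (E j) (R y)) - ln (tq I (E j) S) - ln (q y) + ln p)) \<le>
     (\<Sum>y\<in>Y. neg_entropy I (R y) - q y * ln (q y)) - (neg_entropy I S - p * ln p)"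
proof -
  obtain b v where bv: "eigenbasis I S b v" "\<And>i. i \<in> I \<Longrightarrow> 0 \<le> b i"
    "neg_entropy I S = (\<Sum>i\<in>I. b i * ln (b i))" using neg_entropy_eigenbasis[OF fin(1) S] by metis
  have step: "(\<Sum>j\<in>J. tq I (E j) (R y) * ln (tq I (E j) (R y)) - tq I (E j) (R y) * ln (tq I (E j) S)) \<le>
     neg_entropy I (R y) - (\<Sum>m\<in>I. ln (b m) * Re (sesq I (R y) (v m) (v m)))" if y: "y \<in> Y" for y
  proof -
    obtain a u where au: "eigenbasis I (R y) a u" "neg_entropy I (R y) = (\<Sum>i\<in>I. a i * ln (a i))"
      using neg_entropy_eigenbasis[OF fin(1) R[OF y]] by metis
    show ?thesis unfolding au
      by (rule measured_relative_entropy_le[OF fin(1,2) E R[OF y] au(1) S bv(1) dom[OF y]])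
  qed
  have tot: "(\<Sum>j\<in>J. tq I (E j) (R y)) = q y" if y: "y \<in> Y" for y
  proof -
    obtain a u where au: "eigenbasis I (R y) a u"
      using neg_entropy_eigenbasis[OF fin(1) R[OF y]] by metis
    show ?thesis using povm_tq_sum[OF fin(1) E fin(2) au] eigenbasis_trace[OF fin(1) au]
      by (simp add: q_def)
  qed
  have qp: "(\<Sum>y\<in>Y. q y) = p"
  proof -
    have "(\<Sum>y\<in>Y. tr I (R y)) = (\<Sum>x\<in>I. \<Sum>y\<in>Y. R y x x)" unfolding tr_def by (rule sum.swap)
    also have "\<dots> = tr I S" unfolding tr_def by (intro sum.cong refl sum_R)
    finally show ?thesis unfolding p_def q_def Re_sum[symmetric] by simp
  qed
  \<comment> \<open>By linearity the traces of \<open>R y\<close> against log \<open>S\<close> add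
    up to the trace of \<open>S\<close> log \<open>S\<close>.\<close>
  have ls: "(\<Sum>y\<in>Y. \<Sum>m\<in>I. ln (b m) * Re (sesq I (R y) (v m) (v m))) = neg_entropy I S"
  proof -
    have "(\<Sum>y\<in>Y. sesq I (R y) (v m) (v m)) = of_real (b m)" if "m \<in> I" for m
    proof -
      have "(\<Sum>y\<in>Y. sesq I (R y) (v m) (v m)) = (\<Sum>x\<in>I. \<Sum>y\<in>Y. \<Sum>x'\<in>I. cnj (v m x) * R y x x' * v m x')"
        unfolding sesq_def by (rule sum.swap)
      also have "\<dots> = (\<Sum>x\<in>I. \<Sum>x'\<in>I. \<Sum>y\<in>Y. cnj (v m x) * R y x x' * v m x')"
        by (intro sum.cong refl sum.swap)
      also have "\<dots> = sesq I S (v m) (v m)"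
        unfolding sesq_def sum_distrib_left[symmetric] sum_distrib_right[symmetric]
        by (intro sum.cong refl) (simp add: sum_R)
      finally show ?thesis using eigenbasis_eigenvalue[OF fin(1) bv(1) that] by simp
    qed
    then have "(\<Sum>m\<in>I. ln (b m) * Re (\<Sum>y\<in>Y. sesq I (R y) (v m) (v m))) = (\<Sum>m\<in>I. ln (b m) * b m)"
      by (intro sum.cong refl) simp
    then show ?thesis unfolding bv(3) Re_sum sum_distrib_left
      by (subst sum.swap) (simp add: mult.commute)
  qed
  have "(\<Sum>j\<in>J. \<Sum>y\<in>Y. tq I (E j) (R y) * (ln (tq I (E j) (R y)) - ln (tq I (E j) S) - ln (q y) + ln p)) =
     (\<Sum>y\<in>Y. (\<Sum>j\<in>J. tq I (E j) (R y) * ln (tq I (E j) (R y)) - tq I (E j) (R y) * ln (tq I (E j) S))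
        - (\<Sum>j\<in>J. tq I (E j) (R y)) * ln (q y) + (\<Sum>j\<in>J. tq I (E j) (R y)) * ln p)"
    unfolding sum_distrib_right sum.distrib[symmetric] sum_subtractf[symmetric]
    by (subst sum.swap, intro sum.cong refl) (simp add: algebra_simps)
  also have "\<dots> = (\<Sum>y\<in>Y. (\<Sum>j\<in>J. tq I (E j) (R y) * ln (tq I (E j) (R y)) - tq I (E j) (R y) * ln (tq I (E j) S))
        - q y * ln (q y) + q y * ln p)"
    by (intro sum.cong refl) (simp only: tot)
  also have "\<dots> \<le> (\<Sum>y\<in>Y. (neg_entropy I (R y) - (\<Sum>m\<in>I. ln (b m) * Re (sesq I (R y) (v m) (v m))))
        - q y * ln (q y) + q y * ln p)"
    by (intro sum_mono add_mono diff_mono step) auto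
  also have "\<dots> = (\<Sum>y\<in>Y. neg_entropy I (R y) - q y * ln (q y)) - (neg_entropy I S - p * ln p)"
    by (simp add: sum.distrib sum_subtractf ls sum_distrib_right[symmetric] qp)
  finally show ?thesis .
qed

section \<open>Tensor powers and partial contractions\<close>

lemma finite_idx [simp]: "finite (idx k :: 'a::finite list set)"
  using finite_lists_length_eq[of "UNIV :: 'a set" k] by (simp add: idx_def)

lemma card_idx: "card (idx k :: 'a::finite list set) = CARD('a) ^ k"
  using card_lists_length_eq[of "UNIV :: 'a set" k] by (simp add: idx_def)

lemma idx_0 [simp]: "idx 0 = {[]}"
  by (auto simp: idx_def)

lemma idx_nonempty: "(idx k :: 'a list set) \<noteq> {}"
proof -
  have "replicate k undefined \<in> (idx k :: 'a list set)" by (simp add: idx_def)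
  then show ?thesis by blast
qed

lemma sum_idx_add:
  "(\<Sum>xs\<in>idx (m + n). f xs) = (\<Sum>xs\<in>idx m. \<Sum>ys\<in>idx n. f (xs @ ys :: 'a::finite list))"
proof -
  have "(\<Sum>xs\<in>idx m. \<Sum>ys\<in>idx n. f (xs @ ys)) = (\<Sum>p\<in>idx m \<times> idx n. f (fst p @ snd p))"
    by (simp add: sum.cartesian_product case_prod_unfold)
  also have "\<dots> = (\<Sum>xs\<in>idx (m + n). f xs)"
    by (rule sum.reindex_bij_witness[where i = "\<lambda>xs. (take m xs, drop m xs)" and j = "\<lambda>p. fst p @ snd p"])
      (auto simp: idx_def)
  finally show ?thesis ..
qed

lemma sum_idx_1: "(\<Sum>xs\<in>idx (Suc 0). f xs) = (\<Sum>a\<in>UNIV. f [a :: 'a::finite])"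
proof -
  have "idx (Suc 0) = (\<lambda>a :: 'a. [a]) ` UNIV" by (auto simp: idx_def length_Suc_conv)
  then show ?thesis by (simp add: sum.reindex inj_on_def)
qed

lemma sum_idx_Suc: "(\<Sum>xs\<in>idx (Suc k). f xs) = (\<Sum>a\<in>UNIV. \<Sum>xs\<in>idx k. f (a # xs :: 'a::finite list))"
  using sum_idx_add[of f "Suc 0" k] by (simp add: sum_idx_1)

lemma sum_idx_snoc: "(\<Sum>xs\<in>idx (Suc k). f xs) = (\<Sum>xs\<in>idx k. \<Sum>a\<in>UNIV. f (xs @ [a :: 'a::finite]))"
  using sum_idx_add[of f k "Suc 0"] by (simp add: sum_idx_1)

lemma sum_idx_prod:
  fixes h :: "nat \<Rightarrow> 'a::finite \<Rightarrow> 'c::comm_semiring_1"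
  shows "(\<Sum>u\<in>idx k. \<Prod>l<k. h l (u ! l)) = (\<Prod>l<k. \<Sum>a\<in>UNIV. h l a)"
proof (induction k)
  case (Suc k)
  have "(\<Sum>u\<in>idx (Suc k). \<Prod>l<Suc k. h l (u ! l)) =
     (\<Sum>u\<in>idx k. \<Sum>a\<in>UNIV. (\<Prod>l<k. h l (u ! l)) * h k a)"
    unfolding sum_idx_snoc
    by (intro sum.cong refl) (auto simp: idx_def nth_append intro!: prod.cong arg_cong2[where f="(*)"])
  also have "\<dots> = (\<Sum>u\<in>idx k. \<Prod>l<k. h l (u ! l)) * (\<Sum>a\<in>UNIV. h k a)"
    unfolding sum_product ..
  finally show ?case using Suc by simp
qed simp

text \<open>The partial trace of (M \<otimes> 1) G over the first particle: for an effect
  \<open>M\<close> and a state \<open>G\<close>, the unnormalised state of the other particles upon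
  that outcome.\<close>

definition contr :: "'a::finite op \<Rightarrow> 'a list op \<Rightarrow> 'a list op" where
  "contr M G = (\<lambda>xs ys. \<Sum>a\<in>UNIV. \<Sum>b\<in>UNIV. M b a * G (a # xs) (b # ys))"

primrec contrL :: "'a::finite op list \<Rightarrow> 'a list op \<Rightarrow> 'a list op" where
  "contrL [] G = G"
| "contrL (M # Ms) G = contrL Ms (contr M G)"

lemma contrL_append: "contrL (As @ Bs) G = contrL Bs (contrL As G)"
  by (induction As arbitrary: G) simp_all

lemma contr_sum: "contr M (\<lambda>xs ys. \<Sum>i\<in>S. G i xs ys) = (\<lambda>xs ys. \<Sum>i\<in>S. contr M (G i) xs ys)"
proof (intro ext)
  fix xs ys
  have "contr M (\<lambda>xs ys. \<Sum>i\<in>S. G i xs ys) xs ys =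
      (\<Sum>a\<in>UNIV. \<Sum>i\<in>S. \<Sum>b\<in>UNIV. M b a * G i (a # xs) (b # ys))"
    unfolding contr_def sum_distrib_left by (intro sum.cong refl sum.swap)
  also have "\<dots> = (\<Sum>i\<in>S. contr M (G i) xs ys)" unfolding contr_def by (rule sum.swap)
  finally show "contr M (\<lambda>xs ys. \<Sum>i\<in>S. G i xs ys) xs ys = (\<Sum>i\<in>S. contr M (G i) xs ys)" .
qed

lemma contrL_sum: "contrL Ms (\<lambda>xs ys. \<Sum>i\<in>S. G i xs ys) = (\<lambda>xs ys. \<Sum>i\<in>S. contrL Ms (G i) xs ys)"
  by (induction Ms arbitrary: G) (simp_all add: contr_sum)

lemma contr_sum_left:
  assumes "\<And>a b. (\<Sum>i\<in>S. L i a b) = M a b"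
  shows "contr M G = (\<lambda>xs ys. \<Sum>i\<in>S. contr (L i) G xs ys)"
proof (intro ext)
  fix xs ys
  have "contr M G xs ys = (\<Sum>a\<in>UNIV. \<Sum>i\<in>S. \<Sum>b\<in>UNIV. L i b a * G (a # xs) (b # ys))"
    unfolding contr_def assms[symmetric] sum_distrib_right by (intro sum.cong refl sum.swap)
  also have "\<dots> = (\<Sum>i\<in>S. contr (L i) G xs ys)" unfolding contr_def by (rule sum.swap)
  finally show "contr M G xs ys = (\<Sum>i\<in>S. contr (L i) G xs ys)" .
qed

text \<open>Linearity in one slot. With \<open>M = idop\<close> it says that summing over all
  outcomes of a measurement traces the measured particle out.\<close>

lemma contrL_sum_insert:
  assumes "\<And>a b. (\<Sum>i\<in>S. L i a b) = M a b"
  shows "(\<Sum>i\<in>S. contrL (As @ L i # Bs) G xs ys) = contrL (As @ M # Bs) G xs ys"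
  unfolding contrL_append contrL.simps
  by (subst contr_sum_left[OF assms]) (simp add: contrL_sum)

text \<open>Diagonalise \<open>M\<close>: the form of the contraction at \<open>v\<close> is the sum
  over \<open>r\<close> of \<open>c r\<close> times the form of \<open>G\<close> at the product
  \<open>V r\<close> of the eigenvector \<open>g r\<close> with \<open>v\<close>.\<close>

lemma psd_contr:
  fixes M :: "'a::finite op"
  assumes M: "psd UNIV M" and G: "psd (idx (Suc m)) G"
  shows "psd (idx m) (contr M G)"
proof -
  obtain c g where cg: "eigenbasis UNIV M c g" "\<And>i. 0 \<le> c i"
    using psd_eigenbasis_exists[OF finite M] by (metis UNIV_I)
  have Mcg: "M a b = (\<Sum>i\<in>UNIV. of_real (c i) * g i a * cnj (g i b))" for a b
    using cg(1) by (simp add: eigenbasis_def)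
  have "contr M G x y = cnj (contr M G y x)" if "x \<in> idx m" "y \<in> idx m" for x y
  proof -
    have "cnj (contr M G y x) = (\<Sum>a\<in>UNIV. \<Sum>b\<in>UNIV. M a b * G (b # x) (a # y))"
      unfolding contr_def cnj_sum complex_cnj_mult
      using that by (intro sum.cong refl arg_cong2[where f="(*)"] psd_hermitian[OF M, symmetric]
          psd_hermitian[OF G, symmetric]) (auto simp: idx_def)
    also have "\<dots> = contr M G x y" unfolding contr_def by (rule sum.swap)
    finally show ?thesis ..
  qed
  moreover have "0 \<le> Re (sesq (idx m) (contr M G) v v)" for v
  proof -
    define V where "V r zs = g r (hd zs) * v (tl zs)" for r zs
    let ?t = "\<lambda>r a x b y. of_real (c r) * (cnj (V r (a # x)) * G (a # x) (b # y) * V r (b # y))"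
    have "sesq (idx m) (contr M G) v v =
      (\<Sum>x\<in>idx m. \<Sum>y\<in>idx m. \<Sum>a\<in>UNIV. \<Sum>b\<in>UNIV. \<Sum>r\<in>UNIV. ?t r a x b y)"
      unfolding sesq_def contr_def Mcg sum_distrib_left sum_distrib_right
      by (intro sum.cong refl) (simp add: V_def mult_ac)
    also have "\<dots> = (\<Sum>x\<in>idx m. \<Sum>y\<in>idx m. \<Sum>a\<in>UNIV. \<Sum>r\<in>UNIV. \<Sum>b\<in>UNIV. ?t r a x b y)"
      by (intro sum.cong refl sum.swap)
    also have "\<dots> = (\<Sum>x\<in>idx m. \<Sum>y\<in>idx m. \<Sum>r\<in>UNIV. \<Sum>a\<in>UNIV. \<Sum>b\<in>UNIV. ?t r a x b y)"
      by (intro sum.cong refl sum.swap)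
    also have "\<dots> = (\<Sum>x\<in>idx m. \<Sum>r\<in>UNIV. \<Sum>y\<in>idx m. \<Sum>a\<in>UNIV. \<Sum>b\<in>UNIV. ?t r a x b y)"
      by (intro sum.cong refl sum.swap)
    also have "\<dots> = (\<Sum>r\<in>UNIV. \<Sum>x\<in>idx m. \<Sum>y\<in>idx m. \<Sum>a\<in>UNIV. \<Sum>b\<in>UNIV. ?t r a x b y)"
      by (rule sum.swap)
    also have "\<dots> = (\<Sum>r\<in>UNIV. of_real (c r) * sesq (idx (Suc m)) G (V r) (V r))"
    proof (intro sum.cong refl)
      fix r
      have "(\<Sum>x\<in>idx m. \<Sum>y\<in>idx m. \<Sum>a\<in>UNIV. \<Sum>b\<in>UNIV. ?t r a x b y) =
            (\<Sum>x\<in>idx m. \<Sum>a\<in>UNIV. \<Sum>y\<in>idx m. \<Sum>b\<in>UNIV. ?t r a x b y)"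
        by (intro sum.cong refl sum.swap)
      also have "\<dots> = (\<Sum>a\<in>UNIV. \<Sum>x\<in>idx m. \<Sum>y\<in>idx m. \<Sum>b\<in>UNIV. ?t r a x b y)"
        by (rule sum.swap)
      also have "\<dots> = (\<Sum>a\<in>UNIV. \<Sum>x\<in>idx m. \<Sum>b\<in>UNIV. \<Sum>y\<in>idx m. ?t r a x b y)"
        by (intro sum.cong refl sum.swap)
      finally show "(\<Sum>x\<in>idx m. \<Sum>y\<in>idx m. \<Sum>a\<in>UNIV. \<Sum>b\<in>UNIV. ?t r a x b y) =
         of_real (c r) * sesq (idx (Suc m)) G (V r) (V r)"
        by (simp add: sesq_def sum_idx_Suc sum_distrib_left)
    qed
    finally show ?thesis
      using cg(2) psd_sesq_nonneg[OF G] by (simp add: sum_nonneg)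
  qed
  ultimately show ?thesis unfolding psd_def sesq_def by blast
qed

lemma psd_contrL:
  assumes "\<forall>M\<in>set Ms. psd UNIV M" "psd (idx (length Ms + m)) G"
  shows "psd (idx m) (contrL Ms G)"
  using assms by (induction Ms arbitrary: G) (simp_all add: psd_contr)

definition tens :: "'a op list \<Rightarrow> 'a list op" where
  "tens Ms = (\<lambda>xs ys. \<Prod>i<length Ms. (Ms ! i) (xs ! i) (ys ! i))"

lemma tens_Nil [simp]: "tens [] xs ys = 1"
  by (simp add: tens_def)

lemma tens_Cons [simp]: "tens (M # Ms) (x # xs) (y # ys) = M x y * tens Ms xs ys"
  by (simp add: tens_def prod.lessThan_Suc_shift del: prod.lessThan_Suc)

lemma tr_tens:
  fixes G :: "'a::finite list op"
  shows "tr (idx (length Ms)) (mmult (idx (length Ms)) (tens Ms) G) = contrL Ms G [] []"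
proof (induction Ms arbitrary: G)
  case (Cons M Ms)
  let ?m = "length Ms"
  have "tr (idx (length (M # Ms))) (mmult (idx (length (M # Ms))) (tens (M # Ms)) G) =
    (\<Sum>a\<in>UNIV. \<Sum>x\<in>idx ?m. \<Sum>b\<in>UNIV. \<Sum>y\<in>idx ?m. M a b * tens Ms x y * G (b # y) (a # x))"
    by (simp add: tr_def mmult_def sum_idx_Suc)
  also have "\<dots> = (\<Sum>x\<in>idx ?m. \<Sum>a\<in>UNIV. \<Sum>b\<in>UNIV. \<Sum>y\<in>idx ?m. M a b * tens Ms x y * G (b # y) (a # x))"
    by (rule sum.swap)
  also have "\<dots> = (\<Sum>x\<in>idx ?m. \<Sum>b\<in>UNIV. \<Sum>a\<in>UNIV. \<Sum>y\<in>idx ?m. M a b * tens Ms x y * G (b # y) (a # x))"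
    by (intro sum.cong refl sum.swap)
  also have "\<dots> = (\<Sum>x\<in>idx ?m. \<Sum>b\<in>UNIV. \<Sum>y\<in>idx ?m. \<Sum>a\<in>UNIV. M a b * tens Ms x y * G (b # y) (a # x))"
    by (intro sum.cong refl sum.swap)
  also have "\<dots> = (\<Sum>x\<in>idx ?m. \<Sum>y\<in>idx ?m. \<Sum>b\<in>UNIV. \<Sum>a\<in>UNIV. M a b * tens Ms x y * G (b # y) (a # x))"
    by (intro sum.cong refl sum.swap)
  also have "\<dots> = tr (idx ?m) (mmult (idx ?m) (tens Ms) (contr M G))"
    unfolding tr_def mmult_def contr_def sum_distrib_left
    by (intro sum.cong refl) (simp add: mult_ac)
  finally show ?case using Cons by simp
qed (simp add: tr_def mmult_def)

lemma tr_tens_contrL: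
  "tr (idx (length Bs)) (mmult (idx (length Bs)) (tens Bs) (contrL As G)) = contrL (As @ Bs) G [] []"
  by (simp add: tr_tens contrL_append)

text \<open>The form of \<open>tens Ms\<close> at \<open>v\<close> is the full contraction of the
  rank-one operator |v><v|, and contraction with positive operators preserves positivity.\<close>

lemma psd_tens:
  fixes Ms :: "'a::finite op list"
  assumes "\<forall>M\<in>set Ms. psd UNIV M"
  shows "psd (idx (length Ms)) (tens Ms)"
proof -
  have "tens Ms x y = cnj (tens Ms y x)" for x y
    unfolding tens_def cnj_prod using assms
    by (intro prod.cong refl psd_hermitian[of UNIV]) auto
  moreover have "0 \<le> Re (sesq (idx (length Ms)) (tens Ms) v v)" for v
  proof -
    define G where "G = (\<lambda>y x. v y * cnj (v x))"
    have "psd I G" for I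
    proof -
      have "sesq I G w w = cnj (\<Sum>x\<in>I. cnj (v x) * w x) * (\<Sum>x\<in>I. cnj (v x) * w x)" for w
        unfolding cnj_sum sum_product by (simp add: sesq_def G_def mult_ac)
      then have "0 \<le> Re (sesq I G w w)" for w by (simp only: cnj_mult_self Re_complex_of_real zero_le_power2)
      then show ?thesis by (simp add: psd_def sesq_def G_def)
    qed
    then have "psd (idx 0) (contrL Ms G)" by (intro psd_contrL assms) auto
    from psd_sesq_nonneg[OF this, of "\<lambda>_. 1"]
    have "0 \<le> Re (contrL Ms G [] [])" by (simp add: sesq_def)
    moreover have "contrL Ms G [] [] = sesq (idx (length Ms)) (tens Ms) v v"
      unfolding tr_tens[symmetric] by (simp add: tr_def mmult_def sesq_def G_def mult_ac)
    ultimately show ?thesis by simp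
  qed
  ultimately show ?thesis unfolding psd_def sesq_def by blast
qed

section \<open>Local measurements of several particles\<close>

lemma prod_idop:
  assumes "length xs = length ys"
  shows "(\<Prod>i<length xs. idop (xs ! i) (ys ! i)) = idop xs ys"
  using assms
proof (cases "xs = ys")
  case False
  then obtain i where "i < length xs" "xs ! i \<noteq> ys ! i" using assms nth_equalityI by blast
  then show ?thesis using False by (auto simp: idop_def)
qed (simp add: idop_def)

lemma tens_append:
  assumes "length xs = length As + length Bs" "length ys = length As + length Bs"
  shows "tens (As @ Bs) xs ys = tens As (take (length As) xs) (take (length As) ys)
     * tens Bs (drop (length As) xs) (drop (length As) ys)"
  using assms
proof (induction As arbitrary: xs ys)
  case (Cons A As)
  then show ?case by (cases xs; cases ys) (simp_all add: mult.assoc)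
qed simp

lemma tens_replicate_idop:
  assumes "length xs = n" "length ys = n"
  shows "tens (replicate n idop) xs ys = idop xs ys"
  using prod_idop[of xs ys] assms by (simp add: tens_def)

lemma tens_append_idop:
  assumes "length xs = n" "length ys = n" "length As \<le> n"
  shows "tens (As @ replicate (n - length As) idop) xs ys =
     tens As (take (length As) xs) (take (length As) ys) * idop (drop (length As) xs) (drop (length As) ys)"
  using assms by (subst tens_append) (simp_all add: tens_replicate_idop)

text \<open>The measurements are a function of the position, so that both the given
  \<open>fst (\<Lambda>s l)\<close> and a history \<open>(!) Ls\<close> fit.\<close>

definition outcomes :: "(nat \<Rightarrow> 'a \<Rightarrow> 'a op) \<Rightarrow> 'a list \<Rightarrow> 'a op list" where
  "outcomes L u = map (\<lambda>l. L l (u ! l)) [0..<length u]"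

lemma length_outcomes [simp]: "length (outcomes L u) = length u"
  by (simp add: outcomes_def)

lemma outcomes_snoc: "outcomes L (u @ [y]) = outcomes L u @ [L (length u) y]"
  by (simp add: outcomes_def nth_append)

lemma tens_outcomes:
  "tens (outcomes L u) xs ys = (\<Prod>l<length u. L l (u ! l) (xs ! l) (ys ! l))"
  by (simp add: tens_def outcomes_def)

lemma psd_idop: "psd (UNIV :: 'a::finite set) idop"
proof -
  have "(\<Sum>x\<in>UNIV. \<Sum>y\<in>UNIV. cnj (v x) * idop x y * v y) = (\<Sum>x\<in>UNIV. cnj (v x) * v x)" for v :: "'a \<Rightarrow> complex"
    by (simp add: idop_def if_distrib if_distribR cong: if_cong)
  then show ?thesis by (auto simp: psd_def idop_def cnj_mult_self intro!: sum_nonneg)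
qed

text \<open>Measuring the first \<open>i\<close> of \<open>m\<close> particles and ignoring the
  others is a measurement on all \<open>m\<close>; the chain rule reveals the particles one at a
  time.\<close>

lemma povm_tens:
  fixes L :: "nat \<Rightarrow> 'a::finite \<Rightarrow> 'a op"
  assumes "\<And>l. l < i \<Longrightarrow> povm UNIV UNIV (L l)" "i \<le> m"
  shows "povm (idx m) (idx i) (\<lambda>u. tens (outcomes L u @ replicate (m - i) idop))"
  unfolding povm_def
proof (intro conjI ballI)
  fix u :: "'a list" assume u: "u \<in> idx i"
  have "\<forall>M\<in>set (outcomes L u @ replicate (m - i) idop). psd UNIV M"
    using u assms by (auto simp: outcomes_def idx_def povm_def psd_idop)
  from psd_tens[OF this] show "psd (idx m) (tens (outcomes L u @ replicate (m - i) idop))"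
    using u assms(2) by (simp add: idx_def)
next
  fix xs ys :: "'a list" assume xy: "xs \<in> idx m" "ys \<in> idx m"
  have "(\<Sum>u\<in>idx i. tens (outcomes L u @ replicate (m - i) idop) xs ys) =
    (\<Sum>u\<in>idx i. (\<Prod>l<i. L l (u ! l) (take i xs ! l) (take i ys ! l)) * idop (drop i xs) (drop i ys))"
  proof (intro sum.cong refl)
    fix u :: "'a list" assume "u \<in> idx i"
    then show "tens (outcomes L u @ replicate (m - i) idop) xs ys =
      (\<Prod>l<i. L l (u ! l) (take i xs ! l) (take i ys ! l)) * idop (drop i xs) (drop i ys)"
      using tens_append_idop[of xs m ys "outcomes L u"] xy assms(2)
      by (simp add: idx_def tens_outcomes)
  qed
  also have "\<dots> = (\<Prod>l<i. \<Sum>a\<in>UNIV. L l a (take i xs ! l) (take i ys ! l)) * idop (drop i xs) (drop i ys)"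
    unfolding sum_distrib_right[symmetric]
    using sum_idx_prod[of "\<lambda>l a. L l a (take i xs ! l) (take i ys ! l)" i] by simp
  also have "(\<Prod>l<i. \<Sum>a\<in>UNIV. L l a (take i xs ! l) (take i ys ! l)) = (\<Prod>l<i. idop (take i xs ! l) (take i ys ! l))"
    using assms(1) by (intro prod.cong refl) (simp add: povm_def)
  also have "\<dots> = idop (take i xs) (take i ys)"
  proof -
    have "length (take i xs) = i" "length (take i ys) = i" using xy assms(2) by (auto simp: idx_def)
    then show ?thesis using prod_idop[of "take i xs" "take i ys"] by simp
  qed
  also have "idop (take i xs) (take i ys) * idop (drop i xs) (drop i ys) = idop xs ys"
    by (auto simp: idop_def) (metis append_take_drop_id)
  finally show "(\<Sum>u\<in>idx i. tens (outcomes L u @ replicate (m - i) idop) xs ys) = idop xs ys" .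
qed

section \<open>Permutation symmetry\<close>

lemma permute_list_idx:
  "\<sigma> permutes {..<N} \<Longrightarrow> xs \<in> idx N \<Longrightarrow> permute_list \<sigma> xs \<in> idx N"
  by (simp add: idx_def)

lemma bij_betw_permute_list_idx:
  assumes "\<sigma> permutes {..<N}"
  shows "bij_betw (permute_list \<sigma>) (idx N) (idx N)"
proof (rule bij_betw_byWitness[where f' = "permute_list (inv_into UNIV \<sigma>)"])
  have i: "inv_into UNIV \<sigma> permutes {..<N}" by (rule permutes_inv[OF assms])
  show "\<forall>xs\<in>idx N. permute_list (inv_into UNIV \<sigma>) (permute_list \<sigma> xs) = xs"
    using assms i by (auto simp: idx_def permute_list_compose[symmetric] permutes_inv_o)
  show "\<forall>xs\<in>idx N. permute_list \<sigma> (permute_list (inv_into UNIV \<sigma>) xs) = xs"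
    using assms i by (auto simp: idx_def permute_list_compose[symmetric] permutes_inv_o)
qed (auto simp: idx_def)

text \<open>A permutation matrix has a single nonzero entry in each row and column; the commutation
  relation, read at the entry \<open>permute_list \<sigma> xs\<close>, \<open>ys\<close>, is this
  invariance.\<close>

lemma symmetric_state_permute:
  fixes \<Gamma> :: "'a::finite list op"
  assumes "symmetric_state N \<Gamma>" "\<sigma> permutes {..<N}" "xs \<in> idx N" "ys \<in> idx N"
  shows "\<Gamma> (permute_list \<sigma> xs) (permute_list \<sigma> ys) = \<Gamma> xs ys"
proof -
  note bij = bij_betw_permute_list_idx[OF assms(2), where ?'a = 'a]
  have po: "perm_op N \<sigma> us vs = (if us = permute_list \<sigma> vs then 1 else 0)" if "vs \<in> idx N" for us vs :: "'a list"
    using that by (simp add: perm_op_def permute_list_def idx_def)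
  have "mmult (idx N) (perm_op N \<sigma>) \<Gamma> (permute_list \<sigma> xs) ys = (\<Sum>z\<in>idx N. if z = xs then \<Gamma> z ys else 0)"
    unfolding mmult_def using assms(3) bij
    by (intro sum.cong refl) (auto simp: po bij_betw_def inj_on_def)
  also have "\<dots> = \<Gamma> xs ys" using assms(3) by simp
  finally have 1: "mmult (idx N) (perm_op N \<sigma>) \<Gamma> (permute_list \<sigma> xs) ys = \<Gamma> xs ys" .
  have "mmult (idx N) \<Gamma> (perm_op N \<sigma>) (permute_list \<sigma> xs) ys =
      (\<Sum>z\<in>idx N. if z = permute_list \<sigma> ys then \<Gamma> (permute_list \<sigma> xs) z else 0)"
    unfolding mmult_def using assms(4) by (intro sum.cong refl) (auto simp: po)
  also have "\<dots> = \<Gamma> (permute_list \<sigma> xs) (permute_list \<sigma> ys)"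
    using permute_list_idx[OF assms(2,4)] by simp
  finally show ?thesis using 1 assms permute_list_idx[OF assms(2,3)]
    unfolding symmetric_state_def by metis
qed

text \<open>Exchangeability: relabelling both index lists by the same permutation turns
  \<open>tens Ms\<close> into \<open>tens Ms'\<close> and leaves \<open>\<Gamma>\<close>
  unchanged.\<close>

lemma symmetric_state_contrL_mset:
  fixes \<Gamma> :: "'a::finite list op"
  assumes "symmetric_state N \<Gamma>" "length Ms = N" "mset Ms = mset Ms'"
  shows "contrL Ms \<Gamma> [] [] = contrL Ms' \<Gamma> [] []"
proof -
  obtain \<sigma> where \<sigma>: "\<sigma> permutes {..<length Ms'}" "permute_list \<sigma> Ms' = Ms"
    using mset_eq_permutation[OF assms(3)] .
  have len: "length Ms' = N" using assms(2,3) by (metis size_mset)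
  note s = \<sigma>(1)[unfolded len]
  note bij = bij_betw_permute_list_idx[OF s, where ?'a = 'a]
  have t: "tens Ms (permute_list \<sigma> x) (permute_list \<sigma> y) = tens Ms' x y" if "x \<in> idx N" "y \<in> idx N" for x y
  proof -
    have "tens Ms (permute_list \<sigma> x) (permute_list \<sigma> y) = (\<Prod>i<N. (Ms' ! \<sigma> i) (x ! \<sigma> i) (y ! \<sigma> i))"
      unfolding \<sigma>(2)[symmetric] tens_def using that len s
      by (auto simp: idx_def permute_list_nth intro!: prod.cong)
    also have "\<dots> = (\<Prod>i<N. (Ms' ! i) (x ! i) (y ! i))"
      using prod.permute[OF s, of "\<lambda>i. (Ms' ! i) (x ! i) (y ! i)"] by (simp add: o_def)
    finally show ?thesis by (simp add: tens_def len)
  qed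
  have "contrL Ms \<Gamma> [] [] = (\<Sum>x\<in>idx N. \<Sum>y\<in>idx N. tens Ms x y * \<Gamma> y x)"
    unfolding tr_tens[symmetric] assms(2) by (simp add: tr_def mmult_def)
  also have "\<dots> = (\<Sum>x\<in>idx N. \<Sum>y\<in>idx N. tens Ms (permute_list \<sigma> x) y * \<Gamma> y (permute_list \<sigma> x))"
    by (rule sum.reindex_bij_betw[OF bij, symmetric])
  also have "\<dots> = (\<Sum>x\<in>idx N. \<Sum>y\<in>idx N. tens Ms (permute_list \<sigma> x) (permute_list \<sigma> y) * \<Gamma> (permute_list \<sigma> y) (permute_list \<sigma> x))"
    by (intro sum.cong refl sum.reindex_bij_betw[OF bij, symmetric])
  also have "\<dots> = (\<Sum>x\<in>idx N. \<Sum>y\<in>idx N. tens Ms' x y * \<Gamma> y x)"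
    by (intro sum.cong refl) (simp add: t symmetric_state_permute[OF assms(1) s])
  also have "\<dots> = contrL Ms' \<Gamma> [] []"
    unfolding tr_tens[symmetric] len by (simp add: tr_def mmult_def)
  finally show ?thesis .
qed

section \<open>Trace norms, reduced density matrices and mixtures\<close>

lemma orthonormal_mult:
  assumes fin: "finite I" "finite J"
    and orth: "\<And>i j. i \<in> J \<Longrightarrow> j \<in> J \<Longrightarrow> overlap I (e i) (e j) = (if i = j then 1 else 0)"
  shows "(\<Sum>z\<in>I. (\<Sum>i\<in>J. c i * e i x * cnj (e i z)) * (\<Sum>j\<in>J. d j * e j z * cnj (e j y))) =
    (\<Sum>j\<in>J. c j * d j * e j x * cnj (e j y))"
proof -
  have "(\<Sum>z\<in>I. (\<Sum>i\<in>J. c i * e i x * cnj (e i z)) * (\<Sum>j\<in>J. d j * e j z * cnj (e j y))) =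
    (\<Sum>z\<in>I. \<Sum>i\<in>J. \<Sum>j\<in>J. (c i * d j * e i x * cnj (e j y)) * (cnj (e i z) * e j z))"
    unfolding sum_product by (simp add: mult_ac)
  also have "\<dots> = (\<Sum>i\<in>J. \<Sum>z\<in>I. \<Sum>j\<in>J. (c i * d j * e i x * cnj (e j y)) * (cnj (e i z) * e j z))"
    by (rule sum.swap)
  also have "\<dots> = (\<Sum>i\<in>J. \<Sum>j\<in>J. \<Sum>z\<in>I. (c i * d j * e i x * cnj (e j y)) * (cnj (e i z) * e j z))"
    by (intro sum.cong refl sum.swap)
  also have "\<dots> = (\<Sum>i\<in>J. \<Sum>j\<in>J. (c i * d j * e i x * cnj (e j y)) * (if i = j then 1 else 0))"
    unfolding sum_distrib_left[symmetric] overlap_def[symmetric]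
    by (intro sum.cong refl) (simp add: orth)
  also have "\<dots> = (\<Sum>j\<in>J. c j * d j * e j x * cnj (e j y))"
    using fin by (simp add: if_distrib cong: if_cong)
  finally show ?thesis .
qed

lemma psd_root_eigenvector:
  assumes fin: "finite I" and B: "psd I B" and D: "0 \<le> (D::real)"
    and BB: "\<And>x. x \<in> I \<Longrightarrow> (\<Sum>y\<in>I. mmult I B B x y * f y) = of_real (D\<^sup>2) * f x"
    and x: "x \<in> I"
  shows "(\<Sum>y\<in>I. B x y * f y) = of_real D * f x"
proof -
  \<comment> \<open>Since \<open>(B + D) (B - D) f = 0\<close>, the vector \<open>w = (B - D) f\<close> has eigenvalue \<open>- D\<close>.\<close>
  define w where "w x = (\<Sum>y\<in>I. B x y * f y) - of_real D * f x" for x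
  have Bw: "(\<Sum>y\<in>I. B x y * w y) = - of_real D * w x" if "x \<in> I" for x
  proof -
    have "(\<Sum>y\<in>I. B x y * (\<Sum>z\<in>I. B y z * f z)) = (\<Sum>z\<in>I. \<Sum>y\<in>I. B x y * B y z * f z)"
      unfolding sum_distrib_left by (subst sum.swap) (simp add: mult_ac)
    also have "\<dots> = of_real (D\<^sup>2) * f x"
      using BB[OF that] by (simp add: mmult_def sum_distrib_right)
    finally have "(\<Sum>y\<in>I. B x y * w y) = of_real (D\<^sup>2) * f x - of_real D * (\<Sum>y\<in>I. B x y * f y)"
      unfolding w_def right_diff_distrib sum_subtractf
      by (simp add: sum_distrib_left mult.left_commute)
    then show ?thesis by (simp add: w_def algebra_simps power2_eq_square)
  qed
  define n where "n = (\<Sum>x\<in>I. (cmod (w x))\<^sup>2)"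
  have n0: "0 \<le> n" by (simp add: n_def sum_nonneg)
  have nw: "(\<Sum>x\<in>I. cnj (w x) * w x) = of_real n" by (simp add: n_def cnj_mult_self)
  \<comment> \<open>For \<open>D = 0\<close>, \<open>w = B f\<close> and \<open>B w = 0\<close>, so
    the squared norm of \<open>w\<close> is the pairing of \<open>f\<close> with \<open>B w\<close>.
    Otherwise positivity of \<open>B\<close> at \<open>w\<close> contradicts the eigenvalue
    \<open>- D\<close> unless \<open>w\<close> vanishes.\<close>
  have "n = 0"
  proof (cases "D = 0")
    case True
    have "(\<Sum>x\<in>I. cnj (w x) * w x) = (\<Sum>x\<in>I. \<Sum>y\<in>I. cnj (f y) * (B y x * w x))"
    proof (intro sum.cong refl)
      fix x assume x: "x \<in> I"
      have "cnj (w x) = (\<Sum>y\<in>I. cnj (f y) * B y x)"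
        using x by (auto simp: w_def True cnj_sum psd_hermitian[OF B x] mult.commute intro!: sum.cong)
      then show "cnj (w x) * w x = (\<Sum>y\<in>I. cnj (f y) * (B y x * w x))"
        by (simp add: sum_distrib_right mult.assoc)
    qed
    also have "\<dots> = (\<Sum>y\<in>I. \<Sum>x\<in>I. cnj (f y) * (B y x * w x))" by (rule sum.swap)
    also have "\<dots> = 0"
      unfolding sum_distrib_left[symmetric] by (intro sum.neutral) (simp add: Bw True)
    finally show ?thesis using nw by simp
  next
    case False
    have "sesq I B w w = (\<Sum>x\<in>I. cnj (w x) * (\<Sum>y\<in>I. B x y * w y))"
      by (simp add: sesq_def sum_distrib_left mult.assoc)
    also have "\<dots> = (\<Sum>x\<in>I. - of_real D * (cnj (w x) * w x))"
      by (intro sum.cong refl) (simp add: Bw)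
    also have "\<dots> = of_real (- D * n)" unfolding sum_distrib_left[symmetric] nw by simp
    finally have "0 \<le> - D * n" using psd_sesq_nonneg[OF B, of w] by simp
    then show ?thesis using D False n0
      by (metis mult_minus_left mult_pos_pos neg_0_le_iff_le not_le order_le_less)
  qed
  then have "(cmod (w x))\<^sup>2 = 0"
    using sum_nonneg_eq_0_iff[OF fin, of "\<lambda>x. (cmod (w x))\<^sup>2"] x by (simp add: n_def)
  then show ?thesis by (simp add: w_def)
qed

text \<open>The absolute value has the same eigenvectors and the eigenvalues
  \<open>cmod (c j)\<close>. The definite description in \<open>op_abs\<close> also demands
  uniqueness.\<close>

lemma trace_norm_orthonormal:
  assumes fin: "finite I" "finite J"
    and orth: "\<And>i j. i \<in> J \<Longrightarrow> j \<in> J \<Longrightarrow> overlap I (e i) (e j) = (if i = j then 1 else 0)"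
    and compl: "\<And>x y. x \<in> I \<Longrightarrow> y \<in> I \<Longrightarrow> (\<Sum>j\<in>J. e j x * cnj (e j y)) = (if x = y then 1 else 0)"
  shows "trace_norm I (\<lambda>x y. \<Sum>j\<in>J. c j * e j x * cnj (e j y)) = (\<Sum>j\<in>J. cmod (c j))"
proof -
  let ?A = "\<lambda>x y. \<Sum>j\<in>J. c j * e j x * cnj (e j y)"
  let ?B = "\<lambda>x y. if x \<in> I \<and> y \<in> I then \<Sum>j\<in>J. of_real (cmod (c j)) * e j x * cnj (e j y) else 0"
  have om: "(\<Sum>z\<in>I. (\<Sum>i\<in>J. c i * e i x * cnj (e i z)) * (\<Sum>j\<in>J. d j * e j z * cnj (e j y))) =
    (\<Sum>j\<in>J. c j * d j * e j x * cnj (e j y))" for c d x y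
    by (rule orthonormal_mult[OF fin]) (rule orth)
  have adjA: "adj ?A = (\<lambda>x y. \<Sum>j\<in>J. cnj (c j) * e j x * cnj (e j y))"
    by (intro ext) (simp add: adj_def cnj_sum mult_ac)
  have AA: "mmult I (adj ?A) ?A x y = (\<Sum>j\<in>J. of_real ((cmod (c j))\<^sup>2) * e j x * cnj (e j y))" for x y
    unfolding adjA mmult_def om by (simp only: cnj_mult_self)
  have BB: "mmult I ?B ?B x y = (\<Sum>j\<in>J. of_real ((cmod (c j))\<^sup>2) * e j x * cnj (e j y))"
    if "x \<in> I" "y \<in> I" for x y
  proof -
    have "mmult I ?B ?B x y = (\<Sum>z\<in>I. (\<Sum>i\<in>J. of_real (cmod (c i)) * e i x * cnj (e i z))
        * (\<Sum>j\<in>J. of_real (cmod (c j)) * e j z * cnj (e j y)))"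
      unfolding mmult_def using that by (intro sum.cong refl) simp
    then show ?thesis unfolding om by (simp add: power2_eq_square)
  qed
  have psdB: "psd I ?B"
  proof -
    have "sesq I ?B v v = (\<Sum>j\<in>J. of_real (cmod (c j)) * (cnj (overlap I (e j) v) * overlap I (e j) v))" for v
    proof -
      have "sesq I ?B v v = (\<Sum>x\<in>I. \<Sum>y\<in>I. \<Sum>j\<in>J. of_real (cmod (c j)) * ((cnj (v x) * e j x) * (cnj (e j y) * v y)))"
        unfolding sesq_def by (intro sum.cong refl) (simp add: sum_distrib_left sum_distrib_right mult_ac)
      also have "\<dots> = (\<Sum>x\<in>I. \<Sum>j\<in>J. \<Sum>y\<in>I. of_real (cmod (c j)) * ((cnj (v x) * e j x) * (cnj (e j y) * v y)))"
        by (intro sum.cong refl sum.swap)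
      also have "\<dots> = (\<Sum>j\<in>J. \<Sum>x\<in>I. \<Sum>y\<in>I. of_real (cmod (c j)) * ((cnj (v x) * e j x) * (cnj (e j y) * v y)))"
        by (rule sum.swap)
      also have "\<dots> = (\<Sum>j\<in>J. of_real (cmod (c j)) * (overlap I v (e j) * overlap I (e j) v))"
        unfolding overlap_def sum_product unfolding sum_distrib_left ..
      finally show ?thesis by (simp only: cnj_overlap)
    qed
    then have "0 \<le> Re (sesq I ?B v v)" for v
      by (simp only: cnj_mult_self of_real_mult[symmetric] of_real_sum[symmetric] Re_complex_of_real)
        (intro sum_nonneg mult_nonneg_nonneg, simp_all)
    moreover have "?B x y = cnj (?B y x)" for x y by (simp add: cnj_sum mult_ac)
    ultimately show ?thesis unfolding psd_def sesq_def by blast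
  qed
  have "op_abs I ?A = ?B"
    unfolding op_abs_def
  proof (rule the_equality)
    show "supported I ?B \<and> psd I ?B \<and> (\<forall>x\<in>I. \<forall>y\<in>I. mmult I ?B ?B x y = mmult I (adj ?A) ?A x y)"
      using psdB BB AA by (auto simp: supported_def)
  next
    fix B assume B: "supported I B \<and> psd I B \<and> (\<forall>x\<in>I. \<forall>y\<in>I. mmult I B B x y = mmult I (adj ?A) ?A x y)"
    \<comment> \<open>Any positive root acts on each \<open>e j\<close> as the scalar
      \<open>cmod (c j)\<close>; completeness of the basis then fixes all its entries.\<close>
    have Be: "(\<Sum>y\<in>I. B x y * e j y) = of_real (cmod (c j)) * e j x" if j: "j \<in> J" and x: "x \<in> I" for j x
    proof (rule psd_root_eigenvector[OF fin(1) _ _ _ x])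
      fix x assume x: "x \<in> I"
      have "(\<Sum>y\<in>I. mmult I B B x y * e j y) = (\<Sum>y\<in>I. (\<Sum>i\<in>J. of_real ((cmod (c i))\<^sup>2) * e i x * cnj (e i y)) * e j y)"
        using B x AA by (intro sum.cong refl) simp
      also have "\<dots> = (\<Sum>i\<in>J. of_real ((cmod (c i))\<^sup>2) * e i x * overlap I (e i) (e j))"
        unfolding sum_distrib_right overlap_def sum_distrib_left by (subst sum.swap) (simp add: mult.assoc)
      also have "\<dots> = (\<Sum>i\<in>J. if i = j then of_real ((cmod (c j))\<^sup>2) * e j x else 0)"
        using j by (intro sum.cong refl) (simp add: orth)
      finally show "(\<Sum>y\<in>I. mmult I B B x y * e j y) = of_real ((cmod (c j))\<^sup>2) * e j x"
        using j fin by simp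
    qed (use B in auto)
    show "B = ?B"
    proof (intro ext)
      fix x y
      show "B x y = ?B x y"
      proof (cases "x \<in> I \<and> y \<in> I")
        case True
        have "B x y = (\<Sum>z\<in>I. B x z * (\<Sum>j\<in>J. e j z * cnj (e j y)))"
          using True fin by (simp add: compl if_distrib cong: if_cong)
        also have "\<dots> = (\<Sum>j\<in>J. (\<Sum>z\<in>I. B x z * e j z) * cnj (e j y))"
          unfolding sum_distrib_left sum_distrib_right by (subst sum.swap) (simp add: mult.assoc)
        also have "\<dots> = ?B x y" using True by (simp add: Be)
        finally show ?thesis .
      qed (use B in \<open>auto simp: supported_def\<close>)
    qed
  qed
  then have "trace_norm I ?A = Re (\<Sum>x\<in>I. \<Sum>j\<in>J. of_real (cmod (c j)) * (cnj (e j x) * e j x))"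
    by (simp add: trace_norm_def tr_def mult_ac)
  also have "(\<Sum>x\<in>I. \<Sum>j\<in>J. of_real (cmod (c j)) * (cnj (e j x) * e j x)) = (\<Sum>j\<in>J. of_real (cmod (c j)) * overlap I (e j) (e j))"
    unfolding overlap_def sum_distrib_left by (rule sum.swap)
  also have "\<dots> = (\<Sum>j\<in>J. of_real (cmod (c j)))" by (intro sum.cong refl) (simp add: orth)
  finally show ?thesis by simp
qed

text \<open>A left inverse of a square matrix is also a right inverse.\<close>

lemma orthonormal_UNIV_complete:
  fixes e :: "'a::finite \<Rightarrow> 'a \<Rightarrow> complex"
  assumes "\<And>i j. (\<Sum>x\<in>UNIV. cnj (e i x) * e j x) = (if i = j then 1 else 0)"
  shows "(\<Sum>j\<in>UNIV. e j x * cnj (e j y)) = (if x = y then 1 else 0)"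
proof -
  define A :: "complex^'a^'a" where "A = (\<chi> i x. cnj (e i x))"
  define B :: "complex^'a^'a" where "B = (\<chi> x j. e j x)"
  have "A ** B = Finite_Cartesian_Product.mat 1" by (simp add: vec_eq_iff matrix_matrix_mult_def A_def B_def Finite_Cartesian_Product.mat_def assms)
  then have "B ** A = Finite_Cartesian_Product.mat 1" by (simp add: matrix_left_right_inverse)
  then have "(B ** A) $ x $ y = (Finite_Cartesian_Product.mat 1 :: complex^'a^'a) $ x $ y" by simp
  then show ?thesis by (simp add: matrix_matrix_mult_def A_def B_def Finite_Cartesian_Product.mat_def)
qed

text \<open>The measured operator is diagonal in the product basis \<open>tensE\<close>, with the
  traces against the effects as coefficients, so its trace norm is their l1 norm, whatever the
  basis. This turns the theorem into a statement about outcome distributions.\<close>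

lemma trace_norm_tensor_meas_apply:
  fixes \<Lambda>s :: "nat \<Rightarrow> 'a::finite meas"
  assumes "\<And>i. i < k \<Longrightarrow> one_measurement (\<Lambda>s i)"
  shows "trace_norm (idx k) (tensor_meas_apply k \<Lambda>s X) =
    (\<Sum>js\<in>idx k. cmod (tr (idx k) (mmult (idx k) (tens (outcomes (\<lambda>l. fst (\<Lambda>s l)) js)) X)))"
proof -
  have o: "(\<Sum>x\<in>UNIV. cnj (snd (\<Lambda>s l) i x) * snd (\<Lambda>s l) j x) = (if i = j then 1 else 0)"
    if "l < k" for l i j
    using assms[OF that] by (simp add: one_measurement_def is_measurement_def)
  have c: "(\<Sum>j\<in>UNIV. snd (\<Lambda>s l) j x * cnj (snd (\<Lambda>s l) j y)) = (if x = y then 1 else 0)"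
    if "l < k" for l x y
    by (rule orthonormal_UNIV_complete[OF o[OF that]])
  have orth: "overlap (idx k) (tensE k \<Lambda>s is) (tensE k \<Lambda>s js) = (if is = js then 1 else 0)"
    if "is \<in> idx k" "js \<in> idx k" for "is" js
  proof -
    have "overlap (idx k) (tensE k \<Lambda>s is) (tensE k \<Lambda>s js) =
       (\<Sum>x\<in>idx k. \<Prod>l<k. cnj (snd (\<Lambda>s l) (is ! l) (x ! l)) * snd (\<Lambda>s l) (js ! l) (x ! l))"
      by (simp add: overlap_def tensE_def prod.distrib)
    also have "\<dots> = (\<Prod>l<k. \<Sum>a\<in>UNIV. cnj (snd (\<Lambda>s l) (is ! l) a) * snd (\<Lambda>s l) (js ! l) a)"
      by (rule sum_idx_prod)
    also have "\<dots> = (\<Prod>l<k. idop (is ! l) (js ! l))"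
      by (intro prod.cong refl) (simp add: o idop_def)
    finally show ?thesis using prod_idop[of "is" js] that by (simp add: idx_def idop_def)
  qed
  have compl: "(\<Sum>js\<in>idx k. tensE k \<Lambda>s js x * cnj (tensE k \<Lambda>s js y)) = (if x = y then 1 else 0)"
    if "x \<in> idx k" "y \<in> idx k" for x y
  proof -
    have "(\<Sum>js\<in>idx k. tensE k \<Lambda>s js x * cnj (tensE k \<Lambda>s js y)) =
       (\<Sum>js\<in>idx k. \<Prod>l<k. snd (\<Lambda>s l) (js ! l) (x ! l) * cnj (snd (\<Lambda>s l) (js ! l) (y ! l)))"
      by (simp add: tensE_def prod.distrib)
    also have "\<dots> = (\<Prod>l<k. \<Sum>a\<in>UNIV. snd (\<Lambda>s l) a (x ! l) * cnj (snd (\<Lambda>s l) a (y ! l)))"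
      by (rule sum_idx_prod)
    also have "\<dots> = (\<Prod>l<k. idop (x ! l) (y ! l))"
      by (intro prod.cong refl) (simp add: c idop_def)
    finally show ?thesis using prod_idop[of x y] that by (simp add: idx_def idop_def)
  qed
  have M: "tensM k \<Lambda>s js = tens (outcomes (\<lambda>l. fst (\<Lambda>s l)) js)" if "js \<in> idx k" for js
    using that by (intro ext) (simp add: tensM_def tens_outcomes idx_def)
  show ?thesis
    unfolding tensor_meas_apply_def meas_apply_def
    by (subst trace_norm_orthonormal[OF finite_idx finite_idx orth compl]) (simp_all add: M)
qed

text \<open>The partial trace \<open>?G\<close> over the last \<open>N - k\<close> particles
  satisfies the description in \<open>rdm\<close>; testing against matrix units shows that nothing
  else does.\<close>

lemma tr_rdm:
  fixes \<Gamma> :: "'a::finite list op"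
  assumes "k \<le> N"
  shows "tr (idx k) (mmult (idx k) B (rdm N k \<Gamma>)) = tr (idx N) (mmult (idx N) (kron k B idop) \<Gamma>)"
proof -
  let ?G = "\<lambda>xs ys. if xs \<in> idx k \<and> ys \<in> idx k then \<Sum>zs\<in>idx (N - k). \<Gamma> (xs @ zs) (ys @ zs) else 0"
  let ?P = "\<lambda>G. supported (idx k) G \<and>
     (\<forall>B. tr (idx k) (mmult (idx k) B G) = tr (idx N) (mmult (idx N) (kron k B idop) \<Gamma>))"
  have G: "tr (idx k) (mmult (idx k) B ?G) = tr (idx N) (mmult (idx N) (kron k B idop) \<Gamma>)" for B
  proof -
    have "tr (idx (k + (N - k))) (mmult (idx (k + (N - k))) (kron k B idop) \<Gamma>) =
      (\<Sum>x\<in>idx k. \<Sum>x'\<in>idx (N - k). \<Sum>y\<in>idx k. \<Sum>y'\<in>idx (N - k). B x y * (if x' = y' then \<Gamma> (y @ y') (x @ x') else 0))"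
      unfolding tr_def mmult_def sum_idx_add
      by (intro sum.cong refl) (simp add: kron_def idop_def idx_def)
    also have "\<dots> = (\<Sum>x\<in>idx k. \<Sum>x'\<in>idx (N - k). \<Sum>y\<in>idx k. B x y * \<Gamma> (y @ x') (x @ x'))"
      by (intro sum.cong refl) (simp add: sum_distrib_left[symmetric])
    also have "\<dots> = (\<Sum>x\<in>idx k. \<Sum>y\<in>idx k. \<Sum>x'\<in>idx (N - k). B x y * \<Gamma> (y @ x') (x @ x'))"
      by (intro sum.cong refl sum.swap)
    also have "\<dots> = tr (idx k) (mmult (idx k) B ?G)"
      unfolding tr_def mmult_def by (intro sum.cong refl) (simp add: sum_distrib_left)
    finally show ?thesis using assms by simp
  qed
  have "?P ?G" using G by (simp add: supported_def)
  moreover have "G = ?G" if "?P G" for G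
  proof (intro ext)
    fix b a
    show "G b a = ?G b a"
    proof (cases "a \<in> idx k \<and> b \<in> idx k")
      case True
      have unit: "tr (idx k) (mmult (idx k) (\<lambda>x y. if x = a \<and> y = b then 1 else 0) H) = H b a" for H
      proof -
        have "tr (idx k) (mmult (idx k) (\<lambda>x y. if x = a \<and> y = b then 1 else 0) H) =
          (\<Sum>x\<in>idx k. \<Sum>y\<in>idx k. if y = b then (if x = a then H b a else 0) else 0)"
          unfolding tr_def mmult_def by (intro sum.cong refl) auto
        then show ?thesis using True by simp
      qed
      have "G b a = tr (idx k) (mmult (idx k) (\<lambda>x y. if x = a \<and> y = b then 1 else 0) G)"
        by (rule unit[symmetric])
      also have "\<dots> = tr (idx k) (mmult (idx k) (\<lambda>x y. if x = a \<and> y = b then 1 else 0) ?G)"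
        unfolding G using that by blast
      also have "\<dots> = ?G b a" by (rule unit)
      finally show ?thesis .
    qed (use that in \<open>auto simp: supported_def\<close>)
  qed
  ultimately have "?P (rdm N k \<Gamma>)" unfolding rdm_def by (rule theI)
  then show ?thesis by blast
qed

section \<open>Finite mixtures of one-particle states\<close>

lemma borel_measurable_tpow:
  "(\<lambda>\<gamma> :: 'a op. tpow k \<gamma> xs ys) \<in> borel_measurable borel"
proof -
  have "continuous_on UNIV (\<lambda>\<gamma> :: 'a op. \<gamma> a b)" for a b
    by (rule continuous_on_product_then_coordinatewise[OF continuous_on_product_coordinates])
  then have "continuous_on UNIV (\<lambda>\<gamma> :: 'a op. tpow k \<gamma> xs ys)"
    unfolding tpow_def by (intro continuous_on_prod) auto
  then show ?thesis by (rule borel_measurable_continuous_onI)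
qed

text \<open>The image under \<open>\<gamma>\<close> of a distribution with weights \<open>p\<close>.
  The underlying space is the whole type, so \<open>\<gamma>\<close> has to take states as values
  even outside \<open>X\<close>.\<close>

lemma finite_mixture_exists:
  fixes \<gamma> :: "'x \<Rightarrow> 'a::finite op"
  assumes fin: "finite X" and p: "\<And>x. x \<in> X \<Longrightarrow> 0 \<le> p x" "sum p X = 1"
    and \<gamma>: "\<And>x. \<gamma> x \<in> states UNIV"
  shows "\<exists>\<mu>. prob_space \<mu> \<and> space \<mu> = states (UNIV :: 'a set) \<and>
    sets \<mu> = sets (restrict_space borel (states (UNIV :: 'a set))) \<and>
    (\<forall>k xs ys. tpow_integral k \<mu> xs ys = (\<Sum>x\<in>X. of_real (p x) * tpow k (\<gamma> x) xs ys))"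
proof -
  let ?S = "restrict_space borel (states (UNIV :: 'a set))"
  define P where "P x = (if x \<in> X then p x else 0)" for x
  define q where "q = embed_pmf P"
  have "(\<integral>\<^sup>+ x. ennreal (P x) \<partial>count_space UNIV) = (\<integral>\<^sup>+ x. ennreal (p x) \<partial>count_space X)"
    by (subst nn_integral_count_space_indicator) (auto simp: P_def indicator_def intro!: nn_integral_cong)
  also have "\<dots> = 1" using fin p by (simp add: nn_integral_count_space_finite sum_ennreal)
  finally have pq: "pmf q x = P x" for x
    unfolding q_def using p by (intro pmf_embed_pmf) (auto simp: P_def)
  define \<mu> where "\<mu> = distr (measure_pmf q) ?S \<gamma>"
  have m: "\<gamma> \<in> measurable (measure_pmf q) ?S"
    using \<gamma> by (auto simp: measurable_def space_restrict_space)
  have "tpow_integral k \<mu> xs ys = (\<Sum>x\<in>X. of_real (p x) * tpow k (\<gamma> x) xs ys)" for k xs ys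
  proof -
    have "tpow_integral k \<mu> xs ys = (\<integral>x. tpow k (\<gamma> x) xs ys \<partial>measure_pmf q)"
      unfolding tpow_integral_def \<mu>_def
      by (intro integral_distr m measurable_restrict_space1 borel_measurable_tpow)
    also have "\<dots> = (\<Sum>x\<in>X. pmf q x *\<^sub>R tpow k (\<gamma> x) xs ys)"
      by (intro integral_measure_pmf fin) (auto simp: set_pmf_iff pq P_def split: if_splits)
    finally show ?thesis by (simp add: pq P_def scaleR_conv_of_real)
  qed
  moreover have "prob_space \<mu>" unfolding \<mu>_def by (intro measure_pmf.prob_space_distr m)
  ultimately show ?thesis by (intro exI[of _ \<mu>]) (simp_all add: \<mu>_def space_restrict_space)
qed

section \<open>Conditioning on measured particles\<close>

text \<open>Otherwise every list shorter than \<open>n\<close> could be prolonged with a gain above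
  \<open>C / n\<close>, and \<open>n\<close> such gains would lift \<open>F\<close> from
  \<open>- C\<close> above 0.\<close>

lemma greedy_small_increment:
  fixes F :: "'b list \<Rightarrow> real"
  assumes "0 < n" "- C \<le> F []"
    and "\<And>Ls. length Ls = n \<Longrightarrow> set Ls \<subseteq> S \<Longrightarrow> F Ls \<le> 0"
  obtains Ls where "length Ls < n" "set Ls \<subseteq> S" "\<And>L. L \<in> S \<Longrightarrow> F (Ls @ [L]) - F Ls \<le> C / real n"
proof -
  have "\<exists>Ls. length Ls < n \<and> set Ls \<subseteq> S \<and> (\<forall>L\<in>S. F (Ls @ [L]) - F Ls \<le> C / real n)"
  proof (rule ccontr)
    assume "\<not> ?thesis"
    then have step: "\<exists>L\<in>S. F (Ls @ [L]) - F Ls > C / real n" if "length Ls < n" "set Ls \<subseteq> S" for Ls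
      using that by (meson not_le)
    \<comment> \<open>Equality may hold at \<open>m = 0\<close>, so strictness is claimed only after
      a first step; \<open>0 < n\<close> provides one.\<close>
    have "\<exists>Ls. length Ls = m \<and> set Ls \<subseteq> S \<and> F Ls \<ge> - C + real m * (C / real n) \<and>
        (0 < m \<longrightarrow> F Ls > - C + real m * (C / real n))" if "m \<le> n" for m
      using that
    proof (induction m)
      case 0
      then show ?case using assms(2) by (intro exI[of _ "[]"]) simp
    next
      case (Suc m)
      then obtain Ls where Ls: "length Ls = m" "set Ls \<subseteq> S" "F Ls \<ge> - C + real m * (C / real n)"
        by auto
      then obtain L where L: "L \<in> S" "F (Ls @ [L]) - F Ls > C / real n"
        using step[of Ls] Suc.prems by auto
      have "real (Suc m) * (C / real n) = real m * (C / real n) + C / real n"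
        by (simp only: of_nat_Suc distrib_right mult_1 add.commute)
      then have "F (Ls @ [L]) > - C + real (Suc m) * (C / real n)"
        using L(2) Ls(3) by linarith
      then show ?case using Ls L by (intro exI[of _ "Ls @ [L]"]) simp
    qed
    from this[of n] obtain Ls where "length Ls = n" "set Ls \<subseteq> S" "F Ls > - C + real n * (C / real n)"
      using assms(1) by auto
    then show False using assms(1) assms(3)[of Ls] by simp
  qed
  then show thesis using that by blast
qed

text \<open>\<open>P []\<close> is the weight of a fixed history, \<open>c i\<close> the marginal
  law of the outcome at position \<open>i\<close>, and \<open>Q\<close> the product of these
  marginals rescaled to mass \<open>P []\<close>. The summands on the right are the mutual
  informations of each outcome with the earlier ones.\<close>

lemma relative_entropy_chain_rule:
  fixes P :: "'a::finite list \<Rightarrow> real" and c :: "nat \<Rightarrow> 'a \<Rightarrow> real"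
  defines "Q \<equiv> \<lambda>k u. P [] * (\<Prod>i<k. c i (u ! i) / P [])"
  assumes nonneg: "\<And>u. length u \<le> k \<Longrightarrow> 0 \<le> P u"
    and marginal: "\<And>u. length u < k \<Longrightarrow> (\<Sum>y\<in>UNIV. P (u @ [y])) = P u"
    and le: "\<And>u i. length u \<le> k \<Longrightarrow> i < length u \<Longrightarrow> P u \<le> c i (u ! i)"
    and le0: "\<And>u. length u \<le> k \<Longrightarrow> P u \<le> P []"
  shows "(\<Sum>u\<in>idx k. P u * (ln (P u) - ln (Q k u))) =
    (\<Sum>i<k. \<Sum>u\<in>idx i. \<Sum>y\<in>UNIV. P (u @ [y]) * (ln (P (u @ [y])) - ln (P u) - ln (c i y) + ln (P [])))"
  using nonneg marginal le le0
proof (induction k)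
  case 0
  then show ?case by (simp add: Q_def)
next
  case (Suc k)
  have step: "P (u @ [y]) * (ln (P (u @ [y])) - ln (Q (Suc k) (u @ [y]))) =
     P (u @ [y]) * (ln (P (u @ [y])) - ln (P u) - ln (c k y) + ln (P [])) + P (u @ [y]) * (ln (P u) - ln (Q k u))"
    if u: "u \<in> idx k" for u y
  \<comment> \<open>Where \<open>P (u @ [y])\<close> vanishes both sides are 0; elsewhere
    \<open>le\<close> and \<open>le0\<close> make every factor of \<open>Q\<close> positive, so the
    logarithm splits.\<close>
  proof (cases "P (u @ [y]) = 0")
    case False
    have lu: "length u = k" using u by (simp add: idx_def)
    then have Pp: "P (u @ [y]) > 0" using Suc.prems(1)[of "u @ [y]"] False by simp
    have p: "P [] > 0" using Suc.prems(4)[of "u @ [y]"] Pp lu by simp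
    have ci: "c i ((u @ [y]) ! i) > 0" if "i < Suc k" for i
      using Suc.prems(3)[of "u @ [y]" i] Pp lu that by simp
    have ck: "c k y > 0" using ci[of k] lu by (simp add: nth_append)
    have cu: "c i (u ! i) > 0" if "i < k" for i using ci[of i] lu that by (simp add: nth_append)
    have Qu: "Q k u > 0" unfolding Q_def using p cu by (intro mult_pos_pos prod_pos divide_pos_pos) auto
    have "Q (Suc k) (u @ [y]) = Q k u * (c k y / P [])"
      unfolding Q_def using lu by (simp add: nth_append)
    then have lnQ: "ln (Q (Suc k) (u @ [y])) = ln (Q k u) + ln (c k y) - ln (P [])"
      using Qu ck p by (simp add: ln_mult ln_div)
    show ?thesis unfolding lnQ by (simp add: algebra_simps)
  qed simp
  have "(\<Sum>u\<in>idx (Suc k). P u * (ln (P u) - ln (Q (Suc k) u))) =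
    (\<Sum>u\<in>idx k. \<Sum>y\<in>UNIV. P (u @ [y]) * (ln (P (u @ [y])) - ln (P u) - ln (c k y) + ln (P []))
      + P (u @ [y]) * (ln (P u) - ln (Q k u)))"
    unfolding sum_idx_snoc by (intro sum.cong refl step)
  also have "\<dots> = (\<Sum>u\<in>idx k. \<Sum>y\<in>UNIV. P (u @ [y]) * (ln (P (u @ [y])) - ln (P u) - ln (c k y) + ln (P [])))
      + (\<Sum>u\<in>idx k. P u * (ln (P u) - ln (Q k u)))"
    unfolding sum.distrib sum_distrib_right[symmetric] using Suc.prems(2)
    by (simp add: idx_def)
  finally show ?case using Suc.IH Suc.prems by simp
qed

lemma psd_sum:
  assumes "\<And>i. i \<in> S \<Longrightarrow> psd I (A i)"
  shows "psd I (\<lambda>x y. \<Sum>i\<in>S. A i x y)"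
proof -
  have "sesq I (\<lambda>x y. \<Sum>i\<in>S. A i x y) v v = (\<Sum>i\<in>S. sesq I (A i) v v)" for v
  proof -
    have "sesq I (\<lambda>x y. \<Sum>i\<in>S. A i x y) v v = (\<Sum>x\<in>I. \<Sum>i\<in>S. \<Sum>y\<in>I. cnj (v x) * A i x y * v y)"
      unfolding sesq_def sum_distrib_left sum_distrib_right by (intro sum.cong refl sum.swap)
    also have "\<dots> = (\<Sum>i\<in>S. sesq I (A i) v v)" unfolding sesq_def by (rule sum.swap)
    finally show ?thesis .
  qed
  then have "0 \<le> Re (sesq I (\<lambda>x y. \<Sum>i\<in>S. A i x y) v v)" for v
    using assms by (simp add: sum_nonneg psd_sesq_nonneg)
  moreover have "(\<Sum>i\<in>S. A i x y) = cnj (\<Sum>i\<in>S. A i y x)" if "x \<in> I" "y \<in> I" for x y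
    unfolding cnj_sum using that assms by (intro sum.cong refl psd_hermitian) auto
  ultimately show ?thesis unfolding psd_def sesq_def by blast
qed

lemma tr_tens_idop:
  fixes A :: "'a::finite list op"
  shows "tr (idx m) (mmult (idx m) (tens (replicate m idop)) A) = tr (idx m) A"
  unfolding tr_def
proof (intro sum.cong refl)
  fix x :: "'a list" assume x: "x \<in> idx m"
  have "mmult (idx m) (tens (replicate m idop)) A x x = (\<Sum>z\<in>idx m. if z = x then A x x else 0)"
    unfolding mmult_def using x
    by (intro sum.cong refl) (subst tens_replicate_idop, auto simp: idx_def idop_def)
  then show "mmult (idx m) (tens (replicate m idop)) A x x = A x x" using x by simp
qed

section \<open>Outcome probabilities and information potentials\<close>

definition povm1 :: "('a::finite \<Rightarrow> 'a op) \<Rightarrow> bool" where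
  "povm1 L \<longleftrightarrow> povm UNIV UNIV L"

lemma povm1_psd: "povm1 L \<Longrightarrow> psd UNIV (L y)"
  by (simp add: povm1_def povm_def)

lemma povm1_sum: "povm1 L \<Longrightarrow> (\<Sum>y\<in>UNIV. L y a b) = idop a b"
  by (simp add: povm1_def povm_def)

text \<open>An effect is taken as a member of some measurement rather than as an operator between 0
  and 1: completing it to that measurement shows that a further outcome only lowers a joint
  probability.\<close>

definition effects :: "'a::finite op set" where
  "effects = {L y |L y. povm1 L}"

lemma effects_psd: "M \<in> effects \<Longrightarrow> psd UNIV M"
  by (auto simp: effects_def povm1_psd)

lemma outcomes_effects:
  "(\<And>i. i < length u \<Longrightarrow> povm1 (L i)) \<Longrightarrow> set (outcomes L u) \<subseteq> effects"
  by (auto simp: outcomes_def effects_def)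

text \<open>\<open>joint_prob N \<Gamma> Ms\<close> is the probability that measurements on \<open>length Ms\<close> of the
  particles yield the effects \<open>Ms\<close>; \<open>cond_op\<close> is the unnormalised state of the last
  \<open>N - n\<close> particles given these outcomes among the first \<open>n\<close>.\<close>

definition joint_prob :: "nat \<Rightarrow> 'a::finite list op \<Rightarrow> 'a op list \<Rightarrow> real" where
  "joint_prob N \<Gamma> Ms = Re (contrL (Ms @ replicate (N - length Ms) idop) \<Gamma> [] [])"

definition cond_op :: "nat \<Rightarrow> 'a::finite list op \<Rightarrow> 'a op list \<Rightarrow> 'a list op" where
  "cond_op n \<Gamma> Ms = contrL (Ms @ replicate (n - length Ms) idop) \<Gamma>"

context
  fixes N :: nat and \<Gamma> :: "'a::finite list op"
  assumes sym: "symmetric_state N \<Gamma>"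
begin

lemma psd_\<Gamma>: "psd (idx N) \<Gamma>"
  using sym by (simp add: symmetric_state_def states_def)

lemma cond_op_psd:
  assumes "set Ms \<subseteq> effects" "length Ms \<le> n" "n \<le> N"
  shows "psd (idx (N - n)) (cond_op n \<Gamma> Ms)"
  unfolding cond_op_def
proof (rule psd_contrL)
  show "\<forall>M\<in>set (Ms @ replicate (n - length Ms) idop). psd UNIV M"
    using assms by (auto simp: psd_idop effects_psd)
  show "psd (idx (length (Ms @ replicate (n - length Ms) idop) + (N - n))) \<Gamma>"
    using assms psd_\<Gamma> by simp
qed

lemma contrL_joint_prob:
  assumes "set Ms \<subseteq> effects" "length Ms \<le> N"
  shows "contrL (Ms @ replicate (N - length Ms) idop) \<Gamma> [] [] = of_real (joint_prob N \<Gamma> Ms)"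
    and "0 \<le> joint_prob N \<Gamma> Ms"
proof -
  have p: "psd (idx 0) (contrL (Ms @ replicate (N - length Ms) idop) \<Gamma>)"
    using cond_op_psd[OF assms] by (simp add: cond_op_def)
  have "contrL (Ms @ replicate (N - length Ms) idop) \<Gamma> [] [] = cnj (contrL (Ms @ replicate (N - length Ms) idop) \<Gamma> [] [])"
    by (rule psd_hermitian[OF p]) simp_all
  then show "contrL (Ms @ replicate (N - length Ms) idop) \<Gamma> [] [] = of_real (joint_prob N \<Gamma> Ms)"
    by (simp add: joint_prob_def complex_eq_iff)
  show "0 \<le> joint_prob N \<Gamma> Ms"
    using psd_sesq_nonneg[OF p, of "\<lambda>_. 1"] by (simp add: joint_prob_def sesq_def)
qed

lemma joint_prob_mset:
  assumes "mset Ms = mset Ms'" "length Ms \<le> N"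
  shows "joint_prob N \<Gamma> Ms = joint_prob N \<Gamma> Ms'"
proof -
  have "length Ms' = length Ms" using assms(1) by (metis size_mset)
  then show ?thesis unfolding joint_prob_def
    using symmetric_state_contrL_mset[OF sym, of "Ms @ replicate (N - length Ms) idop" "Ms' @ replicate (N - length Ms') idop"]
      assms by simp
qed

lemma joint_prob_sum:
  assumes "povm1 L" "length Ms < N"
  shows "(\<Sum>y\<in>UNIV. joint_prob N \<Gamma> (Ms @ [L y])) = joint_prob N \<Gamma> Ms"
proof -
  have "N - length Ms = Suc (N - Suc (length Ms))" using assms by simp
  then have "joint_prob N \<Gamma> Ms = Re (contrL (Ms @ idop # replicate (N - Suc (length Ms)) idop) \<Gamma> [] [])"
    by (simp add: joint_prob_def)
  then show ?thesis
    using contrL_sum_insert[OF povm1_sum[OF assms(1)], where As = Ms and Bs = "replicate (N - Suc (length Ms)) idop"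
        and G = \<Gamma> and xs = "[]" and ys = "[]"]
    by (simp add: joint_prob_def Re_sum[symmetric])
qed

lemma joint_prob_Nil: "joint_prob N \<Gamma> [] = 1"
proof -
  have "contrL (replicate N idop) \<Gamma> [] [] = tr (idx N) \<Gamma>"
    using tr_tens[of "replicate N idop" \<Gamma>] by (simp add: tr_tens_idop)
  then show ?thesis using sym by (simp add: joint_prob_def symmetric_state_def states_def)
qed

lemma joint_prob_append_le:
  assumes "set Ms \<subseteq> effects" "set Ms' \<subseteq> effects" "length Ms + length Ms' \<le> N"
  shows "joint_prob N \<Gamma> (Ms @ Ms') \<le> joint_prob N \<Gamma> Ms"
  using assms
proof (induction Ms' rule: rev_induct)
  case (snoc M Ms')
  then obtain L y where L: "povm1 L" "M = L y" by (auto simp: effects_def)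
  have "joint_prob N \<Gamma> ((Ms @ Ms') @ [L y]) \<le> (\<Sum>y\<in>UNIV. joint_prob N \<Gamma> ((Ms @ Ms') @ [L y]))"
    using snoc.prems L by (intro member_le_sum contrL_joint_prob) (auto simp: effects_def)
  also have "\<dots> = joint_prob N \<Gamma> (Ms @ Ms')" using snoc.prems by (intro joint_prob_sum L) simp
  also have "\<dots> \<le> joint_prob N \<Gamma> Ms" using snoc by simp
  finally show ?case by (simp add: L)
qed simp

lemma joint_prob_outcomes_sum:
  assumes "\<And>i. i < k \<Longrightarrow> povm1 (L i)" "length Ms + k \<le> N"
  shows "(\<Sum>u\<in>idx k. joint_prob N \<Gamma> (Ms @ outcomes L u)) = joint_prob N \<Gamma> Ms"
  using assms
proof (induction k)
  case (Suc k)
  have "(\<Sum>u\<in>idx (Suc k). joint_prob N \<Gamma> (Ms @ outcomes L u)) =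
      (\<Sum>u\<in>idx k. \<Sum>y\<in>UNIV. joint_prob N \<Gamma> ((Ms @ outcomes L u) @ [L k y]))"
    unfolding sum_idx_snoc by (intro sum.cong refl) (simp add: outcomes_snoc idx_def)
  also have "\<dots> = (\<Sum>u\<in>idx k. joint_prob N \<Gamma> (Ms @ outcomes L u))"
    using Suc.prems by (intro sum.cong refl joint_prob_sum) (auto simp: idx_def)
  finally show ?case using Suc by simp
qed (simp add: outcomes_def)

lemma joint_prob_pad:
  assumes "length Ms + r \<le> N"
  shows "joint_prob N \<Gamma> (Ms @ replicate r idop) = joint_prob N \<Gamma> Ms"
proof -
  have "replicate r idop @ replicate (N - (length Ms + r)) idop = replicate (N - length Ms) (idop :: 'a op)"
    using assms by (simp add: replicate_add[symmetric])
  then show ?thesis by (simp add: joint_prob_def)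
qed

text \<open>The padding by \<open>idop\<close> stands between the two groups of effects;
  exchangeability moves it to the end, where it is absorbed.\<close>

lemma tr_tens_cond_op:
  assumes "length Ms \<le> n" "n \<le> N" "length Bs = N - n"
  shows "tq (idx (N - n)) (tens Bs) (cond_op n \<Gamma> Ms) = joint_prob N \<Gamma> (Ms @ Bs)"
proof -
  have "tq (idx (N - n)) (tens Bs) (cond_op n \<Gamma> Ms) = Re (contrL (Ms @ replicate (n - length Ms) idop @ Bs) \<Gamma> [] [])"
    using tr_tens_contrL[of Bs "Ms @ replicate (n - length Ms) idop" \<Gamma>] assms
    by (simp add: tq_def cond_op_def)
  also have "\<dots> = joint_prob N \<Gamma> (Ms @ replicate (n - length Ms) idop @ Bs)"
    using assms by (simp add: joint_prob_def)
  also have "\<dots> = joint_prob N \<Gamma> ((Ms @ Bs) @ replicate (n - length Ms) idop)"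
    using assms by (intro joint_prob_mset) simp_all
  also have "\<dots> = joint_prob N \<Gamma> (Ms @ Bs)"
    using assms by (intro joint_prob_pad) simp
  finally show ?thesis .
qed

lemma tr_cond_op:
  assumes "length Ms \<le> n" "n \<le> N"
  shows "Re (tr (idx (N - n)) (cond_op n \<Gamma> Ms)) = joint_prob N \<Gamma> Ms"
proof -
  have "tr (idx (N - n)) (cond_op n \<Gamma> Ms) =
     tr (idx (N - n)) (mmult (idx (N - n)) (tens (replicate (N - n) idop)) (cond_op n \<Gamma> Ms))"
    by (simp only: tr_tens_idop)
  then show ?thesis
    using tr_tens_cond_op[OF assms, of "replicate (N - n) idop"] joint_prob_pad[of Ms "N - n"] assms
    by (simp add: tq_def)
qed

lemma cond_op_sum:
  assumes "povm1 L" "length Ms < n"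
  shows "(\<Sum>y\<in>UNIV. cond_op n \<Gamma> (Ms @ [L y]) xs ys) = cond_op n \<Gamma> Ms xs ys"
proof -
  have "n - length Ms = Suc (n - Suc (length Ms))" using assms by simp
  then show ?thesis
    using contrL_sum_insert[OF povm1_sum[OF assms(1)], where As = Ms and Bs = "replicate (n - Suc (length Ms)) idop"
        and G = \<Gamma> and xs = xs and ys = ys]
    by (simp add: cond_op_def)
qed

text \<open>Minus the probability of the history times the entropy of the normalised conditional
  state of the last \<open>N - n\<close> particles.\<close>

definition info_potential :: "nat \<Rightarrow> 'a op list \<Rightarrow> real" where
  "info_potential n Ms = neg_entropy (idx (N - n)) (cond_op n \<Gamma> Ms)
     - joint_prob N \<Gamma> Ms * ln (joint_prob N \<Gamma> Ms)"

text \<open>Holevo's bound for the last \<open>N - n\<close> particles, of which \<open>i\<close>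
  are measured, and one more particle, measured by \<open>L i\<close>. As
  \<open>length Ms < n\<close>, that particle is available among the first \<open>n\<close>;
  exchangeability makes its outcome the one at position \<open>i\<close>.\<close>

lemma mutual_information_le:
  assumes Ms: "set Ms \<subseteq> effects" "length Ms < n" "n \<le> N"
    and L: "\<And>l. l \<le> i \<Longrightarrow> povm1 (L l)" and i: "i \<le> N - n"
  shows "(\<Sum>u\<in>idx i. \<Sum>y\<in>UNIV. joint_prob N \<Gamma> (Ms @ outcomes L (u @ [y])) *
      (ln (joint_prob N \<Gamma> (Ms @ outcomes L (u @ [y]))) - ln (joint_prob N \<Gamma> (Ms @ outcomes L u))
       - ln (joint_prob N \<Gamma> (Ms @ [L i y])) + ln (joint_prob N \<Gamma> Ms))) \<le>
    (\<Sum>y\<in>UNIV. info_potential n (Ms @ [L i y])) - info_potential n Ms"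
proof -
  let ?I = "idx (N - n) :: 'a list set"
  let ?E = "\<lambda>u. tens (outcomes L u @ replicate (N - n - i) idop)"
  let ?R = "\<lambda>y. cond_op n \<Gamma> (Ms @ [L i y])"
  have Li: "L i y \<in> effects" for y using L by (auto simp: effects_def)
  have R: "psd ?I (?R y)" for y using Ms Li by (intro cond_op_psd) auto
  have S: "psd ?I (cond_op n \<Gamma> Ms)" using Ms by (intro cond_op_psd) auto
  \<comment> \<open>The difference is the sum of the conditional operators of the other
    outcomes.\<close>
  have dom: "psd ?I (\<lambda>x x'. cond_op n \<Gamma> Ms x x' - ?R y x x')" for y
  proof -
    have "(\<lambda>x x'. cond_op n \<Gamma> Ms x x' - ?R y x x') = (\<lambda>x x'. \<Sum>y'\<in>UNIV - {y}. ?R y' x x')"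
      by (intro ext) (simp add: sum_diff1 cond_op_sum[OF L Ms(2)])
    then show ?thesis using psd_sum[of "UNIV - {y}" ?I ?R] R by simp
  qed
  have E: "povm ?I (idx i) ?E" using L i by (intro povm_tens) (auto simp: povm1_def)
  have pR: "tq ?I (?E u) (?R y) = joint_prob N \<Gamma> (Ms @ outcomes L (u @ [y]))" if "u \<in> idx i" for u y
  proof -
    have lu: "length u = i" using that by (simp add: idx_def)
    have "tq ?I (?E u) (?R y) = joint_prob N \<Gamma> ((Ms @ [L i y]) @ outcomes L u @ replicate (N - n - i) idop)"
      using Ms i lu by (intro tr_tens_cond_op) auto
    also have "\<dots> = joint_prob N \<Gamma> ((Ms @ [L i y] @ outcomes L u) @ replicate (N - n - i) idop)" by simp
    also have "\<dots> = joint_prob N \<Gamma> (Ms @ [L i y] @ outcomes L u)"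
      using Ms i lu by (intro joint_prob_pad) simp
    also have "\<dots> = joint_prob N \<Gamma> (Ms @ outcomes L (u @ [y]))"
      using Ms i lu by (intro joint_prob_mset) (simp_all add: outcomes_snoc)
    finally show ?thesis .
  qed
  have pS: "tq ?I (?E u) (cond_op n \<Gamma> Ms) = joint_prob N \<Gamma> (Ms @ outcomes L u)" if "u \<in> idx i" for u
  proof -
    have lu: "length u = i" using that by (simp add: idx_def)
    have "tq ?I (?E u) (cond_op n \<Gamma> Ms) = joint_prob N \<Gamma> (Ms @ outcomes L u @ replicate (N - n - i) idop)"
      using Ms i lu by (intro tr_tens_cond_op) auto
    also have "\<dots> = joint_prob N \<Gamma> (Ms @ outcomes L u)"
      using joint_prob_pad[of "Ms @ outcomes L u"] Ms i lu by simp
    finally show ?thesis .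
  qed
  have tR: "Re (tr ?I (?R y)) = joint_prob N \<Gamma> (Ms @ [L i y])" for y
    using Ms by (intro tr_cond_op) auto
  have tS: "Re (tr ?I (cond_op n \<Gamma> Ms)) = joint_prob N \<Gamma> Ms"
    using Ms by (intro tr_cond_op) auto
  let ?ln = "\<lambda>u y. ln (tq ?I (?E u) (?R y)) - ln (tq ?I (?E u) (cond_op n \<Gamma> Ms))
      - ln (Re (tr ?I (?R y))) + ln (Re (tr ?I (cond_op n \<Gamma> Ms)))"
  have "(\<Sum>u\<in>idx i. \<Sum>y\<in>UNIV. joint_prob N \<Gamma> (Ms @ outcomes L (u @ [y])) *
      (ln (joint_prob N \<Gamma> (Ms @ outcomes L (u @ [y]))) - ln (joint_prob N \<Gamma> (Ms @ outcomes L u))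
       - ln (joint_prob N \<Gamma> (Ms @ [L i y])) + ln (joint_prob N \<Gamma> Ms))) =
    (\<Sum>u\<in>idx i. \<Sum>y\<in>UNIV. tq ?I (?E u) (?R y) * ?ln u y)"
    by (intro sum.cong refl) (simp only: pR pS tR tS)
  also have "\<dots> \<le> (\<Sum>y\<in>UNIV. neg_entropy ?I (?R y) - Re (tr ?I (?R y)) * ln (Re (tr ?I (?R y))))
      - (neg_entropy ?I (cond_op n \<Gamma> Ms) - Re (tr ?I (cond_op n \<Gamma> Ms)) * ln (Re (tr ?I (cond_op n \<Gamma> Ms))))"
    by (rule holevo_bound[OF finite_idx finite_idx finite E R S cond_op_sum[OF L Ms(2)] dom]) simp
  finally show ?thesis unfolding tR tS info_potential_def .
qed

text \<open>Summed over the outcomes of \<open>Ls\<close>, the potential is minus the average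
  entropy of \<open>N - n\<close> particles: at least \<open>- (N - n) * ln d\<close> for the empty
  history and never positive, as the greedy argument requires.\<close>

lemma small_increment_exists:
  assumes "0 < n" "n \<le> N"
  obtains Ls where "length Ls < n" "\<And>L. L \<in> set Ls \<Longrightarrow> povm1 L"
    "\<And>L. povm1 L \<Longrightarrow> (\<Sum>x\<in>idx (length Ls). (\<Sum>y\<in>UNIV. info_potential n (outcomes ((!) Ls) x @ [L y]))
        - info_potential n (outcomes ((!) Ls) x)) \<le> real (N - n) * ln (real CARD('a)) / real n"
proof -
  define F where "F Ls = (\<Sum>x\<in>idx (length Ls). info_potential n (outcomes ((!) Ls) x))" for Ls
  have ef: "set (outcomes ((!) Ls) x) \<subseteq> effects" if "set Ls \<subseteq> Collect povm1" "x \<in> idx (length Ls)" for Ls and x :: "'a list"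
    using that by (intro outcomes_effects) (auto simp: idx_def dest: nth_mem)
  have F0: "- (real (N - n) * ln (real CARD('a))) \<le> F []"
  proof -
    have p: "psd (idx (N - n)) (cond_op n \<Gamma> [])" using assms by (intro cond_op_psd) auto
    have "tr (idx (N - n)) (cond_op n \<Gamma> []) = of_real (Re (tr (idx (N - n)) (cond_op n \<Gamma> [])))"
      using neg_entropy_eigenbasis[OF finite_idx p] eigenbasis_trace[OF finite_idx]
      by (metis Re_complex_of_real)
    also have "\<dots> = 1" using assms by (simp add: tr_cond_op joint_prob_Nil)
    finally have "- ln (real (card (idx (N - n) :: 'a list set))) \<le> neg_entropy (idx (N - n)) (cond_op n \<Gamma> [])"
      by (intro neg_entropy_ge p idx_nonempty finite_idx)
    then show ?thesis by (simp add: F_def info_potential_def joint_prob_Nil outcomes_def card_idx ln_realpow)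
  qed
  have Fn: "F Ls \<le> 0" if "length Ls = n" "set Ls \<subseteq> Collect povm1" for Ls
    unfolding F_def
  proof (rule sum_nonpos)
    fix x :: "'a list" assume x: "x \<in> idx (length Ls)"
    then have "length x = n" using that by (simp add: idx_def)
    then show "info_potential n (outcomes ((!) Ls) x) \<le> 0"
      using neg_entropy_le[OF finite_idx cond_op_psd[OF ef[OF that(2) x], of n]] assms
      by (simp add: info_potential_def tr_cond_op)
  qed
  obtain Ls where Ls: "length Ls < n" "set Ls \<subseteq> Collect povm1"
    "\<And>L. L \<in> Collect povm1 \<Longrightarrow> F (Ls @ [L]) - F Ls \<le> real (N - n) * ln (real CARD('a)) / real n"
    using greedy_small_increment[of n "real (N - n) * ln (real CARD('a))" F "Collect povm1"] assms(1) F0 Fn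
    by blast
  have "F (Ls @ [L]) - F Ls = (\<Sum>x\<in>idx (length Ls). (\<Sum>y\<in>UNIV. info_potential n (outcomes ((!) Ls) x @ [L y]))
        - info_potential n (outcomes ((!) Ls) x))" for L
  proof -
    have "outcomes ((!) (Ls @ [L])) (x @ [y]) = outcomes ((!) Ls) x @ [L y]" if "x \<in> idx (length Ls)" for x y
      using that by (auto simp: outcomes_def idx_def nth_append)
    then show ?thesis by (simp add: F_def sum_idx_snoc sum_subtractf)
  qed
  then show thesis using Ls by (intro that[of Ls]) auto
qed

end

section \<open>Conditional one-particle states and the distance to their product\<close>

lemma tr_tens_tpow:
  fixes \<gamma> :: "'a::finite op"
  assumes "js \<in> idx k"
  shows "tr (idx k) (mmult (idx k) (tens (outcomes L js)) (tpow k \<gamma>)) =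
    (\<Prod>l<k. tr UNIV (mmult UNIV (L l (js ! l)) \<gamma>))"
proof -
  have "tr (idx k) (mmult (idx k) (tens (outcomes L js)) (tpow k \<gamma>)) =
    (\<Sum>x\<in>idx k. \<Sum>y\<in>idx k. \<Prod>l<k. L l (js ! l) (x ! l) (y ! l) * \<gamma> (y ! l) (x ! l))"
    unfolding tr_def mmult_def using assms
    by (intro sum.cong refl) (simp add: tens_outcomes tpow_def prod.distrib idx_def)
  also have "\<dots> = (\<Sum>x\<in>idx k. \<Prod>l<k. \<Sum>b\<in>UNIV. L l (js ! l) (x ! l) b * \<gamma> b (x ! l))"
    by (intro sum.cong refl sum_idx_prod)
  also have "\<dots> = (\<Prod>l<k. \<Sum>a\<in>UNIV. \<Sum>b\<in>UNIV. L l (js ! l) a b * \<gamma> b a)"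
    by (rule sum_idx_prod)
  finally show ?thesis by (simp add: tr_def mmult_def)
qed

text \<open>Contracting \<open>N - 1\<close> particles leaves the last one. The division normalises
  only if the history has positive probability.\<close>

definition cond_state :: "nat \<Rightarrow> 'a::finite list op \<Rightarrow> 'a op list \<Rightarrow> 'a op" where
  "cond_state N \<Gamma> Ms = (\<lambda>a b. cond_op (N - 1) \<Gamma> Ms [a] [b] / of_real (joint_prob N \<Gamma> Ms))"

context
  fixes N :: nat and \<Gamma> :: "'a::finite list op"
  assumes sym: "symmetric_state N \<Gamma>"
begin

lemma tr_cond_state:
  assumes "length Ms < N"
  shows "tr UNIV (mmult UNIV M (cond_state N \<Gamma> Ms)) =
    contrL (Ms @ M # replicate (N - Suc (length Ms)) idop) \<Gamma> [] [] / of_real (joint_prob N \<Gamma> Ms)"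
proof -
  have "tr UNIV (mmult UNIV M (cond_state N \<Gamma> Ms)) =
    (\<Sum>a\<in>UNIV. \<Sum>b\<in>UNIV. M a b * cond_op (N - 1) \<Gamma> Ms [b] [a]) / of_real (joint_prob N \<Gamma> Ms)"
    by (simp add: tr_def mmult_def cond_state_def sum_divide_distrib)
  also have "(\<Sum>a\<in>UNIV. \<Sum>b\<in>UNIV. M a b * cond_op (N - 1) \<Gamma> Ms [b] [a]) = contrL [M] (cond_op (N - 1) \<Gamma> Ms) [] []"
    unfolding contrL.simps contr_def by (rule sum.swap)
  also have "\<dots> = contrL (Ms @ replicate (N - Suc (length Ms)) idop @ [M]) \<Gamma> [] []"
    unfolding cond_op_def contrL_append[symmetric] by simp
  also have "\<dots> = contrL (Ms @ M # replicate (N - Suc (length Ms)) idop) \<Gamma> [] []"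
    using assms by (intro symmetric_state_contrL_mset[OF sym]) simp_all
  finally show ?thesis .
qed

lemma tr_cond_state_effect:
  assumes "length Ms < N" "set Ms \<subseteq> effects" "M \<in> effects"
  shows "tr UNIV (mmult UNIV M (cond_state N \<Gamma> Ms)) =
    of_real (joint_prob N \<Gamma> (Ms @ [M]) / joint_prob N \<Gamma> Ms)"
  using contrL_joint_prob(1)[OF sym, of "Ms @ [M]"] assms by (simp add: tr_cond_state)

lemma cond_state_states:
  assumes "length Ms < N" "set Ms \<subseteq> effects" "0 < joint_prob N \<Gamma> Ms"
  shows "cond_state N \<Gamma> Ms \<in> states UNIV"
proof -
  define p where "p = joint_prob N \<Gamma> Ms"
  let ?G = "cond_op (N - 1) \<Gamma> Ms"
  have p: "p > 0" using assms by (simp add: p_def)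
  have G: "psd (idx (Suc 0)) ?G"
    using cond_op_psd[OF sym assms(2), of "N - 1"] assms(1) by simp
  have "cond_state N \<Gamma> Ms a b = cnj (cond_state N \<Gamma> Ms b a)" for a b
    using psd_hermitian[OF G, of "[a]" "[b]"] by (simp add: cond_state_def idx_def)
  moreover have "0 \<le> Re (sesq UNIV (cond_state N \<Gamma> Ms) v v)" for v
  proof -
    have "sesq UNIV (cond_state N \<Gamma> Ms) v v = sesq (idx (Suc 0)) ?G (\<lambda>xs. v (hd xs)) (\<lambda>xs. v (hd xs)) / of_real p"
      by (simp add: sesq_def cond_state_def sum_idx_1 sum_divide_distrib p_def)
    then show ?thesis using psd_sesq_nonneg[OF G] p by simp
  qed
  ultimately have "psd UNIV (cond_state N \<Gamma> Ms)" unfolding psd_def sesq_def by blast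
  moreover have "tr UNIV (cond_state N \<Gamma> Ms) = 1"
  proof -
    have "N - length Ms = Suc (N - Suc (length Ms))" using assms(1) by simp
    then have "contrL (Ms @ idop # replicate (N - Suc (length Ms)) idop) \<Gamma> [] [] = of_real p"
      using contrL_joint_prob(1)[OF sym assms(2)] assms(1) by (simp add: p_def)
    moreover have "tr UNIV (mmult UNIV idop (cond_state N \<Gamma> Ms)) = tr UNIV (cond_state N \<Gamma> Ms)"
      by (simp add: tr_def mmult_def idop_def if_distrib if_distribR cong: if_cong)
    ultimately show ?thesis using tr_cond_state[OF assms(1), of idop] p by (simp add: p_def)
  qed
  ultimately show ?thesis by (simp add: states_def)
qed

lemma tr_rdm_outcomes:
  assumes "js \<in> idx k" "k \<le> N" "\<And>l. l < k \<Longrightarrow> povm1 (L l)"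
  shows "tr (idx k) (mmult (idx k) (tens (outcomes L js)) (rdm N k \<Gamma>)) = of_real (joint_prob N \<Gamma> (outcomes L js))"
proof -
  have lj: "length js = k" using assms by (simp add: idx_def)
  let ?Ms = "outcomes L js @ replicate (N - k) idop"
  have "tr (idx N) (mmult (idx N) (kron k (tens (outcomes L js)) idop) \<Gamma>) = tr (idx N) (mmult (idx N) (tens ?Ms) \<Gamma>)"
    unfolding tr_def mmult_def
  proof (intro sum.cong refl)
    fix x z :: "'a list" assume "x \<in> idx N" "z \<in> idx N"
    then show "kron k (tens (outcomes L js)) idop x z * \<Gamma> z x = tens ?Ms x z * \<Gamma> z x"
      using tens_append_idop[of x N z "outcomes L js"] lj assms(2) by (simp add: idx_def kron_def)
  qed
  also have "\<dots> = contrL ?Ms \<Gamma> [] []"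
    using tr_tens[of ?Ms \<Gamma>] lj assms(2) by simp
  also have "\<dots> = of_real (joint_prob N \<Gamma> (outcomes L js))"
    using contrL_joint_prob(1)[OF sym, of "outcomes L js"] outcomes_effects[of js L] assms lj by simp
  finally show ?thesis unfolding tr_rdm[OF assms(2)] .
qed

text \<open>Pinsker's inequality is applied once, to the joint law of the history outcomes
  \<open>x\<close> and the outcomes \<open>u\<close>, instead of history by history; the average
  then stays inside the square root.\<close>

lemma conditional_product_distance:
  fixes Ls :: "('a \<Rightarrow> 'a op) list" and L :: "nat \<Rightarrow> 'a \<Rightarrow> 'a op"
  assumes k: "1 \<le> k" "k \<le> N" and n: "n = N - k + 1"
    and Ls: "length Ls < n" "\<And>K. K \<in> set Ls \<Longrightarrow> povm1 K"
    and inc: "\<And>K. povm1 K \<Longrightarrow> (\<Sum>x\<in>idx (length Ls). (\<Sum>y\<in>UNIV. info_potential N \<Gamma> n (outcomes ((!) Ls) x @ [K y]))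
        - info_potential N \<Gamma> n (outcomes ((!) Ls) x)) \<le> real (N - n) * ln (real CARD('a)) / real n"
    and L: "\<And>l. l < k \<Longrightarrow> povm1 (L l)"
  defines "m \<equiv> outcomes ((!) Ls)"
  shows "(\<Sum>u\<in>idx k. \<Sum>x\<in>idx (length Ls). \<bar>joint_prob N \<Gamma> (m x @ outcomes L u) -
      joint_prob N \<Gamma> (m x) * (\<Prod>i<k. joint_prob N \<Gamma> (m x @ [L i (u ! i)]) / joint_prob N \<Gamma> (m x))\<bar>)
    \<le> sqrt (2 * (real k - 1)\<^sup>2 * ln (real CARD('a)) / (real N - real k + 1))"
proof -
  define j where "j = length Ls"
  define P where "P x u = joint_prob N \<Gamma> (m x @ outcomes L u)" for x u
  define c where "c x i y = joint_prob N \<Gamma> (m x @ [L i y])" for x i y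
  define Q where "Q x u = P x [] * (\<Prod>i<k. c x i (u ! i) / P x [])" for x u
  have P_Nil: "P x [] = joint_prob N \<Gamma> (m x)" for x by (simp add: P_def outcomes_def)
  have jk: "j + k \<le> N" using Ls(1) n k by (simp add: j_def)
  have mx: "set (m x) \<subseteq> effects" "length (m x) = j" if "x \<in> idx j" for x
    using outcomes_effects[of x "(!) Ls"] Ls(2) that by (auto simp: m_def idx_def j_def)
  have out: "set (outcomes L u) \<subseteq> effects" if "length u \<le> k" for u
    using that L by (intro outcomes_effects) auto
  have P0: "0 \<le> P x u" if "x \<in> idx j" "length u \<le> k" for x u
    unfolding P_def using mx[OF that(1)] out[OF that(2)] jk that
    by (intro contrL_joint_prob[OF sym]) auto
  have P_marginal: "(\<Sum>y\<in>UNIV. P x (u @ [y])) = P x u" if "x \<in> idx j" "length u < k" for x u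
    using joint_prob_sum[OF sym L[OF that(2)], of "m x @ outcomes L u"] mx[OF that(1)] that jk
    by (simp add: P_def outcomes_snoc)
  \<comment> \<open>Exchangeability brings the effect at position \<open>i\<close> to the front of
    \<open>outcomes L u\<close>, and forgetting the other outcomes can only raise the
    probability.\<close>
  have P_le: "P x u \<le> c x i (u ! i)" if x: "x \<in> idx j" and u: "length u \<le> k" "i < length u" for x u i
  proof -
    define M where "M = L i (u ! i)"
    have M: "M \<in> set (outcomes L u)" using u by (auto simp: M_def outcomes_def)
    have "P x u = joint_prob N \<Gamma> ((m x @ [M]) @ remove1 M (outcomes L u))"
      unfolding P_def using M mx[OF x] u jk
      by (intro joint_prob_mset[OF sym]) simp_all
    also have "\<dots> \<le> joint_prob N \<Gamma> (m x @ [M])"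
      using M mx[OF x] out[OF u(1)] u jk set_remove1_subset[of M "outcomes L u"]
      by (intro joint_prob_append_le[OF sym]) (auto simp: length_remove1)
    finally show ?thesis by (simp add: c_def M_def)
  qed
  have P_le_Nil: "P x u \<le> P x []" if "x \<in> idx j" "length u \<le> k" for x u
    unfolding P_Nil unfolding P_def using mx[OF that(1)] out[OF that(2)] that jk
    by (intro joint_prob_append_le[OF sym]) auto
  have P_sum: "(\<Sum>u\<in>idx k. P x u) = P x []" if "x \<in> idx j" for x
    unfolding P_Nil unfolding P_def using mx[OF that] jk L
    by (intro joint_prob_outcomes_sum[OF sym]) auto
  have P_Nil_sum: "(\<Sum>x\<in>idx j. P x []) = 1"
    unfolding P_Nil using joint_prob_outcomes_sum[OF sym, of j "(!) Ls" "[]"] Ls jk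
    by (simp add: m_def j_def joint_prob_Nil[OF sym])
  have c_sum: "(\<Sum>y\<in>UNIV. c x i y) = P x []" if "x \<in> idx j" "i < k" for x i
    unfolding P_Nil c_def using mx[OF that(1)] that jk by (intro joint_prob_sum[OF sym] L) auto
  have c0: "0 \<le> c x i y" if "x \<in> idx j" "i < k" for x i y
    unfolding c_def using mx[OF that(1)] that jk L
    by (intro contrL_joint_prob[OF sym]) (auto simp: effects_def)
  have Q0: "0 \<le> Q x u" if "x \<in> idx j" for x u
    unfolding Q_def using c0[OF that] P0[OF that]
    by (intro mult_nonneg_nonneg prod_nonneg) auto
  have Q_sum: "(\<Sum>u\<in>idx k. Q x u) = P x []" if x: "x \<in> idx j" for x
  proof (cases "P x [] = 0")
    case False
    have "(\<Sum>u\<in>idx k. Q x u) = P x [] * (\<Prod>i<k. \<Sum>y\<in>UNIV. c x i y / P x [])"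
      unfolding Q_def sum_distrib_left[symmetric] using sum_idx_prod[of "\<lambda>i y. c x i y / P x []" k] by simp
    also have "(\<Prod>i<k. \<Sum>y\<in>UNIV. c x i y / P x []) = 1"
      using False by (intro prod.neutral) (simp add: sum_divide_distrib[symmetric] c_sum[OF x])
    finally show ?thesis by simp
  qed (simp add: Q_def)
  have ac: "P x u = 0" if x: "x \<in> idx j" and u: "u \<in> idx k" and Q: "Q x u = 0" for x u
  proof (rule ccontr)
    assume "P x u \<noteq> 0"
    have lu: "length u = k" using u by (simp add: idx_def)
    then have Pp: "P x u > 0" using P0[OF x, of u] \<open>P x u \<noteq> 0\<close> by simp
    then have "P x [] > 0" using P_le_Nil[OF x, of u] lu by simp
    moreover have "c x i (u ! i) > 0" if "i < k" for i using P_le[OF x, of u i] lu that Pp by simp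
    ultimately have "Q x u > 0" unfolding Q_def by (intro mult_pos_pos prod_pos) auto
    then show False using Q by simp
  qed
  define T where "T x i = (\<Sum>u\<in>idx i. \<Sum>y\<in>UNIV. P x (u @ [y]) *
      (ln (P x (u @ [y])) - ln (P x u) - ln (c x i y) + ln (P x [])))" for x i
  have chain: "(\<Sum>u\<in>idx k. P x u * (ln (P x u) - ln (Q x u))) = (\<Sum>i<k. T x i)" if x: "x \<in> idx j" for x
    unfolding T_def Q_def
    by (rule relative_entropy_chain_rule) (use P0[OF x] P_marginal[OF x] P_le[OF x] P_le_Nil[OF x] in auto)
  define C where "C = (real k - 1) * ln (real CARD('a)) / (real N - real k + 1)"
  have nr: "real n = real N - real k + 1" and Nn: "real (N - n) = real k - 1" and Nn': "N - n = k - 1"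
    using n k by (simp_all add: of_nat_diff)
  have T_le: "(\<Sum>x\<in>idx j. T x i) \<le> C" if i: "i < k" for i
  proof -
    have "T x i \<le> (\<Sum>y\<in>UNIV. info_potential N \<Gamma> n (m x @ [L i y])) - info_potential N \<Gamma> n (m x)"
      if x: "x \<in> idx j" for x
      unfolding T_def P_Nil unfolding P_def c_def
      using mx[OF x] Ls(1) n k i L by (intro mutual_information_le[OF sym]) (auto simp: j_def)
    then have "(\<Sum>x\<in>idx j. T x i) \<le> (\<Sum>x\<in>idx j. (\<Sum>y\<in>UNIV. info_potential N \<Gamma> n (m x @ [L i y])) - info_potential N \<Gamma> n (m x))"
      by (rule sum_mono)
    also have "\<dots> \<le> C" using inc[OF L[OF i]] unfolding C_def nr[symmetric] Nn[symmetric] j_def m_def .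
    finally show ?thesis .
  qed
  \<comment> \<open>The first outcome has no earlier one to be correlated with; this leaves
    \<open>k - 1\<close> terms.\<close>
  have T0: "T x 0 = 0" for x
    unfolding T_def by (intro sum.neutral) (simp add: P_def c_def outcomes_def)
  have "(\<Sum>x\<in>idx j. \<Sum>u\<in>idx k. P x u * (ln (P x u) - ln (Q x u))) = (\<Sum>x\<in>idx j. \<Sum>i<k. T x i)"
    by (intro sum.cong refl chain)
  also have "\<dots> = (\<Sum>i<k. \<Sum>x\<in>idx j. T x i)" by (rule sum.swap)
  also have "\<dots> = (\<Sum>i\<in>{1..<k}. \<Sum>x\<in>idx j. T x i)"
    by (rule sum.mono_neutral_right) (auto simp: T0 not_le)
  also have "\<dots> \<le> (\<Sum>i\<in>{1..<k}. C)" by (intro sum_mono T_le) auto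
  also have "\<dots> = (real k - 1) * C" using k by (simp add: of_nat_diff)
  finally have KL: "(\<Sum>x\<in>idx j. \<Sum>u\<in>idx k. P x u * (ln (P x u) - ln (Q x u))) \<le> (real k - 1) * C" .
  let ?Z = "(idx j :: 'a list set) \<times> (idx k :: 'a list set)"
  have "(\<Sum>z\<in>?Z. \<bar>P (fst z) (snd z) - Q (fst z) (snd z)\<bar>)\<^sup>2 \<le>
     2 * (\<Sum>z\<in>?Z. P (fst z) (snd z) * ln (P (fst z) (snd z)) - P (fst z) (snd z) * ln (Q (fst z) (snd z)))"
  proof (rule pinsker)
    show "finite ?Z" by simp
    show "(\<Sum>z\<in>?Z. P (fst z) (snd z)) = 1" "(\<Sum>z\<in>?Z. Q (fst z) (snd z)) = 1"
      using P_sum Q_sum P_Nil_sum by (simp_all add: sum.cartesian_product')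
  qed (use P0 Q0 ac in \<open>auto simp: idx_def\<close>)
  also have "(\<Sum>z\<in>?Z. P (fst z) (snd z) * ln (P (fst z) (snd z)) - P (fst z) (snd z) * ln (Q (fst z) (snd z)))
     = (\<Sum>x\<in>idx j. \<Sum>u\<in>idx k. P x u * (ln (P x u) - ln (Q x u)))"
    by (simp add: sum.cartesian_product' right_diff_distrib)
  also have "(\<Sum>z\<in>?Z. \<bar>P (fst z) (snd z) - Q (fst z) (snd z)\<bar>) = (\<Sum>u\<in>idx k. \<Sum>x\<in>idx j. \<bar>P x u - Q x u\<bar>)"
    by (subst sum.swap) (simp add: sum.cartesian_product')
  finally have "(\<Sum>u\<in>idx k. \<Sum>x\<in>idx j. \<bar>P x u - Q x u\<bar>)\<^sup>2 \<le> 2 * ((real k - 1) * C)"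
    using KL by linarith
  then have "(\<Sum>u\<in>idx k. \<Sum>x\<in>idx j. \<bar>P x u - Q x u\<bar>) \<le> sqrt (2 * ((real k - 1) * C))"
    by (rule real_le_rsqrt)
  also have "2 * ((real k - 1) * C) = 2 * (real k - 1)\<^sup>2 * ln (real CARD('a)) / (real N - real k + 1)"
    by (simp add: C_def power2_eq_square mult_ac)
  finally show ?thesis by (simp add: P_def Q_def c_def j_def outcomes_def)
qed

end

theorem theoremA1:
  fixes \<Gamma> :: "'a::finite list op" and N :: nat
  assumes "symmetric_state N \<Gamma>"
  shows "\<forall>k. 1 \<le> k \<and> k \<le> N \<longrightarrow>
    (\<exists>\<mu> :: 'a op measure.
       prob_space \<mu> \<and> space \<mu> = states (UNIV :: 'a set) \<and>
       sets \<mu> = sets (restrict_space borel (states (UNIV :: 'a set))) \<and>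
       (\<forall>\<Lambda>s :: nat \<Rightarrow> 'a meas. (\<forall>i<k. one_measurement (\<Lambda>s i)) \<longrightarrow>
          trace_norm (idx k)
            (tensor_meas_apply k \<Lambda>s (\<lambda>xs ys. rdm N k \<Gamma> xs ys - tpow_integral k \<mu> xs ys))
          \<le> sqrt (2 * (real k - 1)^2 * ln (real CARD('a)) / (real N - real k + 1))))"
proof (intro allI impI)
  fix k assume k: "1 \<le> k \<and> k \<le> N"
  define n where "n = N - k + 1"
  have n: "0 < n" "n \<le> N" using k by (auto simp: n_def)
  obtain Ls where Ls: "length Ls < n" "\<And>K. K \<in> set Ls \<Longrightarrow> povm1 K"
    "\<And>K. povm1 K \<Longrightarrow> (\<Sum>x\<in>idx (length Ls). (\<Sum>y\<in>UNIV. info_potential N \<Gamma> n (outcomes ((!) Ls) x @ [K y]))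
        - info_potential N \<Gamma> n (outcomes ((!) Ls) x)) \<le> real (N - n) * ln (real CARD('a)) / real n"
    using small_increment_exists[OF assms n] by blast
  define j where "j = length Ls"
  define m where "m x = outcomes ((!) Ls) x" for x
  define p where "p x = joint_prob N \<Gamma> (m x)" for x
  \<comment> \<open>A history of probability 0 has no conditional state. It gets the unconditioned
    one-particle state, from the empty history of probability 1; its weight \<open>p x\<close> is 0,
    so the mixture is unaffected.\<close>
  define \<gamma> where "\<gamma> x = cond_state N \<Gamma> (if x \<in> idx j \<and> p x > 0 then m x else [])" for x
  \<comment> \<open>The history uses at most \<open>N - k\<close> particles and leaves
    \<open>k\<close> to be measured.\<close>
  have jN: "j < N" "j + k \<le> N" using Ls(1) n k by (auto simp: j_def n_def)
  have mx: "set (m x) \<subseteq> effects" "length (m x) = j" if "x \<in> idx j" for x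
    using outcomes_effects[of x "(!) Ls"] Ls(2) that by (auto simp: m_def idx_def j_def)
  have p0: "0 \<le> p x" if "x \<in> idx j" for x
    unfolding p_def using mx[OF that] jN by (intro contrL_joint_prob[OF assms]) auto
  have p1: "sum p (idx j) = 1"
    using joint_prob_outcomes_sum[OF assms, of j "(!) Ls" "[]"] Ls jN
    by (simp add: p_def[abs_def] m_def j_def joint_prob_Nil[OF assms])
  have \<gamma>S: "\<gamma> x \<in> states UNIV" for x
    unfolding \<gamma>_def using mx[of x] jN by (intro cond_state_states[OF assms]) (auto simp: p_def joint_prob_Nil[OF assms])
  obtain \<mu> where \<mu>: "prob_space \<mu>" "space \<mu> = states (UNIV :: 'a set)"
    "sets \<mu> = sets (restrict_space borel (states (UNIV :: 'a set)))"
    "\<And>k xs ys. tpow_integral k \<mu> xs ys = (\<Sum>x\<in>idx j. of_real (p x) * tpow k (\<gamma> x) xs ys)"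
    using finite_mixture_exists[of "idx j" p \<gamma>] p0 p1 \<gamma>S finite_idx by blast
  have "trace_norm (idx k)
            (tensor_meas_apply k \<Lambda>s (\<lambda>xs ys. rdm N k \<Gamma> xs ys - tpow_integral k \<mu> xs ys))
          \<le> sqrt (2 * (real k - 1)^2 * ln (real CARD('a)) / (real N - real k + 1))"
    if \<Lambda>s: "\<forall>i<k. one_measurement (\<Lambda>s i)" for \<Lambda>s :: "nat \<Rightarrow> 'a meas"
  proof -
    define L where "L l = fst (\<Lambda>s l)" for l
    have L: "povm1 (L l)" if "l < k" for l
      using \<Lambda>s that by (simp add: one_measurement_def is_measurement_def povm1_def povm_def L_def)
    have "cmod (tr (idx k) (mmult (idx k) (tens (outcomes L u)) (\<lambda>xs ys. rdm N k \<Gamma> xs ys - tpow_integral k \<mu> xs ys)))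
       \<le> (\<Sum>x\<in>idx j. \<bar>joint_prob N \<Gamma> (m x @ outcomes L u) -
          p x * (\<Prod>i<k. joint_prob N \<Gamma> (m x @ [L i (u ! i)]) / p x)\<bar>)" if u: "u \<in> idx k" for u
    proof -
      let ?t = "\<lambda>X. tr (idx k) (mmult (idx k) (tens (outcomes L u)) X)"
      have lu: "length u = k" using u by (simp add: idx_def)
      have out: "set (outcomes L u) \<subseteq> effects" using L lu by (intro outcomes_effects) auto
      \<comment> \<open>Law of total probability: measuring the history on \<open>j\<close> further
        particles and summing over its outcomes changes nothing. This is how the unconditioned
        reduced state acquires the same sum over \<open>x\<close> as the mixture.\<close>
      have "joint_prob N \<Gamma> (outcomes L u) = (\<Sum>x\<in>idx j. joint_prob N \<Gamma> (outcomes L u @ m x))"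
        using joint_prob_outcomes_sum[OF assms, of j "(!) Ls" "outcomes L u"] Ls jN lu
        by (simp add: m_def j_def)
      also have "\<dots> = (\<Sum>x\<in>idx j. joint_prob N \<Gamma> (m x @ outcomes L u))"
        using mx lu jN by (intro sum.cong refl joint_prob_mset[OF assms]) auto
      finally have 1: "?t (rdm N k \<Gamma>) = of_real (\<Sum>x\<in>idx j. joint_prob N \<Gamma> (m x @ outcomes L u))"
        using tr_rdm_outcomes[OF assms u _ L] k by simp
      have "?t (tpow_integral k \<mu>) = (\<Sum>x\<in>idx j. of_real (p x) * ?t (tpow k (\<gamma> x)))"
      proof -
        have "?t (tpow_integral k \<mu>) = (\<Sum>xs\<in>idx k. \<Sum>ys\<in>idx k. \<Sum>x\<in>idx j. of_real (p x) * (tens (outcomes L u) xs ys * tpow k (\<gamma> x) ys xs))"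
          unfolding tr_def mmult_def \<mu>(4) sum_distrib_left by (simp add: mult_ac)
        also have "\<dots> = (\<Sum>xs\<in>idx k. \<Sum>x\<in>idx j. \<Sum>ys\<in>idx k. of_real (p x) * (tens (outcomes L u) xs ys * tpow k (\<gamma> x) ys xs))"
          by (intro sum.cong refl sum.swap)
        also have "\<dots> = (\<Sum>x\<in>idx j. \<Sum>xs\<in>idx k. \<Sum>ys\<in>idx k. of_real (p x) * (tens (outcomes L u) xs ys * tpow k (\<gamma> x) ys xs))"
          by (rule sum.swap)
        finally show ?thesis by (simp add: tr_def mmult_def sum_distrib_left)
      qed
      also have "\<dots> = (\<Sum>x\<in>idx j. of_real (p x * (\<Prod>i<k. joint_prob N \<Gamma> (m x @ [L i (u ! i)]) / p x)))"
      proof (intro sum.cong refl)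
        fix x :: "'a list" assume x: "x \<in> idx j"
        show "of_real (p x) * ?t (tpow k (\<gamma> x)) = of_real (p x * (\<Prod>i<k. joint_prob N \<Gamma> (m x @ [L i (u ! i)]) / p x))"
        proof (cases "p x = 0")
          case False
          then have "\<gamma> x = cond_state N \<Gamma> (m x)" using p0[OF x] x by (simp add: \<gamma>_def)
          moreover have "tr UNIV (mmult UNIV (L i (u ! i)) (cond_state N \<Gamma> (m x))) = of_real (joint_prob N \<Gamma> (m x @ [L i (u ! i)]) / p x)"
            if "i < k" for i
            unfolding p_def using mx[OF x] jN L[OF that]
            by (intro tr_cond_state_effect[OF assms]) (auto simp: effects_def)
          ultimately show ?thesis by (simp add: tr_tens_tpow[OF u])
        qed simp
      qed
      finally have 2: "?t (tpow_integral k \<mu>) = of_real (\<Sum>x\<in>idx j. p x * (\<Prod>i<k. joint_prob N \<Gamma> (m x @ [L i (u ! i)]) / p x))"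
        by simp
      have "?t (\<lambda>xs ys. rdm N k \<Gamma> xs ys - tpow_integral k \<mu> xs ys) = ?t (rdm N k \<Gamma>) - ?t (tpow_integral k \<mu>)"
        by (simp add: tr_def mmult_def right_diff_distrib sum_subtractf)
      also have "\<dots> = of_real (\<Sum>x\<in>idx j. joint_prob N \<Gamma> (m x @ outcomes L u) -
          p x * (\<Prod>i<k. joint_prob N \<Gamma> (m x @ [L i (u ! i)]) / p x))"
        unfolding 1 2 by (simp add: sum_subtractf)
      finally show ?thesis by (simp only: norm_of_real sum_abs)
    qed
    then have "trace_norm (idx k) (tensor_meas_apply k \<Lambda>s (\<lambda>xs ys. rdm N k \<Gamma> xs ys - tpow_integral k \<mu> xs ys)) \<le>
      (\<Sum>u\<in>idx k. \<Sum>x\<in>idx j. \<bar>joint_prob N \<Gamma> (m x @ outcomes L u) -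
          p x * (\<Prod>i<k. joint_prob N \<Gamma> (m x @ [L i (u ! i)]) / p x)\<bar>)"
      using \<Lambda>s by (subst trace_norm_tensor_meas_apply) (auto simp: L_def[abs_def] intro!: sum_mono)
    also have "\<dots> \<le> sqrt (2 * (real k - 1)^2 * ln (real CARD('a)) / (real N - real k + 1))"
      unfolding j_def p_def m_def using k L
      by (intro conditional_product_distance[OF assms _ _ n_def Ls]) auto
    finally show ?thesis .
  qed
  then show "\<exists>\<mu> :: 'a op measure.
       prob_space \<mu> \<and> space \<mu> = states (UNIV :: 'a set) \<and>
       sets \<mu> = sets (restrict_space borel (states (UNIV :: 'a set))) \<and>
       (\<forall>\<Lambda>s :: nat \<Rightarrow> 'a meas. (\<forall>i<k. one_measurement (\<Lambda>s i)) \<longrightarrow>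
          trace_norm (idx k)
            (tensor_meas_apply k \<Lambda>s (\<lambda>xs ys. rdm N k \<Gamma> xs ys - tpow_integral k \<mu> xs ys))
          \<le> sqrt (2 * (real k - 1)^2 * ln (real CARD('a)) / (real N - real k + 1)))"
    using \<mu>(1,2,3) by blast
qed

end
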